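(* Let $A$ be an artinian local ring with infinite residue field, let $S$ be a finitely generated standard $\mathbb{N}^d$-graded algebra over $A$ and let $M$ be a finitely generated $\mathbb{N}^d$-graded $S$-module. Let $\mathbf{k}\in\mathbb{N}^d$ and let $\mathbf{x}$ be a mixed multiplicity system of $M$ of the type $\mathbf{k}$. Assume that $\dim \mathrm{Supp}_{++}M \le |\mathbf{k}|$. Then $$E(M;\mathbf{k})=\chi(\mathbf{x},M)=\widetilde{e}(\mathbf{x},M).$$
   Context: Notation: $\mathbf{e}_i=(0,\dots,1,\dots,0)\in\mathbb{N}^d$ (1 in position $i$), $\mathbf 0=(0,\dots,0)$, $\mathbf 1=(1,\dots,1)$, $|\mathbf k|=k_1+\dots+k_d$, $\mathbf k!=k_1!\cdots k_d!$, $\mathbf n^{\mathbf k}=n_1^{k_1}\cdots n_d^{k_d}$; "for all large $\mathbf n$" ($\mathbf n\gg 0$) means for all $\mathbf n\ge \mathbf v$ componentwise for some $\mathbf v$. "Standard" means $S_{\mathbf 0}=A$ and $S$ is generated as an $A$-algebra by $S_i:=S_{\mathbf e_i}$, $i=1,\dots,d$. Put $S_{++}=\bigoplus_{\mathbf n\ge\mathbf 1}S_{\mathbf n}$, $\mathrm{Proj}\,S$ = set of homogeneous primes of $S$ not containing $S_{++}$, and $\mathrm{Supp}_{++}M=\{P\in\mathrm{Proj}\,S: M_P\neq0\}$; its dimension is taken to be $-\infty$ if it is empty. For a finitely generated $\mathbb{N}^d$-graded $S$-module $F$ there is a polynomial $P_F(\mathbf n)$ (the Hilbert polynomial) with $\ell_A(F_{\mathbf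 n})=P_F(\mathbf n)$ for all large $\mathbf n$, and $\deg P_F=\dim\mathrm{Supp}_{++}F$ (zero polynomial has degree $-\infty$). If $s=\dim\mathrm{Supp}_{++}M\ge0$, the terms of total degree $s$ of $P_M$ are written $\sum_{|\mathbf k|=s}e(M;\mathbf k)\mathbf n^{\mathbf k}/\mathbf k!$; $e(M;\mathbf k)$ is the mixed multiplicity of $M$ of type $\mathbf k$. For $|\mathbf k|\ge\dim\mathrm{Supp}_{++}M$ set $E(M;\mathbf k)=e(M;\mathbf k)$ if $|\mathbf k|=\dim\mathrm{Supp}_{++}M$ and $E(M;\mathbf k)=0$ if $|\mathbf k|>\dim\mathrm{Supp}_{++}M$. A sequence $\mathbf x=x_1,\dots,x_n$ of elements of $\bigcup_{j=1}^dS_j$ consisting of $m_1$ elements of $S_1,\dots,m_d$ elements of $S_d$ is a mixed multiplicity system of $M$ of type $\mathbf m=(m_1,\dots,m_d)$ if $\dim\mathrm{Supp}_{++}(M/\mathbf xM)\le0$ (with $\mathbf xM=0$ if $\mathbf x$ is empty). For such $\mathbf x$, with $H_i(\mathbf x,M)$ the homology of the ($\mathbb N^d$-graded) Koszul complex of $M$ with respect to $\mathbf x$, the integer $\sum_{i=0}^n(-1)^i\ell_A(H_i(\mathbf x,M)_{\mathbf n})$ is constant for all large $\mathbf n$; this constant is the Euler–Poincaré characteristic $\chi(\mathbf x,M)$. The mixed multiplicity symbol $\widetilde e(\mathbf x,M)$ is defined recursively: if $n=0$, $\ell_A(M_{\mathbf n})=c$ is constant for large $\mathbf n$ and $\widetilde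 e(\emptyset,M)=c$; if $n>0$, $\widetilde e(\mathbf x,M)=\widetilde e(\mathbf x',M/x_1M)-\widetilde e(\mathbf x',0_M:x_1)$ where $\mathbf x'=x_2,\dots,x_n$ (which is a mixed multiplicity system of both $M/x_1M$ and $0_M:x_1$). *)

theory Defs
  imports Complex_Main "HOL-Library.Extended_Real" "HOL-Library.Function_Algebras"
begin

text \<open>Conventions. The ambient ring S is the whole type 'a (a commutative ring),
  graded by Sg :: ('d \<Rightarrow> nat) \<Rightarrow> 'a set with 'd a finite index type
  (so N^d = 'd \<Rightarrow> nat, ordered componentwise). A = Sg 0. The module M is the
  whole type 'm with scalar action act and grading Mg. Subquotients N/L of M
  are represented by pairs of sets (N, L).\<close>

definition add_subgroup :: "'v::ab_group_add set \<Rightarrow> bool" where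
  "add_subgroup U \<longleftrightarrow> 0 \<in> U \<and> (\<forall>x\<in>U. \<forall>y\<in>U. x + y \<in> U) \<and> (\<forall>x\<in>U. - x \<in> U)"

definition unit_vec :: "'d \<Rightarrow> 'd \<Rightarrow> nat" where
  "unit_vec i = (\<lambda>j. if j = i then 1 else 0)"

definition zero_deg :: "'d \<Rightarrow> nat" where
  "zero_deg = (\<lambda>j. 0)"

definition add_deg :: "('d \<Rightarrow> nat) \<Rightarrow> ('d \<Rightarrow> nat) \<Rightarrow> 'd \<Rightarrow> nat" where
  "add_deg m n = (\<lambda>j. m j + n j)"

definition direct_sum_decomp :: "(('d \<Rightarrow> nat) \<Rightarrow> 'v::ab_group_add set) \<Rightarrow> bool" where
  "direct_sum_decomp G \<longleftrightarrow>
     (\<forall>x. \<exists>!f. finite {n. f n \<noteq> 0} \<and> (\<forall>n. f n \<in> G n) \<and> x = (\<Sum>n\<in>{n. f n \<noteq> 0}. f n))"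

definition graded_ring :: "(('d \<Rightarrow> nat) \<Rightarrow> 'a::comm_ring_1 set) \<Rightarrow> bool" where
  "graded_ring Sg \<longleftrightarrow> (\<forall>n. add_subgroup (Sg n)) \<and> 1 \<in> Sg zero_deg \<and>
     (\<forall>m n a b. a \<in> Sg m \<longrightarrow> b \<in> Sg n \<longrightarrow> a * b \<in> Sg (add_deg m n)) \<and>
     direct_sum_decomp Sg"

inductive_set gen_alg :: "'a::comm_ring_1 set \<Rightarrow> 'a set \<Rightarrow> 'a set" for A G where
  base: "a \<in> A \<Longrightarrow> a \<in> gen_alg A G"
| gen: "g \<in> G \<Longrightarrow> g \<in> gen_alg A G"
| add: "x \<in> gen_alg A G \<Longrightarrow> y \<in> gen_alg A G \<Longrightarrow> x + y \<in> gen_alg A G"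
| mult: "x \<in> gen_alg A G \<Longrightarrow> y \<in> gen_alg A G \<Longrightarrow> x * y \<in> gen_alg A G"
| neg: "x \<in> gen_alg A G \<Longrightarrow> - x \<in> gen_alg A G"

definition standard_graded_algebra :: "(('d \<Rightarrow> nat) \<Rightarrow> 'a::comm_ring_1 set) \<Rightarrow> bool" where
  "standard_graded_algebra Sg \<longleftrightarrow> graded_ring Sg \<and>
     gen_alg (Sg zero_deg) (\<Union>i. Sg (unit_vec i)) = UNIV"

definition fg_algebra :: "(('d \<Rightarrow> nat) \<Rightarrow> 'a::comm_ring_1 set) \<Rightarrow> bool" where
  "fg_algebra Sg \<longleftrightarrow> (\<exists>G. finite G \<and> gen_alg (Sg zero_deg) G = UNIV)"

definition ideal_in :: "'a::comm_ring_1 set \<Rightarrow> 'a set \<Rightarrow> bool" where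
  "ideal_in A I \<longleftrightarrow> I \<subseteq> A \<and> add_subgroup I \<and> (\<forall>a\<in>A. \<forall>x\<in>I. a * x \<in> I)"

definition maximal_ideal_in :: "'a::comm_ring_1 set \<Rightarrow> 'a set \<Rightarrow> bool" where
  "maximal_ideal_in A m \<longleftrightarrow> ideal_in A m \<and> m \<noteq> A \<and>
     (\<forall>J. ideal_in A J \<longrightarrow> m \<subseteq> J \<longrightarrow> J = m \<or> J = A)"

definition artinian_local_inf_residue :: "'a::comm_ring_1 set \<Rightarrow> bool" where
  "artinian_local_inf_residue A \<longleftrightarrow>
     (\<exists>!m. maximal_ideal_in A m) \<and>
     \<not> (\<exists>f :: nat \<Rightarrow> 'a set. \<forall>n. ideal_in A (f n) \<and> f (Suc n) \<subset> f n) \<and>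
     (\<forall>m. maximal_ideal_in A m \<longrightarrow> infinite ((\<lambda>a. {a + y | y. y \<in> m}) ` A))"

definition module_act :: "('a::comm_ring_1 \<Rightarrow> 'm::ab_group_add \<Rightarrow> 'm) \<Rightarrow> bool" where
  "module_act act \<longleftrightarrow> (\<forall>a b x. act (a + b) x = act a x + act b x) \<and>
     (\<forall>a x y. act a (x + y) = act a x + act a y) \<and>
     (\<forall>a b x. act (a * b) x = act a (act b x)) \<and> (\<forall>x. act 1 x = x)"

definition graded_module :: "(('d \<Rightarrow> nat) \<Rightarrow> 'a::comm_ring_1 set) \<Rightarrow> ('a \<Rightarrow> 'm::ab_group_add \<Rightarrow> 'm)
    \<Rightarrow> (('d \<Rightarrow> nat) \<Rightarrow> 'm set) \<Rightarrow> bool" where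
  "graded_module Sg act Mg \<longleftrightarrow> module_act act \<and> (\<forall>n. add_subgroup (Mg n)) \<and>
     (\<forall>m n a x. a \<in> Sg m \<longrightarrow> x \<in> Mg n \<longrightarrow> act a x \<in> Mg (add_deg m n)) \<and>
     direct_sum_decomp Mg"

definition fg_module :: "('a::comm_ring_1 \<Rightarrow> 'm::ab_group_add \<Rightarrow> 'm) \<Rightarrow> bool" where
  "fg_module act \<longleftrightarrow> (\<exists>G. finite G \<and> (\<forall>x. \<exists>c. x = (\<Sum>g\<in>G. act (c g) g)))"

definition A_submodule :: "'a set \<Rightarrow> ('a \<Rightarrow> 'v::ab_group_add \<Rightarrow> 'v) \<Rightarrow> 'v set \<Rightarrow> bool" where
  "A_submodule A act U \<longleftrightarrow> add_subgroup U \<and> (\<forall>a\<in>A. \<forall>x\<in>U. act a x \<in> U)"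

definition length_sq :: "'a set \<Rightarrow> ('a \<Rightarrow> 'v::ab_group_add \<Rightarrow> 'v) \<Rightarrow> 'v set \<Rightarrow> 'v set \<Rightarrow> enat" where
  "length_sq A act N L = Sup {enat (length C - 1) | C. C \<noteq> [] \<and> hd C = L \<and> last C = N \<and>
      (\<forall>U\<in>set C. A_submodule A act U) \<and> sorted_wrt (\<subset>) C}"

definition hlen :: "(('d \<Rightarrow> nat) \<Rightarrow> 'a::comm_ring_1 set) \<Rightarrow> ('a \<Rightarrow> 'm::ab_group_add \<Rightarrow> 'm)
    \<Rightarrow> (('d \<Rightarrow> nat) \<Rightarrow> 'm set) \<Rightarrow> 'm set \<Rightarrow> 'm set \<Rightarrow> ('d \<Rightarrow> nat) \<Rightarrow> enat" where
  "hlen Sg act Mg N L v = length_sq (Sg zero_deg) act (N \<inter> Mg v) (L \<inter> Mg v)"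

definition prime_ideal :: "'a::comm_ring_1 set \<Rightarrow> bool" where
  "prime_ideal P \<longleftrightarrow> add_subgroup P \<and> (\<forall>a x. x \<in> P \<longrightarrow> a * x \<in> P) \<and> P \<noteq> UNIV \<and>
     (\<forall>a b. a * b \<in> P \<longrightarrow> a \<in> P \<or> b \<in> P)"

definition homogeneous_ideal :: "(('d \<Rightarrow> nat) \<Rightarrow> 'a::comm_ring_1 set) \<Rightarrow> 'a set \<Rightarrow> bool" where
  "homogeneous_ideal Sg P \<longleftrightarrow> (\<forall>x\<in>P. \<exists>f. finite {n. f n \<noteq> 0} \<and> (\<forall>n. f n \<in> Sg n \<inter> P) \<and>
      x = (\<Sum>n\<in>{n. f n \<noteq> 0}. f n))"

definition S_pp :: "(('d \<Rightarrow> nat) \<Rightarrow> 'a::comm_ring_1 set) \<Rightarrow> 'a set" where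
  "S_pp Sg = {x. \<exists>f. finite {n. f n \<noteq> 0} \<and> (\<forall>n. f n \<in> Sg n) \<and>
      (\<forall>n. f n \<noteq> 0 \<longrightarrow> (\<forall>i. 1 \<le> n i)) \<and> x = (\<Sum>n\<in>{n. f n \<noteq> 0}. f n)}"

definition Proj :: "(('d \<Rightarrow> nat) \<Rightarrow> 'a::comm_ring_1 set) \<Rightarrow> 'a set set" where
  "Proj Sg = {P. prime_ideal P \<and> homogeneous_ideal Sg P \<and> \<not> S_pp Sg \<subseteq> P}"

text \<open>(N/L)_P \<noteq> 0 iff some class x + L (x \<in> N) does not become 0 in the localization,
  i.e. s x \<notin> L for all s \<notin> P.\<close>
definition Supp_pp :: "(('d \<Rightarrow> nat) \<Rightarrow> 'a::comm_ring_1 set) \<Rightarrow> ('a \<Rightarrow> 'm::ab_group_add \<Rightarrow> 'm)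
    \<Rightarrow> 'm set \<Rightarrow> 'm set \<Rightarrow> 'a set set" where
  "Supp_pp Sg act N L = {P \<in> Proj Sg. \<exists>x\<in>N. \<forall>s. s \<notin> P \<longrightarrow> act s x \<notin> L}"

definition dim_supp :: "(('d \<Rightarrow> nat) \<Rightarrow> 'a::comm_ring_1 set) \<Rightarrow> ('a \<Rightarrow> 'm::ab_group_add \<Rightarrow> 'm)
    \<Rightarrow> 'm set \<Rightarrow> 'm set \<Rightarrow> ereal" where
  "dim_supp Sg act N L = (if Supp_pp Sg act N L = {} then - \<infinity> else
      Sup {ereal (real (length C - 1)) | C. C \<noteq> [] \<and> set C \<subseteq> Supp_pp Sg act N L \<and>
         sorted_wrt (\<subset>) C})"

definition hilb_coeff :: "(('d::finite \<Rightarrow> nat) \<Rightarrow> 'a::comm_ring_1 set) \<Rightarrow> ('a \<Rightarrow> 'm::ab_group_add \<Rightarrow> 'm)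
    \<Rightarrow> (('d \<Rightarrow> nat) \<Rightarrow> 'm set) \<Rightarrow> ('d \<Rightarrow> nat) \<Rightarrow> real" where
  "hilb_coeff Sg act Mg = (THE c. finite {k. c k \<noteq> 0} \<and>
     (\<exists>v. \<forall>n. v \<le> n \<longrightarrow> (\<exists>m. hlen Sg act Mg UNIV {0} n = enat m \<and>
        real m = (\<Sum>k\<in>{k. c k \<noteq> 0}. c k * (\<Prod>i\<in>UNIV. real (n i) ^ k i)))))"

definition mixed_mult :: "(('d::finite \<Rightarrow> nat) \<Rightarrow> 'a::comm_ring_1 set) \<Rightarrow> ('a \<Rightarrow> 'm::ab_group_add \<Rightarrow> 'm)
    \<Rightarrow> (('d \<Rightarrow> nat) \<Rightarrow> 'm set) \<Rightarrow> ('d \<Rightarrow> nat) \<Rightarrow> real" where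
  "mixed_mult Sg act Mg k = hilb_coeff Sg act Mg k * (\<Prod>i\<in>UNIV. fact (k i))"

text \<open>E(M;k), meaningful for |k| \<ge> dim Supp_{++} M.\<close>
definition EE :: "(('d::finite \<Rightarrow> nat) \<Rightarrow> 'a::comm_ring_1 set) \<Rightarrow> ('a \<Rightarrow> 'm::ab_group_add \<Rightarrow> 'm)
    \<Rightarrow> (('d \<Rightarrow> nat) \<Rightarrow> 'm set) \<Rightarrow> ('d \<Rightarrow> nat) \<Rightarrow> real" where
  "EE Sg act Mg k = (if ereal (real (\<Sum>i\<in>UNIV. k i)) = dim_supp Sg act UNIV {0}
      then mixed_mult Sg act Mg k else 0)"

definition seq_mult :: "('a \<Rightarrow> 'm::ab_group_add \<Rightarrow> 'm) \<Rightarrow> 'a list \<Rightarrow> 'm set \<Rightarrow> 'm set" where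
  "seq_mult act xs N = {(\<Sum>j<length xs. act (xs ! j) (m j)) | m. \<forall>j. m j \<in> N}"

definition mms :: "(('d::finite \<Rightarrow> nat) \<Rightarrow> 'a::comm_ring_1 set) \<Rightarrow> ('a \<Rightarrow> 'm::ab_group_add \<Rightarrow> 'm)
    \<Rightarrow> 'a list \<Rightarrow> 'd list \<Rightarrow> ('d \<Rightarrow> nat) \<Rightarrow> bool" where
  "mms Sg act xs ds k \<longleftrightarrow> length ds = length xs \<and>
     (\<forall>j<length xs. xs ! j \<in> Sg (unit_vec (ds ! j))) \<and>
     (\<forall>i. length (filter (\<lambda>j. j = i) ds) = k i) \<and>
     dim_supp Sg act UNIV (seq_mult act xs UNIV) \<le> 0"

text \<open>Degree of the basis element e_I of the Koszul complex.\<close>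
definition kdeg :: "'d list \<Rightarrow> nat set \<Rightarrow> 'd \<Rightarrow> nat" where
  "kdeg ds I = (\<lambda>i. card {j\<in>I. ds ! j = i})"

text \<open>Degree-v part of K_i(x, N): functions on i-subsets I of {0..<n} with values in
  N \<inter> M_{v - deg e_I} (zero when deg e_I is not \<le> v).\<close>
definition kos_piece :: "(('d \<Rightarrow> nat) \<Rightarrow> 'm::ab_group_add set) \<Rightarrow> 'a list \<Rightarrow> 'd list \<Rightarrow> 'm set
    \<Rightarrow> nat \<Rightarrow> ('d \<Rightarrow> nat) \<Rightarrow> (nat set \<Rightarrow> 'm) set" where
  "kos_piece Mg xs ds N i v = {f. \<forall>I. if I \<subseteq> {..<length xs} \<and> card I = i \<and> kdeg ds I \<le> v
      then f I \<in> N \<inter> Mg (\<lambda>t. v t - kdeg ds I t) else f I = 0}"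

definition kos_d :: "('a \<Rightarrow> 'm::ab_group_add \<Rightarrow> 'm) \<Rightarrow> 'a list \<Rightarrow> (nat set \<Rightarrow> 'm) \<Rightarrow> nat set \<Rightarrow> 'm" where
  "kos_d act xs f = (\<lambda>J. \<Sum>j\<in>{..<length xs} - J.
      (if even (card {t\<in>J. t < j}) then act (xs ! j) (f (insert j J))
       else - act (xs ! j) (f (insert j J))))"

definition kos_hlen :: "(('d \<Rightarrow> nat) \<Rightarrow> 'a::comm_ring_1 set) \<Rightarrow> ('a \<Rightarrow> 'm::ab_group_add \<Rightarrow> 'm)
    \<Rightarrow> (('d \<Rightarrow> nat) \<Rightarrow> 'm set) \<Rightarrow> 'a list \<Rightarrow> 'd list \<Rightarrow> 'm set \<Rightarrow> 'm set \<Rightarrow> nat \<Rightarrow> ('d \<Rightarrow> nat) \<Rightarrow> enat" where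
  "kos_hlen Sg act Mg xs ds N L i v =
     length_sq (Sg zero_deg) (\<lambda>a f I. act a (f I))
       {f \<in> kos_piece Mg xs ds N i v. \<forall>J. kos_d act xs f J \<in> L}
       {(\<lambda>J. kos_d act xs g J + h J) | g h. g \<in> kos_piece Mg xs ds N (Suc i) v \<and> h \<in> kos_piece Mg xs ds L i v}"

definition chi :: "(('d \<Rightarrow> nat) \<Rightarrow> 'a::comm_ring_1 set) \<Rightarrow> ('a \<Rightarrow> 'm::ab_group_add \<Rightarrow> 'm)
    \<Rightarrow> (('d \<Rightarrow> nat) \<Rightarrow> 'm set) \<Rightarrow> 'a list \<Rightarrow> 'd list \<Rightarrow> 'm set \<Rightarrow> 'm set \<Rightarrow> int" where
  "chi Sg act Mg xs ds N L = (THE c. \<exists>v. \<forall>n. v \<le> n \<longrightarrow>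
     (\<forall>i\<le>length xs. kos_hlen Sg act Mg xs ds N L i n \<noteq> \<infinity>) \<and>
     (\<Sum>i\<le>length xs. (-1) ^ i * int (the_enat (kos_hlen Sg act Mg xs ds N L i n))) = c)"

fun mm_symbol :: "(('d \<Rightarrow> nat) \<Rightarrow> 'a::comm_ring_1 set) \<Rightarrow> ('a \<Rightarrow> 'm::ab_group_add \<Rightarrow> 'm)
    \<Rightarrow> (('d \<Rightarrow> nat) \<Rightarrow> 'm set) \<Rightarrow> 'a list \<Rightarrow> 'm set \<Rightarrow> 'm set \<Rightarrow> int" where
  "mm_symbol Sg act Mg [] N L = int (THE c. \<exists>v. \<forall>n. v \<le> n \<longrightarrow> hlen Sg act Mg N L n = enat c)"
| "mm_symbol Sg act Mg (x # xs) N L =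
     mm_symbol Sg act Mg xs N {l + act x m | l m. l \<in> L \<and> m \<in> N}
     - mm_symbol Sg act Mg xs {m \<in> N. act x m \<in> L} L"

end

theory Submission
  imports Defs "HOL-Library.FuncSet"
begin

text \<open>
  Write $h$ for the Hilbert function of $M$. Both \<open>chi\<close> and \<open>mm_symbol\<close> are the eventually constant
  value of the iterated difference $\Delta^{\mathbf k} h$. For the Koszul complex this is the
  Euler characteristic of a finite complex of modules of finite length, whose terms are shifts of
  copies of $M$. For the symbol it is the exact sequence
  $0 \to (0 : x) \to M \to M \to M/xM \to 0$, where only the final subquotients, whose support has
  dimension at most $0$, need an eventually constant Hilbert function.

  It remains that $h$ is eventually a polynomial of degree at most $\dim \mathrm{Supp}_{++} M$.
  By Noetherian induction one reduces to subquotients $U/L$ generated by one homogeneous element with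
  a homogeneous prime annihilator $P$. If $P \supseteq S_{++}$, then $U/L$ vanishes in large degrees. Otherwise
  every $S_i$ contains some $y_i \notin P$, which is injective on $U/L$; all chains in the support of
  $U/(L + y_i U)$ extend by $P$, so by induction on the dimension every partial difference of $h$ is a
  polynomial, and $h$ is recovered by discrete integration.

  Since $|\mathbf k| \ge \dim \mathrm{Supp}_{++} M$, the constant $\Delta^{\mathbf k} h$ is $\mathbf k!$ times the
  coefficient of $\mathbf n^{\mathbf k}$.
\<close>

section \<open>Lengths of subquotients\<close>

text \<open>Quotients never appear as types: a subquotient N/L is a pair of homogeneous submodules
  of the one module M, and the recursion of \<open>mm_symbol\<close> acts on such pairs. What
  survives this recursion is not a bound on the dimension of one quotient M/xM, but a bound on
  chains among the primes in the support of N/L that contain all remaining elements of the sequence.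
  Passing to N/(L + xN) or to (L : x)/L keeps it, because x kills both. Only at the start must it be
  compared with the support of M modulo the whole sequence, and there Nakayama's lemma at a prime
  enters. Dimension and degree carry the same shift: \<open>chain_le t\<close> allows at most t
  primes in a chain, and \<open>poly_fun t\<close> holds the polynomials of degree strictly below t.
  Thus t = 0 means empty support and the zero polynomial, and dimension minus infinity is no
  separate case. Finiteness comes from A: it has finite length over itself, finite length gives the
  ascending chain condition, Hilbert's basis theorem carries this to S and M, and the condition on M
  returns finite length to each graded piece.\<close>

lemma subgroup_minus: "add_subgroup U \<Longrightarrow> x \<in> U \<Longrightarrow> y \<in> U \<Longrightarrow> x - y \<in> U"
  unfolding add_subgroup_def by (metis diff_conv_add_uminus)

lemma subgroup_0: "add_subgroup U \<Longrightarrow> 0 \<in> U"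
  and subgroup_add: "add_subgroup U \<Longrightarrow> x \<in> U \<Longrightarrow> y \<in> U \<Longrightarrow> x + y \<in> U"
  and subgroup_uminus: "add_subgroup U \<Longrightarrow> x \<in> U \<Longrightarrow> - x \<in> U"
  unfolding add_subgroup_def by auto

lemma subgroup_sum: "add_subgroup U \<Longrightarrow> (\<And>i. i \<in> I \<Longrightarrow> f i \<in> U) \<Longrightarrow> sum f I \<in> U"
  by (induction I rule: infinite_finite_induct) (auto simp: subgroup_0 subgroup_add)

definition set_add :: "'v::ab_group_add set \<Rightarrow> 'v set \<Rightarrow> 'v set" where
  "set_add U V = {u + v | u v. u \<in> U \<and> v \<in> V}"

lemma set_add_I: "u \<in> U \<Longrightarrow> v \<in> V \<Longrightarrow> u + v \<in> set_add U V"
  by (auto simp: set_add_def)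

lemma set_add_E: "x \<in> set_add U V \<Longrightarrow> (\<And>u v. x = u + v \<Longrightarrow> u \<in> U \<Longrightarrow> v \<in> V \<Longrightarrow> P) \<Longrightarrow> P"
  by (auto simp: set_add_def)

lemma set_add_left: "0 \<in> V \<Longrightarrow> U \<subseteq> set_add U V"
  using set_add_I by (metis add.right_neutral subsetI)

lemma set_add_right: "0 \<in> U \<Longrightarrow> V \<subseteq> set_add U V"
  using set_add_I by (metis add.left_neutral subsetI)

lemma set_add_mono: "U \<subseteq> U' \<Longrightarrow> V \<subseteq> V' \<Longrightarrow> set_add U V \<subseteq> set_add U' V'"
  by (auto simp: set_add_def)

lemma set_add_least: "add_subgroup W \<Longrightarrow> U \<subseteq> W \<Longrightarrow> V \<subseteq> W \<Longrightarrow> set_add U V \<subseteq> W"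
  by (auto simp: set_add_def subgroup_add subset_iff)

lemma set_add_absorb: "add_subgroup W \<Longrightarrow> 0 \<in> V \<Longrightarrow> V \<subseteq> W \<Longrightarrow> set_add W V = W"
  by (simp add: set_add_left set_add_least subset_antisym)

lemma subgroup_set_add: "add_subgroup U \<Longrightarrow> add_subgroup V \<Longrightarrow> add_subgroup (set_add U V)"
  unfolding add_subgroup_def
proof (intro conjI ballI; elim conjE)
  assume a: "0 \<in> U" "\<forall>x\<in>U. \<forall>y\<in>U. x + y \<in> U" "\<forall>x\<in>U. - x \<in> U"
    "0 \<in> V" "\<forall>x\<in>V. \<forall>y\<in>V. x + y \<in> V" "\<forall>x\<in>V. - x \<in> V"
  show "0 \<in> set_add U V" using set_add_I[OF a(1,4)] by simp
  fix x assume "x \<in> set_add U V"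
  then obtain u v where x: "x = u + v" "u \<in> U" "v \<in> V" by (rule set_add_E)
  have "- x = (- u) + (- v)" using x by simp
  then show "- x \<in> set_add U V" using set_add_I[of "- u" U "- v" V] a x by metis
  fix y assume "y \<in> set_add U V"
  then obtain u' v' where y: "y = u' + v'" "u' \<in> U" "v' \<in> V" by (rule set_add_E)
  have "x + y = (u + u') + (v + v')" using x y by (simp add: algebra_simps)
  then show "x + y \<in> set_add U V" using set_add_I[of "u + u'" U "v + v'" V] a x y by metis
qed

section \<open>Submodules over a set of scalars\<close>

lemma submodule_subgroup: "A_submodule A act U \<Longrightarrow> add_subgroup U"
  and A_submodule_act: "A_submodule A act U \<Longrightarrow> a \<in> A \<Longrightarrow> x \<in> U \<Longrightarrow> act a x \<in> U"
  by (auto simp: A_submodule_def)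

lemma A_submodule_0: "A_submodule A act U \<Longrightarrow> 0 \<in> U"
  by (simp add: submodule_subgroup subgroup_0)

lemma A_submodule_Int: "A_submodule A act U \<Longrightarrow> A_submodule A act V \<Longrightarrow> A_submodule A act (U \<inter> V)"
  unfolding A_submodule_def add_subgroup_def by simp

lemma act_add: "module_act act \<Longrightarrow> act a (x + y) = act a x + act a y"
  and act_add_left: "module_act act \<Longrightarrow> act (a + b) x = act a x + act b x"
  and act_mult: "module_act act \<Longrightarrow> act (a * b) x = act a (act b x)"
  and act_1: "module_act act \<Longrightarrow> act 1 x = x"
  by (auto simp: module_act_def)

lemma act_0: "module_act act \<Longrightarrow> act a 0 = 0"
  using act_add[of act a 0 0] by simp

lemma act_0_left: "module_act act \<Longrightarrow> act 0 x = 0"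
  using act_add_left[of act 0 0 x] by simp

lemma act_minus: "module_act act \<Longrightarrow> act a (- x) = - act a x"
  using act_add[of act a x "- x"] act_0[of act a] by (simp add: eq_neg_iff_add_eq_0 add.commute)

lemma act_minus_left: "module_act act \<Longrightarrow> act (- a) x = - act a x"
  using act_add_left[of act a "- a" x] act_0_left[of act x]
  by (simp add: eq_neg_iff_add_eq_0 add.commute)

lemma act_diff_left: "module_act act \<Longrightarrow> act (a - b) x = act a x - act b x"
  using act_add_left[of act a "- b" x] act_minus_left[of act b x] by simp

lemma act_sum: "module_act act \<Longrightarrow> act a (sum f I) = (\<Sum>i\<in>I. act a (f i))"
  by (induction I rule: infinite_finite_induct) (auto simp: act_0 act_add)

lemma act_sum_left: "module_act act \<Longrightarrow> act (sum f I) x = (\<Sum>i\<in>I. act (f i) x)"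
  by (induction I rule: infinite_finite_induct) (auto simp: act_0_left act_add_left)

lemma A_submodule_set_add:
  assumes "module_act act" "A_submodule A act U" "A_submodule A act V"
  shows "A_submodule A act (set_add U V)"
  unfolding A_submodule_def
proof (intro conjI ballI)
  show "add_subgroup (set_add U V)"
    using assms by (simp add: A_submodule_def subgroup_set_add)
  fix a x assume a: "a \<in> A" and "x \<in> set_add U V"
  then obtain u v where "x = u + v" "u \<in> U" "v \<in> V" by (auto elim: set_add_E)
  then show "act a x \<in> set_add U V"
    using a assms by (auto simp: act_add A_submodule_def intro: set_add_I)
qed

text \<open>The strict chains of \<open>length_sq\<close>, recorded by their number of steps. A
  chain grows at its top, so rule induction removes the largest submodule and leaves the bottom L
  fixed.\<close>

inductive sub_chain :: "'a set \<Rightarrow> ('a \<Rightarrow> 'v::ab_group_add \<Rightarrow> 'v) \<Rightarrow> nat \<Rightarrow> 'v set \<Rightarrow> 'v set \<Rightarrow> bool"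
  for A act where
  sub_chain_0: "A_submodule A act L \<Longrightarrow> sub_chain A act 0 L L"
| sub_chain_Suc: "sub_chain A act n L K \<Longrightarrow> K \<subset> N \<Longrightarrow> A_submodule A act N \<Longrightarrow> sub_chain A act (Suc n) L N"

lemma sub_chain_sub: "sub_chain A act n L N \<Longrightarrow> A_submodule A act L \<and> A_submodule A act N \<and> L \<subseteq> N"
  by (induction rule: sub_chain.induct) auto

lemma sub_chain_trans: "sub_chain A act n K N \<Longrightarrow> sub_chain A act m L K \<Longrightarrow> sub_chain A act (m + n) L N"
  by (induction rule: sub_chain.induct) (auto intro: sub_chain.intros)

lemma list_imp_sub_chain:
  "C \<noteq> [] \<Longrightarrow> \<forall>U\<in>set C. A_submodule A act U \<Longrightarrow> sorted_wrt (\<subset>) C \<Longrightarrow>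
    sub_chain A act (length C - 1) (hd C) (last C)"
proof (induction C rule: rev_induct)
  case (snoc U C)
  show ?case
  proof (cases "C = []")
    case True
    then show ?thesis using snoc by (auto intro: sub_chain.intros)
  next
    case False
    have IH: "sub_chain A act (length C - 1) (hd C) (last C)"
      using snoc False by (auto simp: sorted_wrt_append)
    have "last C \<subset> U" using snoc.prems False by (simp add: sorted_wrt_append)
    from sub_chain_Suc[OF IH this] show ?thesis using snoc.prems False by simp
  qed
qed simp

lemma sub_chain_imp_list:
  "sub_chain A act n L N \<Longrightarrow> \<exists>C. C \<noteq> [] \<and> hd C = L \<and> last C = N \<and>
      (\<forall>U\<in>set C. A_submodule A act U) \<and> sorted_wrt (\<subset>) C \<and> (\<forall>U\<in>set C. U \<subseteq> N) \<and> length C - 1 = n"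
proof (induction rule: sub_chain.induct)
  case (sub_chain_0 L)
  then show ?case by (intro exI[of _ "[L]"]) auto
next
  case (sub_chain_Suc n L K N)
  then obtain C where C: "C \<noteq> []" "hd C = L" "last C = K" "\<forall>U\<in>set C. A_submodule A act U"
      "sorted_wrt (\<subset>) C" "\<forall>U\<in>set C. U \<subseteq> K" "length C - 1 = n" by blast
  from C(1) C(7) have "length C = Suc n" by (cases C) auto
  with C sub_chain_Suc show ?case by (intro exI[of _ "C @ [N]"]) (auto simp: sorted_wrt_append)
qed

lemma length_sq_sub_chain: "length_sq A act N L = Sup {enat n | n. sub_chain A act n L N}"
proof -
  have "{enat (length C - 1) | C. C \<noteq> [] \<and> hd C = L \<and> last C = N \<and>
      (\<forall>U\<in>set C. A_submodule A act U) \<and> sorted_wrt (\<subset>) C} = {enat n | n. sub_chain A act n L N}"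
    using list_imp_sub_chain[of _ A act] sub_chain_imp_list[of A act _ L N] by auto
  then show ?thesis unfolding length_sq_def by simp
qed

lemma sub_chain_exists:
  assumes "A_submodule A act L" "A_submodule A act N" "L \<subseteq> N"
  shows "\<exists>n. sub_chain A act n L N"
  using assms sub_chain_0[of A act L] sub_chain_Suc[OF sub_chain_0[of A act L], of N]
  by (cases "L = N") auto

text \<open>A nonempty set of naturals without an element \<open>>= n\<close> has supremum at most
  \<open>n - 1\<close>. Asking for at least n steps, and not for exactly n, spares the thinning of
  longer chains.\<close>

lemma enat_le_length_sq:
  assumes "A_submodule A act L" "A_submodule A act N" "L \<subseteq> N"
  shows "enat n \<le> length_sq A act N L \<longleftrightarrow> (\<exists>m\<ge>n. sub_chain A act m L N)"
proof
  assume "\<exists>m\<ge>n. sub_chain A act m L N"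
  then obtain m where "m \<ge> n" "sub_chain A act m L N" by auto
  then have "enat m \<le> length_sq A act N L" unfolding length_sq_sub_chain by (auto intro: Sup_upper)
  then show "enat n \<le> length_sq A act N L" using \<open>m \<ge> n\<close> by (meson enat_ord_simps(1) order_trans)
next
  assume *: "enat n \<le> length_sq A act N L"
  show "\<exists>m\<ge>n. sub_chain A act m L N"
  proof (rule ccontr)
    assume no: "\<not> ?thesis"
    obtain m0 where m0: "sub_chain A act m0 L N" using sub_chain_exists[OF assms] by auto
    \<comment> \<open>Some chain exists, so n = 0 is excluded and \<open>n - 1\<close> is a proper
      predecessor.\<close>
    have "n > 0" using m0 no by auto
    have "length_sq A act N L \<le> enat (n - 1)" unfolding length_sq_sub_chain
    proof (intro Sup_least, elim CollectE exE conjE)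
      fix x m assume "x = enat m" "sub_chain A act m L N"
      then have "m < n" using no by (meson not_le)
      then show "x \<le> enat (n - 1)" using \<open>x = enat m\<close> by simp
    qed
    with * have "enat n \<le> enat (n - 1)" by order
    then show False using \<open>n > 0\<close> by simp
  qed
qed

text \<open>An extended natural is determined by the naturals below it; comparing lengths this way
  treats finite and infinite values alike.\<close>

lemma enat_le_iff_all: "(x::enat) \<le> y \<longleftrightarrow> (\<forall>n. enat n \<le> x \<longrightarrow> enat n \<le> y)"
proof (cases x)
  case infinity
  then show ?thesis
  proof (cases y)
    case (enat m) 
    then show ?thesis using infinity by (auto intro!: exI[of _ "Suc m"])
  qed simp
next
  case (enat m)
  then show ?thesis by (metis dual_order.refl order_trans)
qed

lemma enat_le_add_decomp: "enat n \<le> a + b \<longleftrightarrow> (\<exists>p q. n = p + q \<and> enat p \<le> a \<and> enat q \<le> b)"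
proof
  assume "enat n \<le> a + b"
  show "\<exists>p q. n = p + q \<and> enat p \<le> a \<and> enat q \<le> b"
  proof (cases a)
    case (enat i)
    show ?thesis
    proof (cases b)
      case (enat j)
      then show ?thesis using \<open>enat n \<le> a + b\<close> \<open>a = enat i\<close>
        by (intro exI[of _ "min n i"] exI[of _ "n - min n i"]) auto
    next
      case infinity
      then show ?thesis by (intro exI[of _ 0] exI[of _ n]) (auto simp: zero_enat_def[symmetric])
    qed
  next
    case infinity
    then show ?thesis by (intro exI[of _ n] exI[of _ 0]) (auto simp: zero_enat_def[symmetric])
  qed
next
  assume "\<exists>p q. n = p + q \<and> enat p \<le> a \<and> enat q \<le> b"
  then show "enat n \<le> a + b" by (metis add_mono plus_enat_simps(1))
qed

text \<open>Intersecting with and adding \<^term>\<open>K\<close>: by modularity every strict step of the chain stays strict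
  in at least one of the two chains.\<close>
lemma sub_chain_split:
  assumes "module_act act" "A_submodule A act K"
  shows "sub_chain A act n L V \<Longrightarrow> L \<subseteq> K \<Longrightarrow>
    \<exists>p q. n \<le> p + q \<and> sub_chain A act p L (V \<inter> K) \<and> sub_chain A act q K (set_add V K)"
proof (induction rule: sub_chain.induct)
  case (sub_chain_0 L)
  have "L \<inter> K = L" "set_add L K = K"
    using sub_chain_0 set_add_right[of L K] set_add_least[of K L K] submodule_subgroup[OF assms(2)]
      A_submodule_0[of A act L] by auto
  then show ?case using sub_chain.sub_chain_0[OF sub_chain_0(1)] sub_chain.sub_chain_0[OF assms(2)]
    by (intro exI[of _ 0]) auto
next
  case (sub_chain_Suc n L V V')
  then obtain p q where pq: "n \<le> p + q" "sub_chain A act p L (V \<inter> K)" "sub_chain A act q K (set_add V K)" by auto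
  have V: "A_submodule A act V" using sub_chain_sub sub_chain_Suc by blast
  have sub: "A_submodule A act (V' \<inter> K)" "A_submodule A act (set_add V' K)"
    using sub_chain_Suc assms by (auto simp: A_submodule_Int A_submodule_set_add)
  have le: "V \<inter> K \<subseteq> V' \<inter> K" "set_add V K \<subseteq> set_add V' K"
    using sub_chain_Suc set_add_mono[of V V' K K] by auto
  have "V \<inter> K \<noteq> V' \<inter> K \<or> set_add V K \<noteq> set_add V' K"
  proof (rule ccontr)
    assume "\<not> ?thesis"
    then have eq: "V \<inter> K = V' \<inter> K" "set_add V K = set_add V' K" by auto
    have "V' \<subseteq> V"
    proof
      fix x assume x: "x \<in> V'"
      then have "x \<in> set_add V K" using eq set_add_left[of K V'] A_submodule_0[OF assms(2)] by auto
      then obtain v k where vk: "x = v + k" "v \<in> V" "k \<in> K" by (rule set_add_E)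
      have "k = x - v" using vk by simp
      then have "k \<in> V'" using x vk sub_chain_Suc subgroup_minus[of V' x v] unfolding A_submodule_def by blast
      then have "k \<in> V" using eq vk by auto
      then show "x \<in> V" using vk V by (auto simp: A_submodule_def subgroup_add)
    qed
    then show False using sub_chain_Suc by auto
  qed
  then consider "V \<inter> K \<subset> V' \<inter> K" | "V \<inter> K = V' \<inter> K" "set_add V K \<subset> set_add V' K" using le by auto
  then show ?case
  proof cases
    case 1
    have "sub_chain A act (Suc p) L (V' \<inter> K)" using sub_chain.sub_chain_Suc[OF pq(2) 1 sub(1)] .
    moreover have "\<exists>q'\<ge>q. sub_chain A act q' K (set_add V' K)"
    proof (cases "set_add V K = set_add V' K")
      case True
      then show ?thesis using pq(3) by auto
    next
      case False
      then have "set_add V K \<subset> set_add V' K" using le by auto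
      from sub_chain.sub_chain_Suc[OF pq(3) this sub(2)] show ?thesis
        by (intro exI[of _ "Suc q"]) simp
    qed
    then obtain q' where "q' \<ge> q" "sub_chain A act q' K (set_add V' K)" by auto
    ultimately show ?thesis using pq(1) by (intro exI[of _ "Suc p"] exI[of _ q']) auto
  next
    case 2
    have "sub_chain A act (Suc q) K (set_add V' K)" using sub_chain.sub_chain_Suc[OF pq(3) 2(2) sub(2)] .
    then show ?thesis using pq 2 by (intro exI[of _ p] exI[of _ "Suc q"]) auto
  qed
qed

text \<open>A chain from L to N splits at K by \<open>sub_chain_split\<close>, where N meets K in K
  and N + K = N; conversely, chains through K concatenate. Both directions are compared through
  finite lower bounds, so infinite lengths are included.\<close>

lemma length_sq_add:
  assumes M: "module_act act" and sub: "A_submodule A act L" "A_submodule A act K" "A_submodule A act N"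
    and le: "L \<subseteq> K" "K \<subseteq> N"
  shows "length_sq A act N L = length_sq A act N K + length_sq A act K L"
proof -
  have "enat n \<le> length_sq A act N L \<longleftrightarrow> enat n \<le> length_sq A act N K + length_sq A act K L" for n
  proof -
    have LN: "L \<subseteq> N" using le by auto
    note iff = enat_le_length_sq[OF sub(1,3) LN] enat_le_length_sq[OF sub(1,2) le(1)] enat_le_length_sq[OF sub(2,3) le(2)]
    have N: "N \<inter> K = K" "set_add N K = N"
      using le sub A_submodule_0[of A act] by (auto simp: A_submodule_def set_add_absorb)
    show ?thesis
    proof
      assume "enat n \<le> length_sq A act N L"
      then obtain m where m: "m \<ge> n" "sub_chain A act m L N" using iff by auto
      from sub_chain_split[OF M sub(2) m(2) le(1)] N
      obtain p q where pq: "m \<le> p + q" "sub_chain A act p L K" "sub_chain A act q K N" by auto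
      have "enat q \<le> length_sq A act N K" "enat p \<le> length_sq A act K L"
        using pq iff by auto
      then have "enat (q + p) \<le> length_sq A act N K + length_sq A act K L"
        using enat_le_add_decomp by blast
      then show "enat n \<le> length_sq A act N K + length_sq A act K L"
        using m(1) pq(1) order_trans[of "enat n" "enat (q + p)"] by simp
    next
      assume "enat n \<le> length_sq A act N K + length_sq A act K L"
      then obtain p q where pq: "n = p + q" "enat p \<le> length_sq A act N K" "enat q \<le> length_sq A act K L"
        using enat_le_add_decomp by blast
      then obtain p' q' where "p' \<ge> p" "sub_chain A act p' K N" "q' \<ge> q" "sub_chain A act q' L K" using iff by auto
      then have "sub_chain A act (q' + p') L N" "q' + p' \<ge> n" using sub_chain_trans pq by auto
      then show "enat n \<le> length_sq A act N L" using iff by auto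
    qed
  qed
  then show ?thesis by (intro antisym iffD2[OF enat_le_iff_all]) blast+
qed

lemma length_sq_self:
  assumes "A_submodule A act L" shows "length_sq A act L L = 0"
proof -
  have "n = 0" if "sub_chain A act n L L" for n
    using that
  proof cases
    case (sub_chain_Suc n K)
    then show ?thesis using sub_chain_sub[of A act n L K] by auto
  qed
  then have "length_sq A act L L \<le> 0"
    unfolding length_sq_sub_chain by (intro Sup_least) (auto simp: zero_enat_def)
  then show ?thesis by simp
qed

text \<open>Linearity is over the scalars in A only, and the two actions may live on different
  groups: instances are multiplication by a ring element, the map \<open>a -> a x\<close>,
  evaluation of a family at an index, and the Koszul differential.\<close>

locale A_linear =
  fixes A :: "'a::comm_ring_1 set" and act :: "'a \<Rightarrow> 'v::ab_group_add \<Rightarrow> 'v"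
    and act' :: "'a \<Rightarrow> 'w::ab_group_add \<Rightarrow> 'w" and f :: "'v \<Rightarrow> 'w"
  assumes module: "module_act act" "module_act act'"
    and add: "f (x + y) = f x + f y"
    and scale: "a \<in> A \<Longrightarrow> f (act a x) = act' a (f x)"
begin

lemma zero: "f 0 = 0"
  using add[of 0 0] by simp

lemma minus: "f (- x) = - f x"
  using add[of x "- x"] zero by (simp add: eq_neg_iff_add_eq_0 add.commute)

lemma diff: "f (x - y) = f x - f y"
  using add[of x "- y"] minus by simp

lemma A_submodule_vimage:
  assumes "A_submodule A act N" "A_submodule A act' L"
  shows "A_submodule A act {x \<in> N. f x \<in> L}"
  using assms unfolding A_submodule_def add_subgroup_def by (auto simp: zero add minus scale)

lemma A_submodule_image:
  assumes "A_submodule A act N"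
  shows "A_submodule A act' (f ` N)"
  unfolding A_submodule_def add_subgroup_def
proof (intro conjI ballI)
  show "0 \<in> f ` N" using A_submodule_0[OF assms] zero by (metis imageI)
next
  fix x assume "x \<in> f ` N"
  then obtain u where u: "x = f u" "u \<in> N" by auto
  then show "- x \<in> f ` N" using assms minus by (metis imageI A_submodule_def subgroup_uminus)
  fix y assume "y \<in> f ` N"
  then obtain v where v: "y = f v" "v \<in> N" by auto
  show "x + y \<in> f ` N" using u v add assms by (metis imageI A_submodule_def subgroup_add)
next
  fix a x assume a: "a \<in> A" and "x \<in> f ` N"
  then obtain u where u: "x = f u" "u \<in> N" by auto
  then show "act' a x \<in> f ` N" using assms scale[OF a] a by (metis imageI A_submodule_def)
qed

text \<open>The isomorphism theorem for subquotients: f identifies N modulo the preimage of L' with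
  (f N + L')/L'. Chains are transported by V -> f V + L' and by taking preimages, and both maps keep
  strict steps strict.\<close>

lemma length_sq_image:
  assumes N: "A_submodule A act N" and L: "A_submodule A act' L'"
    and N': "N' = set_add (f ` N) L'"
  shows "length_sq A act N {x \<in> N. f x \<in> L'} = length_sq A act' N' L'"
proof -
  let ?L = "{x \<in> N. f x \<in> L'}"
  have subL: "A_submodule A act ?L" by (rule A_submodule_vimage[OF N L])
  have fwd: "sub_chain A act n ?L V \<Longrightarrow> V \<subseteq> N \<Longrightarrow> sub_chain A act' n L' (set_add (f ` V) L')" for n V
  proof (induction n arbitrary: V)
    case 0
    from 0(1) have "V = ?L" by (cases rule: sub_chain.cases) auto
    moreover have "set_add (f ` ?L) L' = L'"
      using A_submodule_0[OF A_submodule_image[OF subL]] L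
      by (intro subset_antisym set_add_right set_add_least) (auto simp: A_submodule_def)
    ultimately show ?case using sub_chain_0[OF L] by simp
  next
    case (Suc n)
    from Suc.prems(1) obtain K where K: "sub_chain A act n ?L K" "K \<subset> V" "A_submodule A act V"
      by (cases rule: sub_chain.cases) auto
    have IH: "sub_chain A act' n L' (set_add (f ` K) L')"
      using Suc.IH[OF K(1)] K(2) Suc.prems(2) by blast
    have LK: "?L \<subseteq> K" and Ks: "A_submodule A act K" using sub_chain_sub[OF K(1)] by auto
    \<comment> \<open>Equal images would put every x in V into K: x differs from some v in K by an
      element of the preimage of L', and K contains that preimage.\<close>
    have "set_add (f ` K) L' \<noteq> set_add (f ` V) L'"
    proof
      assume eq: "set_add (f ` K) L' = set_add (f ` V) L'"
      have "V \<subseteq> K"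
      proof
        fix x assume x: "x \<in> V"
        then have "f x \<in> set_add (f ` K) L'" using eq set_add_left[of L' "f ` V"] A_submodule_0[OF L] by auto
        then obtain v l where "f x = f v + l" "v \<in> K" "l \<in> L'" by (auto elim: set_add_E)
        then have "f (x - v) = l" by (simp add: diff)
        moreover have "x \<in> N" "v \<in> N" using x K(2) Suc.prems(2) \<open>v \<in> K\<close> by auto
        then have "x - v \<in> N" using subgroup_minus[OF submodule_subgroup[OF N]] by simp
        ultimately have "x - v \<in> K" using LK \<open>l \<in> L'\<close> by auto
        then have "(x - v) + v \<in> K" using \<open>v \<in> K\<close> subgroup_add[OF submodule_subgroup[OF Ks]] by blast
        then show "x \<in> K" by simp
      qed
      then show False using K(2) by auto
    qed
    moreover have "set_add (f ` K) L' \<subseteq> set_add (f ` V) L'" using K by (intro set_add_mono) auto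
    moreover have "A_submodule A act' (set_add (f ` V) L')"
      by (intro A_submodule_set_add A_submodule_image K L module)
    ultimately show ?case by (intro sub_chain_Suc[OF IH]) auto
  qed
  have bwd: "sub_chain A act' n L' V \<Longrightarrow> V \<subseteq> N' \<Longrightarrow> sub_chain A act n ?L {x \<in> N. f x \<in> V}" for n V
  proof (induction n arbitrary: V)
    case 0
    from 0(1) have "V = L'" by (cases rule: sub_chain.cases) auto
    then show ?case using sub_chain_0[OF subL] by simp
  next
    case (Suc n)
    from Suc.prems(1) obtain K where K: "sub_chain A act' n L' K" "K \<subset> V" "A_submodule A act' V"
      by (cases rule: sub_chain.cases) auto
    have IH: "sub_chain A act n ?L {x \<in> N. f x \<in> K}"
      using Suc.IH[OF K(1)] K(2) Suc.prems(2) by blast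
    have LK: "L' \<subseteq> K" and Ks: "A_submodule A act' K" using sub_chain_sub[OF K(1)] by auto
    \<comment> \<open>Surjectivity modulo L' lifts a witness w of the strict step to N, up to an
      element of L', which already lies in K.\<close>
    obtain w where w: "w \<in> V" "w \<notin> K" using K by auto
    then have "w \<in> set_add (f ` N) L'" using Suc.prems(2) N' by blast
    then obtain x l where x: "w = f x + l" "x \<in> N" "l \<in> L'" by (auto elim!: set_add_E)
    have "f x = w - l" using x by simp
    moreover have "l \<in> V" "l \<in> K" using x(3) LK K(2) by auto
    ultimately have fx: "f x \<in> V"
      using subgroup_minus[OF submodule_subgroup[OF K(3)] w(1), of l] by simp
    have "f x \<notin> K"
      using subgroup_add[OF submodule_subgroup[OF Ks] _ \<open>l \<in> K\<close>] w(2) x(1) by metis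
    then have "{x \<in> N. f x \<in> K} \<subset> {x \<in> N. f x \<in> V}" using fx x(2) K(2) by blast
    then show ?case by (rule sub_chain_Suc[OF IH _ A_submodule_vimage[OF N K(3)]])
  qed
  have NL: "{x \<in> N. f x \<in> N'} = N"
    unfolding N' using set_add_left[of L' "f ` N"] A_submodule_0[OF L] by auto
  have "sub_chain A act n ?L N \<longleftrightarrow> sub_chain A act' n L' N'" for n
    using fwd[of n N] bwd[of n N'] unfolding NL N'[symmetric] by blast
  then show ?thesis by (simp add: length_sq_sub_chain)
qed

end

section \<open>Artinian local rings\<close>

text \<open>The chain condition is relative to a predicate, so that one notion serves ideals,
  submodules inside a fixed module and submodules over different sets of scalars.\<close>

definition acc_on :: "('s set \<Rightarrow> bool) \<Rightarrow> bool" where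
  "acc_on P \<longleftrightarrow> (\<forall>f::nat \<Rightarrow> 's set. (\<forall>n. P (f n) \<and> f n \<subseteq> f (Suc n)) \<longrightarrow> (\<exists>n. \<forall>m\<ge>n. f m = f n))"

lemma acc_onD:
  assumes "acc_on P" "\<And>n::nat. P (f n)" "\<And>n. f n \<subseteq> f (Suc n)"
  shows "\<exists>n. \<forall>m\<ge>n. f m = f n"
  using assms unfolding acc_on_def by blast

lemma acc_on_maximal:
  assumes acc: "acc_on P" and F: "U0 \<in> F" "\<And>U. U \<in> F \<Longrightarrow> P U"
  shows "\<exists>U\<in>F. \<forall>V\<in>F. U \<subseteq> V \<longrightarrow> V = U"
proof (rule ccontr)
  assume "\<not> ?thesis"
  then have step: "\<exists>V. V \<in> F \<and> U \<subset> V" if "U \<in> F" for U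
    using that by blast
  have "\<exists>f :: nat \<Rightarrow> _. \<forall>n. f n \<in> F \<and> f n \<subset> f (Suc n)"
    by (rule dependent_nat_choice) (rule exI[of _ U0], rule F(1), rule step)
  then obtain f :: "nat \<Rightarrow> _" where "\<forall>n. f n \<in> F \<and> f n \<subset> f (Suc n)" ..
  then have f: "\<And>n. f n \<in> F \<and> f n \<subset> f (Suc n)" ..
  have "P (f n)" "f n \<subseteq> f (Suc n)" for n
    using F(2)[of "f n"] conjunct1[OF f[of n]] conjunct2[OF f[of n]] by simp_all
  then have "\<exists>n. \<forall>m\<ge>n. f m = f n" by (rule acc_onD[OF acc])
  then obtain n where "\<forall>m\<ge>n. f m = f n" ..
  then have "f (Suc n) = f n" using le_SucI[OF order_refl] by blast
  then show False using f[of n] by blast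
qed

lemma dcc_minimal:
  assumes dcc: "\<not> (\<exists>f :: nat \<Rightarrow> 's set. \<forall>n. P (f n) \<and> f (Suc n) \<subset> f n)"
    and F: "U0 \<in> F" "\<And>U. U \<in> F \<Longrightarrow> P U"
  shows "\<exists>U\<in>F. \<forall>V\<in>F. V \<subseteq> U \<longrightarrow> V = U"
proof (rule ccontr)
  assume "\<not> ?thesis"
  then have step: "\<exists>V. V \<in> F \<and> V \<subset> U" if "U \<in> F" for U
    using that by blast
  have "\<exists>f :: nat \<Rightarrow> _. \<forall>n. f n \<in> F \<and> f (Suc n) \<subset> f n"
    by (rule dependent_nat_choice) (rule exI[of _ U0], rule F(1), rule step)
  then obtain f :: "nat \<Rightarrow> _" where "\<forall>n. f n \<in> F \<and> f (Suc n) \<subset> f n" ..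
  then have "\<forall>n. P (f n) \<and> f (Suc n) \<subset> f n" using F(2) by simp
  then show False using dcc by blast
qed

lemma times_module: "module_act ((*) :: 'a::comm_ring_1 \<Rightarrow> 'a \<Rightarrow> 'a)"
  by (simp add: module_act_def algebra_simps)

text \<open>A will be the degree zero part of S, a subring of the ambient type; ideals, units and
  the maximal ideal are therefore relative to a carrier set.\<close>

locale artin_local =
  fixes A :: "'a::comm_ring_1 set"
  assumes subgroup: "add_subgroup A"
    and one: "1 \<in> A"
    and mult: "a \<in> A \<Longrightarrow> b \<in> A \<Longrightarrow> a * b \<in> A"
    and artin: "artinian_local_inf_residue A"
begin

definition mm :: "'a set" where "mm = (THE m. maximal_ideal_in A m)"

lemma mm_maximal: "maximal_ideal_in A mm"
  and mm_unique: "maximal_ideal_in A m \<Longrightarrow> m = mm"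
proof -
  have *: "\<exists>!m. maximal_ideal_in A m" using artin by (auto simp: artinian_local_inf_residue_def)
  show "maximal_ideal_in A mm" unfolding mm_def by (rule theI'[OF *])
  then show "maximal_ideal_in A m \<Longrightarrow> m = mm" using ex1E[OF *] by metis
qed

lemma minus: "a \<in> A \<Longrightarrow> - a \<in> A" and diff: "a \<in> A \<Longrightarrow> b \<in> A \<Longrightarrow> a - b \<in> A"
  using subgroup by (auto simp: subgroup_uminus subgroup_minus)

lemma mm_subset: "mm \<subseteq> A" and mm_mult: "a \<in> A \<Longrightarrow> x \<in> mm \<Longrightarrow> a * x \<in> mm" and mm_subgroup: "add_subgroup mm"
proof -
  have "ideal_in A mm" using mm_maximal unfolding maximal_ideal_in_def by (rule conjunct1)
  then show "mm \<subseteq> A" "a \<in> A \<Longrightarrow> x \<in> mm \<Longrightarrow> a * x \<in> mm" "add_subgroup mm"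
    unfolding ideal_in_def by blast+
qed

lemma above_mm: "ideal_in A I \<Longrightarrow> mm \<subseteq> I \<Longrightarrow> I = mm \<or> I = A" and mm_neq: "mm \<noteq> A"
  using mm_maximal unfolding maximal_ideal_in_def by blast+

lemma one_notin_mm: "1 \<notin> mm"
proof
  assume "1 \<in> mm"
  then have "a \<in> mm" if "a \<in> A" for a using mm_mult[OF that \<open>1 \<in> mm\<close>] by simp
  then show False using mm_neq mm_subset by blast
qed

lemma ideal_in_iff: "ideal_in A I \<longleftrightarrow> A_submodule A (*) I \<and> I \<subseteq> A"
  by (auto simp: ideal_in_def A_submodule_def)

lemma A_sub: "A_submodule A (*) A"
  using subgroup mult by (auto simp: A_submodule_def)

lemma linear_cyclic: "module_act act \<Longrightarrow> A_linear A (*) act (\<lambda>a. act a x)"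
  by (simp add: A_linear_def times_module act_add_left act_mult)

lemma A_submodule_cyclic: "module_act act \<Longrightarrow> A_submodule A act ((\<lambda>a. act a x) ` A)"
  by (rule A_linear.A_submodule_image[OF linear_cyclic A_sub])

lemma mem_cyclic: "module_act act \<Longrightarrow> x \<in> (\<lambda>a. act a x) ` A"
  using one by (auto simp: act_1 intro: image_eqI[of _ _ 1])

lemma ideal_in_cyclic: "a \<in> A \<Longrightarrow> ideal_in A ((\<lambda>b. b * a) ` A)"
  using A_submodule_cyclic[OF times_module, of a] mult by (auto simp: ideal_in_iff)

text \<open>Zorn's lemma. It is used with y = 1 to embed a proper ideal in a maximal one, and with a
  general y to find a submodule with a quotient of length at most one.\<close>

lemma maximal_submodule_avoiding:
  assumes U: "A_submodule A act U" "U \<subseteq> N" "y \<notin> U"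
  obtains J where "A_submodule A act J" "U \<subseteq> J" "J \<subseteq> N" "y \<notin> J"
    "\<And>K. A_submodule A act K \<Longrightarrow> J \<subseteq> K \<Longrightarrow> K \<subseteq> N \<Longrightarrow> y \<notin> K \<Longrightarrow> K = J"
proof -
  let ?F = "{J. A_submodule A act J \<and> U \<subseteq> J \<and> J \<subseteq> N \<and> y \<notin> J}"
  have "\<exists>M\<in>?F. \<forall>X\<in>?F. M \<subseteq> X \<longrightarrow> X = M"
  proof (rule subset_Zorn_nonempty)
    show "?F \<noteq> {}" using U by auto
    fix C assume C: "C \<noteq> {}" "subset.chain ?F C"
    then have CF: "A_submodule A act J" "U \<subseteq> J" "J \<subseteq> N" "y \<notin> J" if "J \<in> C" for J
      using that by (auto simp: subset.chain_def)
    have "A_submodule A act (\<Union>C)" unfolding A_submodule_def add_subgroup_def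
    proof (intro conjI ballI)
      obtain J where "J \<in> C" using C(1) by blast
      then show "0 \<in> \<Union>C" using A_submodule_0[OF CF(1)] by blast
    next
      fix x y assume "x \<in> \<Union>C" "y \<in> \<Union>C"
      then obtain J K where JK: "J \<in> C" "K \<in> C" "x \<in> J" "y \<in> K" by auto
      then have "J \<subseteq> K \<or> K \<subseteq> J" using C(2) by (auto simp: subset.chain_def)
      then obtain H where "H \<in> C" "x \<in> H" "y \<in> H" using JK by auto
      then show "x + y \<in> \<Union>C" using CF(1)[of H] by (auto simp: A_submodule_def add_subgroup_def)
    next
      fix x assume "x \<in> \<Union>C"
      then show "- x \<in> \<Union>C" using CF(1) by (auto simp: A_submodule_def add_subgroup_def)
    next
      fix a x assume "a \<in> A" "x \<in> \<Union>C"
      then show "act a x \<in> \<Union>C" using CF(1) by (auto simp: A_submodule_def)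
    qed
    moreover have "U \<subseteq> \<Union>C" using CF(2) C(1) by blast
    moreover have "\<Union>C \<subseteq> N" using CF(3) by blast
    moreover have "y \<notin> \<Union>C" using CF(4) by blast
    ultimately show "\<Union>C \<in> ?F" by blast
  qed
  then obtain M where "M \<in> ?F" "\<forall>X\<in>?F. M \<subseteq> X \<longrightarrow> X = M" by blast
  then show thesis using that[of M] by blast
qed

text \<open>If the ideal \<open>A a\<close> missed 1, it would lie in a maximal ideal, which can
  only be \<open>mm\<close>, although a is outside \<open>mm\<close>.\<close>

lemma unit:
  assumes a: "a \<in> A" "a \<notin> mm"
  obtains b where "b \<in> A" "b * a = 1"
proof -
  let ?I = "(\<lambda>b. b * a) ` A"
  have I: "A_submodule A (*) ?I" "?I \<subseteq> A" using ideal_in_cyclic[OF a(1)] by (auto simp: ideal_in_iff)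
  have "1 \<in> ?I"
  proof (rule ccontr)
    assume "1 \<notin> ?I"
    from maximal_submodule_avoiding[OF I this]
    obtain M where M: "A_submodule A (*) M" "?I \<subseteq> M" "M \<subseteq> A" "1 \<notin> M"
      "\<And>K. A_submodule A (*) K \<Longrightarrow> M \<subseteq> K \<Longrightarrow> K \<subseteq> A \<Longrightarrow> 1 \<notin> K \<Longrightarrow> K = M" by blast
    have "maximal_ideal_in A M" unfolding maximal_ideal_in_def
    proof (intro conjI allI impI)
      show "ideal_in A M" "M \<noteq> A" using M one by (auto simp: ideal_in_iff)
      fix J assume J: "ideal_in A J" "M \<subseteq> J"
      show "J = M \<or> J = A"
      proof (cases "1 \<in> J")
        case True
        then have "x \<in> J" if "x \<in> A" for x using J(1) that unfolding ideal_in_def by (metis mult.right_neutral)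
        then show ?thesis using J(1) by (auto simp: ideal_in_def)
      next
        case False
        then show ?thesis using M(5)[of J] J by (auto simp: ideal_in_iff)
      qed
    qed
    then have "M = mm" by (rule mm_unique)
    then show False using M(2) a mem_cyclic[OF times_module, of a] by auto
  qed
  then obtain b where "b \<in> A" "b * a = 1" by force
  then show thesis by (rule that)
qed

text \<open>A substitute for nilpotency of the maximal ideal that avoids powers of ideals.\<close>
lemma T_nilpotent:
  fixes a :: "nat \<Rightarrow> 'a"
  assumes "\<And>i. a i \<in> mm"
  shows "\<exists>n. (\<Prod>i<n. a i) = 0"
proof (rule ccontr)
  assume no: "\<not> ?thesis"
  define p where "p n = (\<Prod>i<n. a i)" for n
  have aA: "a i \<in> A" for i using assms mm_subset by auto
  have pA: "p n \<in> A" for n unfolding p_def by (induction n) (auto simp: one mult aA)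
  have pS: "p (Suc n) = p n * a n" for n by (simp add: p_def)
  define I where "I n = (\<lambda>r. r * p n) ` A" for n
  have "ideal_in A (I n)" for n unfolding I_def by (rule ideal_in_cyclic[OF pA])
  moreover have "I (Suc n) \<subseteq> I n" for n
  proof
    fix x assume "x \<in> I (Suc n)"
    then obtain r where "r \<in> A" "x = (r * a n) * p n" unfolding I_def pS by (auto simp: algebra_simps)
    then show "x \<in> I n" unfolding I_def using mult aA by blast
  qed
  moreover have "\<not> (\<forall>n. ideal_in A (I n) \<and> I (Suc n) \<subset> I n)"
    using artin by (auto simp: artinian_local_inf_residue_def)
  ultimately obtain n where "I n = I (Suc n)" by blast
  moreover have "p n \<in> I n" unfolding I_def using one by (auto intro: image_eqI[of _ _ 1])
  ultimately obtain r where r: "r \<in> A" "p n = r * (p n * a n)" unfolding I_def pS by auto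
  \<comment> \<open>The principal ideals of the partial products have stabilised, so
    \<open>p n\<close> is killed by \<open>1 - r * a n\<close>. This factor is a unit because it
    differs from 1 by an element of \<open>mm\<close>.\<close>
  have "1 - r * a n \<notin> mm"
  proof
    assume "1 - r * a n \<in> mm"
    then have "(1 - r * a n) + r * a n \<in> mm"
      using mm_mult[OF r(1) assms[of n]] mm_subgroup by (simp only: subgroup_add)
    then show False using one_notin_mm by simp
  qed
  moreover have "1 - r * a n \<in> A" using one r(1) aA by (simp add: diff mult)
  ultimately obtain b where b: "b * (1 - r * a n) = 1" using unit by metis
  have "p n * (1 - r * a n) = 0" using r(2) by (simp add: algebra_simps)
  then have "p n * (b * (1 - r * a n)) = 0" by (metis mult.left_commute mult_zero_right)
  then show False using no b by (auto simp: p_def)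
qed

text \<open>Modulo W, \<open>act a x\<close> is a nonzero socle element in the module generated by
  x. Without one, x could be multiplied by elements of \<open>mm\<close> forever without entering W,
  although the products of these multipliers vanish at some point by
  \<open>T_nilpotent\<close>.\<close>

lemma socle:
  assumes M: "module_act act" and W: "A_submodule A act W" and x: "x \<notin> W"
  obtains a where "a \<in> A" "act a x \<notin> W" "\<And>c. c \<in> mm \<Longrightarrow> act c (act a x) \<in> W"
proof (rule ccontr)
  note ex = that
  assume no: "\<not> thesis"
  have step: "\<exists>b. (b \<in> A \<and> act b x \<notin> W) \<and> (\<exists>c\<in>mm. b = a * c)" if a: "a \<in> A \<and> act a x \<notin> W" for a
  proof -
    obtain c where c: "c \<in> mm" "act c (act a x) \<notin> W" using ex[of a] no a by blast
    then have "c \<in> A" using mm_subset by auto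
    then show ?thesis using c a mult
      by (intro exI[of _ "a * c"]) (auto simp: act_mult[OF M, symmetric] mult.commute)
  qed
  have "\<exists>f. \<forall>n::nat. (f n \<in> A \<and> act (f n) x \<notin> W) \<and> (\<exists>c\<in>mm. f (Suc n) = f n * c)"
  proof (rule dependent_nat_choice)
    show "\<exists>b. b \<in> A \<and> act b x \<notin> W" using one x act_1[OF M] by metis
  qed (rule step)
  then obtain f where f: "\<And>n::nat. f n \<in> A \<and> act (f n) x \<notin> W" "\<And>n. \<exists>c\<in>mm. f (Suc n) = f n * c" by blast
  obtain c where c: "\<And>n. c n \<in> mm" "\<And>n. f (Suc n) = f n * c n" using f(2) by metis
  have "f n = f 0 * (\<Prod>i<n. c i)" for n by (induction n) (auto simp: c algebra_simps)
  then obtain n where "f n = 0" using T_nilpotent[of c] c(1) by (metis mult_zero_right)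
  then show False using f(1)[of n] A_submodule_0[OF W] by (simp add: act_0_left[OF M])
qed

lemma length_sq_residue: "length_sq A (*) A mm \<le> 1"
proof -
  have "n \<le> 1" if "sub_chain A (*) n mm A" for n
    using that
  proof cases
    case (sub_chain_Suc n K)
    then have "ideal_in A K" "mm \<subseteq> K" using sub_chain_sub[of A "(*)" n mm K] by (auto simp: ideal_in_iff)
    then have "K = mm" using above_mm[of K] sub_chain_Suc by blast
    with sub_chain_Suc(2) have "n = 0"
    proof (cases rule: sub_chain.cases)
      case (sub_chain_Suc n' K')
      then show ?thesis using sub_chain_sub[of A "(*)" n' mm K'] \<open>K = mm\<close> by auto
    qed
    then show ?thesis using sub_chain_Suc by simp
  qed simp
  then show ?thesis unfolding length_sq_sub_chain
    by (intro Sup_least) (auto simp: one_enat_def)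
qed

section \<open>Modules of finite length over A\<close>

lemma length_sq_cyclic:
  assumes "module_act act" "A_submodule A act W"
  shows "length_sq A act (set_add ((\<lambda>a. act a y) ` A) W) W = length_sq A (*) A {a \<in> A. act a y \<in> W}"
  using A_linear.length_sq_image[OF linear_cyclic[OF assms(1)] A_sub assms(2) refl] by simp

text \<open>The added cyclic quotient is A modulo an ideal containing \<open>mm\<close>, thus zero
  or the residue field.\<close>

lemma length_sq_socle:
  assumes M: "module_act act" and W: "A_submodule A act W" and y: "\<And>c. c \<in> mm \<Longrightarrow> act c y \<in> W"
  shows "length_sq A act (set_add ((\<lambda>a. act a y) ` A) W) W \<le> 1"
proof -
  let ?L = "{a \<in> A. act a y \<in> W}"
  have L: "A_submodule A (*) ?L"
    by (rule A_linear.A_submodule_vimage[OF linear_cyclic[OF M] A_sub W])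
  then have "ideal_in A ?L" "mm \<subseteq> ?L" using y mm_subset by (auto simp: ideal_in_iff)
  then have "?L = mm \<or> ?L = A" by (rule above_mm)
  then have "length_sq A (*) A ?L \<le> 1"
    using length_sq_residue length_sq_self[OF A_sub] by (elim disjE) auto
  then show ?thesis using length_sq_cyclic[OF M W] by simp
qed

lemma length_sq_mono:
  assumes "module_act act" "A_submodule A act L" "A_submodule A act K" "A_submodule A act N" "L \<subseteq> K" "K \<subseteq> N"
  shows "length_sq A act N K \<le> length_sq A act N L" "length_sq A act K L \<le> length_sq A act N L"
  using length_sq_add[OF assms] by (auto simp: add_increasing add_increasing2)

text \<open>An ideal I that is minimal among those of finite colength must be zero: otherwise some J
  strictly inside I has I/J of length at most one, against minimality.\<close>

lemma finite_length_A: "length_sq A (*) A {0} \<noteq> \<infinity>"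
proof -
  let ?F = "{I. ideal_in A I \<and> length_sq A (*) A I \<noteq> \<infinity>}"
  have "A \<in> ?F" using A_sub length_sq_self[OF A_sub] by (auto simp: ideal_in_iff zero_enat_def)
  moreover have "\<not> (\<exists>f :: nat \<Rightarrow> 'a set. \<forall>n. ideal_in A (f n) \<and> f (Suc n) \<subset> f n)"
    using artin unfolding artinian_local_inf_residue_def by (elim conjE)
  ultimately have "\<exists>I\<in>?F. \<forall>V\<in>?F. V \<subseteq> I \<longrightarrow> V = I" 
    by (intro dcc_minimal[where P = "ideal_in A"]) auto
  then obtain I where I: "I \<in> ?F" and min: "\<forall>V\<in>?F. V \<subseteq> I \<longrightarrow> V = I" ..
  have sub: "A_submodule A (*) I" "I \<subseteq> A" using I by (auto simp: ideal_in_iff)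
  have "I = {0}"
  proof (rule ccontr)
    assume "I \<noteq> {0}"
    then obtain x0 where x0: "x0 \<in> I" "x0 \<noteq> 0" using A_submodule_0[OF sub(1)] by auto
    \<comment> \<open>A nonzero I differs from \<open>mm\<close> I. If every submodule containing
      these products contained I, then each c with c I nonzero could be multiplied by some a in
      \<open>mm\<close> with c a I still nonzero, and repeating this contradicts
      \<open>T_nilpotent\<close>.\<close>
    have "\<exists>U y. A_submodule A (*) U \<and> (\<forall>a\<in>mm. \<forall>x\<in>I. a * x \<in> U) \<and> y \<in> I \<and> y \<notin> U"
    proof (rule ccontr)
      assume no: "\<not> ?thesis"
      have step: "\<exists>d. (\<exists>x\<in>I. d * x \<noteq> 0) \<and> (\<exists>a\<in>mm. d = c * a)" if "\<exists>x\<in>I. c * x \<noteq> 0" for c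
      proof (rule ccontr)
        assume no': "\<not> ?thesis"
        have "A_submodule A (*) {z. c * z = 0}"
          unfolding A_submodule_def add_subgroup_def by (auto simp: algebra_simps)
        moreover have "\<forall>a\<in>mm. \<forall>x\<in>I. a * x \<in> {z. c * z = 0}"
        proof (intro ballI CollectI)
          fix a x assume "a \<in> mm" "x \<in> I"
          then have "(c * a) * x = 0" using no' by blast
          then show "c * (a * x) = 0" by (simp add: mult.assoc)
        qed
        ultimately show False using no that by blast
      qed
      have "\<exists>f. \<forall>n::nat. (\<exists>x\<in>I. f n * x \<noteq> 0) \<and> (\<exists>a\<in>mm. f (Suc n) = f n * a)"
      proof (rule dependent_nat_choice)
        show "\<exists>c. \<exists>x\<in>I. c * x \<noteq> 0" using x0 by (metis mult_1)
      qed (rule step)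
      then obtain f where f: "\<And>n::nat. \<exists>x\<in>I. f n * x \<noteq> 0" "\<And>n. \<exists>a\<in>mm. f (Suc n) = f n * a" by blast
      obtain a where a: "\<And>n. a n \<in> mm" "\<And>n. f (Suc n) = f n * a n" using f(2) by metis
      have "f n = f 0 * (\<Prod>i<n. a i)" for n by (induction n) (auto simp: a algebra_simps)
      then obtain n where "f n = 0" using T_nilpotent[of a] a(1) by (metis mult_zero_right)
      then show False using f(1)[of n] by simp
    qed
    then obtain U y where U: "A_submodule A (*) U" "\<And>a x. a \<in> mm \<Longrightarrow> x \<in> I \<Longrightarrow> a * x \<in> U" "y \<in> I" "y \<notin> U"
      by blast
    \<comment> \<open>J is maximal in I without y and contains \<open>mm\<close> I, so I/J is a
      vector space over the residue field in which every nonzero vector has y in its span.\<close>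
    from maximal_submodule_avoiding[OF A_submodule_Int[OF U(1) sub(1)], of I y] U
    obtain J where J: "A_submodule A (*) J" "U \<inter> I \<subseteq> J" "J \<subseteq> I" "y \<notin> J"
      "\<And>K. A_submodule A (*) K \<Longrightarrow> J \<subseteq> K \<Longrightarrow> K \<subseteq> I \<Longrightarrow> y \<notin> K \<Longrightarrow> K = J" by auto
    have mJ: "a * x \<in> J" if "a \<in> mm" "x \<in> I" for a x
    proof -
      have "a * x \<in> I" using A_submodule_act[OF sub(1) _ that(2)] that(1) mm_subset by blast
      then show ?thesis using U(2)[OF that] J(2) by blast
    qed
    let ?Y = "\<lambda>z. set_add ((\<lambda>a. a * z) ` A) J"
    have Y: "A_submodule A (*) (?Y z)" "J \<subseteq> ?Y z" "z \<in> ?Y z" for z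
      using A_submodule_set_add[OF times_module A_submodule_cyclic[OF times_module] J(1)]
        set_add_right[of "(\<lambda>a. a * z) ` A" J] set_add_left[of J "(\<lambda>a. a * z) ` A"]
        A_submodule_0[OF A_submodule_cyclic[OF times_module, of z]] A_submodule_0[OF J(1)]
        mem_cyclic[OF times_module, of z] by blast+
    have YI: "?Y z \<subseteq> I" if "z \<in> I" for z
      using that sub(1) J(3) by (intro set_add_least submodule_subgroup[OF sub(1)]) (auto simp: A_submodule_def)
    have "I \<subseteq> ?Y y"
    proof
      fix z assume z: "z \<in> I"
      show "z \<in> ?Y y"
      proof (cases "z \<in> J")
        case True
        then show ?thesis using Y(2) by blast
      next
        case False
        \<comment> \<open>Maximality of J puts y into J + A z. The coefficient a of z is a unit,
          since a in \<open>mm\<close> would give y in J, so z can be expressed through y.\<close>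
        then have "y \<in> ?Y z" using J(5)[OF Y(1,2) YI[OF z]] Y(3)[of z] by blast
        then obtain a j where a: "y = a * z + j" "a \<in> A" "j \<in> J" by (auto elim: set_add_E)
        have "a \<notin> mm"
          using mJ[of a z] z a J(4) subgroup_add[OF submodule_subgroup[OF J(1)], of "a * z" j] by blast
        then obtain b where b: "b \<in> A" "b * a = 1" using unit a(2) by blast
        have "z = b * y + (- b) * j" using b(2) a(1) by (simp add: algebra_simps mult.assoc[symmetric])
        moreover have "b * y \<in> (\<lambda>a. a * y) ` A" using b by auto
        moreover have "(- b) * j \<in> J" using A_submodule_act[OF J(1) minus[OF b(1)] a(3)] .
        ultimately show ?thesis using set_add_I by metis
      qed
    qed
    then have IY: "?Y y = I" using YI[OF U(3)] by auto
    have "length_sq A (*) I J \<le> 1"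
      using length_sq_socle[OF times_module J(1), of y] mJ U(3) IY by auto
    then have "length_sq A (*) I J \<noteq> \<infinity>" by (cases "length_sq A (*) I J") auto
    moreover have "length_sq A (*) A J = length_sq A (*) A I + length_sq A (*) I J"
      by (rule length_sq_add[OF times_module J(1) sub(1) A_sub J(3) sub(2)])
    ultimately have "J \<in> ?F" using I J sub by (auto simp: ideal_in_iff)
    then have "J = I" using min J(3) by blast
    then show False using U J by blast
  qed
  then show ?thesis using I by simp
qed

lemma A_submodule_singleton_0: "module_act act \<Longrightarrow> A_submodule A act {0}"
  by (simp add: A_submodule_def add_subgroup_def act_0)

text \<open>Each further generator adds a cyclic quotient of A, whose length is at most that of
  A.\<close>

lemma finite_length_span:
  assumes M: "module_act act" and "finite G"
  shows "\<exists>N. A_submodule A act N \<and> G \<subseteq> N \<and> length_sq A act N {0} \<noteq> \<infinity>"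
  using \<open>finite G\<close>
proof induction
  case empty
  then show ?case using A_submodule_singleton_0[OF M] length_sq_self[OF A_submodule_singleton_0[OF M]]
    by (intro exI[of _ "{0}"]) simp
next
  case (insert x G)
  then obtain N where N: "A_submodule A act N" "G \<subseteq> N" "length_sq A act N {0} \<noteq> \<infinity>" by blast
  let ?C = "(\<lambda>a. act a x) ` A"
  let ?N = "set_add ?C N"
  have C: "A_submodule A act ?C" by (rule A_submodule_cyclic[OF M])
  have sub: "A_submodule A act ?N" by (rule A_submodule_set_add[OF M C N(1)])
  have NN: "N \<subseteq> ?N" by (rule set_add_right[OF A_submodule_0[OF C]])
  let ?L = "{a \<in> A. act a x \<in> N}"
  have "A_submodule A (*) ?L"
    by (rule A_linear.A_submodule_vimage[OF linear_cyclic[OF M] A_sub N(1)])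
  then have "length_sq A (*) A ?L \<le> length_sq A (*) A {0}"
    using length_sq_mono(1)[OF times_module A_submodule_singleton_0[OF times_module], of ?L A] A_sub
      A_submodule_0 by blast
  then have "length_sq A act ?N N \<noteq> \<infinity>"
    using length_sq_cyclic[OF M N(1), of x] finite_length_A by (metis enat_ile not_infinity_eq)
  then have "length_sq A act ?N {0} \<noteq> \<infinity>"
    using length_sq_add[OF M A_submodule_singleton_0[OF M] N(1) sub _ NN] N(3) A_submodule_0[OF N(1)] by auto
  moreover have "x \<in> ?N"
    using set_add_left[OF A_submodule_0[OF N(1)], of ?C] mem_cyclic[OF M, of x] by blast
  ultimately show ?case using sub NN N(2) by (intro exI[of _ ?N]) auto
qed

lemma length_sq_0_eq:
  assumes "A_submodule A act L" "A_submodule A act N" "L \<subseteq> N" "length_sq A act N L = 0"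
  shows "N = L"
proof (rule ccontr)
  assume "N \<noteq> L"
  then have "sub_chain A act (Suc 0) L N"
    using sub_chain_Suc[OF sub_chain_0[OF assms(1)] _ assms(2)] assms(3) by auto
  then have "enat (Suc 0) \<le> length_sq A act N L" using enat_le_length_sq[OF assms(1-3)] by blast
  then show False using assms(4) by (simp add: zero_enat_def)
qed

text \<open>Along an ascending chain the lengths are bounded by that of N; once their maximum is
  attained, each later inclusion has length zero and is an equality.\<close>

lemma finite_length_acc:
  assumes M: "module_act act" and N: "A_submodule A act N" and fl: "length_sq A act N {0} \<noteq> \<infinity>"
  shows "acc_on (\<lambda>U. A_submodule A act U \<and> U \<subseteq> N)"
  unfolding acc_on_def
proof (intro allI impI)
  fix f :: "nat \<Rightarrow> _ set" assume f: "\<forall>n. (A_submodule A act (f n) \<and> f n \<subseteq> N) \<and> f n \<subseteq> f (Suc n)"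
  have z: "A_submodule A act {0}" by (rule A_submodule_singleton_0[OF M])
  have fs: "A_submodule A act (f n)" "f n \<subseteq> N" "{0} \<subseteq> f n" for n using f A_submodule_0 by blast+
  have mono: "f n \<subseteq> f m" if "n \<le> m" for n m using lift_Suc_mono_le[of f] f that by blast
  let ?l = "\<lambda>n. the_enat (length_sq A act (f n) {0})"
  have fin: "length_sq A act (f n) {0} \<le> length_sq A act N {0}" for n
    by (rule length_sq_mono(2)[OF M z fs(1) N fs(3) fs(2)])
  then have fin': "length_sq A act (f n) {0} \<noteq> \<infinity>" for n using fl by (metis enat_ile not_infinity_eq)
  have bound: "?l n \<le> the_enat (length_sq A act N {0})" for n
    using fin[of n] fl fin'[of n]
    by (cases "length_sq A act (f n) {0}"; cases "length_sq A act N {0}") auto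
  have "finite (range ?l)" 
  proof (rule finite_subset)
    show "range ?l \<subseteq> {..the_enat (length_sq A act N {0})}" using bound by blast
  qed simp
  then have "Max (range ?l) \<in> range ?l" by (intro Max_in) auto
  then obtain n where n: "?l n = Max (range ?l)" by (elim rangeE) (rule that, simp)
  have "f m = f n" if "m \<ge> n" for m
  proof -
    have add: "length_sq A act (f m) {0} = length_sq A act (f m) (f n) + length_sq A act (f n) {0}"
      by (rule length_sq_add[OF M z fs(1) fs(1) fs(3) mono[OF that]])
    have "?l m \<le> ?l n" using n \<open>finite (range ?l)\<close> by simp
    then have "length_sq A act (f m) (f n) = 0"
      using add fin'[of m] fin'[of n]
      by (cases "length_sq A act (f m) (f n)"; cases "length_sq A act (f n) {0}") (auto simp: zero_enat_def)
    then show ?thesis by (rule length_sq_0_eq[OF fs(1) fs(1) mono[OF that]])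
  qed
  then show "\<exists>n. \<forall>m\<ge>n. f m = f n" by blast
qed

text \<open>A submodule U maximal among those of finite length is all of N: otherwise a socle
  element of N/U would enlarge it by length at most one.\<close>

lemma acc_finite_length:
  assumes M: "module_act act" and N: "A_submodule A act N"
    and acc: "acc_on (\<lambda>U. A_submodule A act U \<and> U \<subseteq> N)"
  shows "length_sq A act N {0} \<noteq> \<infinity>"
proof -
  have z: "A_submodule A act {0}" by (rule A_submodule_singleton_0[OF M])
  let ?F = "{U. A_submodule A act U \<and> U \<subseteq> N \<and> length_sq A act U {0} \<noteq> \<infinity>}"
  have "{0} \<in> ?F" using z A_submodule_0[OF N] length_sq_self[OF z] by (auto simp: zero_enat_def)
  then have "\<exists>U\<in>?F. \<forall>V\<in>?F. U \<subseteq> V \<longrightarrow> V = U" by (rule acc_on_maximal[OF acc]) simp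
  then obtain U where U: "U \<in> ?F" "\<forall>V\<in>?F. U \<subseteq> V \<longrightarrow> V = U" ..
  have "N \<subseteq> U"
  proof (rule ccontr)
    assume "\<not> N \<subseteq> U"
    then obtain x where x: "x \<in> N" "x \<notin> U" by auto
    obtain a where a: "a \<in> A" "act a x \<notin> U" "\<And>c. c \<in> mm \<Longrightarrow> act c (act a x) \<in> U"
      using socle[OF M _ x(2)] U(1) by blast
    let ?y = "act a x"
    let ?C = "(\<lambda>b. act b ?y) ` A"
    let ?V = "set_add ?C U"
    have Us: "A_submodule A act U" "{0} \<subseteq> U" using U(1) A_submodule_0 by auto
    have C: "A_submodule A act ?C" by (rule A_submodule_cyclic[OF M])
    have V: "A_submodule A act ?V" by (rule A_submodule_set_add[OF M C Us(1)])
    have UV: "U \<subseteq> ?V" by (rule set_add_right[OF A_submodule_0[OF C]])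
    have "length_sq A act ?V U \<le> 1" by (rule length_sq_socle[OF M Us(1) a(3)])
    then have "length_sq A act ?V {0} \<noteq> \<infinity>"
      using length_sq_add[OF M z Us(1) V Us(2) UV] U(1)
      by (cases "length_sq A act ?V U") auto
    moreover have "?V \<subseteq> N"
      using N x(1) a(1) U(1) by (intro set_add_least submodule_subgroup[OF N]) (auto simp: A_submodule_def)
    ultimately have "?V = U" using U(2) V UV by simp
    moreover have "?y \<in> ?V"
      using set_add_left[OF A_submodule_0[OF Us(1)], of ?C] mem_cyclic[OF M, of ?y] by blast
    ultimately show False using a(2) by simp
  qed
  then show ?thesis using U(1) by auto
qed

end

section \<open>Hilbert's basis theorem for modules\<close>

lemma A_submodule_mono: "A_submodule B act U \<Longrightarrow> A \<subseteq> B \<Longrightarrow> A_submodule A act U"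
  by (auto simp: A_submodule_def)

context
  fixes act :: "'a::comm_ring_1 \<Rightarrow> 'm::ab_group_add \<Rightarrow> 'm" and B :: "'a set" and y :: 'a and N :: "'m set"
  assumes M: "module_act act" and N: "A_submodule B act N"
begin

text \<open>The values in the module of polynomials in y of degree below i with coefficients in N.
  No polynomial module is formed, so the representation of a value need not be unique.\<close>

primrec poly_filt :: "nat \<Rightarrow> 'm set" where
  "poly_filt 0 = {0}"
| "poly_filt (Suc i) = set_add (poly_filt i) ((\<lambda>x. act (y ^ i) x) ` N)"

lemma linear_scale: "A_linear B act act (act c)"
  using M by (simp add: A_linear_def act_add act_mult[symmetric] mult.commute)

lemma poly_filt_sub: "A_submodule B act (poly_filt i)"
proof (induction i)
  case 0
  then show ?case by (simp add: A_submodule_def add_subgroup_def act_0[OF M])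
next
  case (Suc i)
  then show ?case
    using A_submodule_set_add[OF M Suc A_linear.A_submodule_image[OF linear_scale N]] by simp
qed

lemma poly_filt_Suc: "poly_filt i \<subseteq> poly_filt (Suc i)"
proof -
  have "0 \<in> (\<lambda>x. act (y ^ i) x) ` N"
    by (rule A_submodule_0[OF A_linear.A_submodule_image[OF linear_scale N]])
  then show ?thesis using set_add_left by simp
qed

lemma poly_filt_mono: "i \<le> j \<Longrightarrow> poly_filt i \<subseteq> poly_filt j"
  by (rule lift_Suc_mono_le[of poly_filt]) (rule poly_filt_Suc)

lemma poly_filt_act: "x \<in> poly_filt i \<Longrightarrow> act y x \<in> poly_filt (Suc i)"
proof (induction i arbitrary: x)
  case 0
  then have "act y x = 0" using act_0[OF M] by simp
  then show ?case using A_submodule_0[OF poly_filt_sub, of "Suc 0"] by simp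
next
  case (Suc i)
  then obtain f n where x: "x = f + act (y ^ i) n" "f \<in> poly_filt i" "n \<in> N"
    by (auto elim: set_add_E)
  have "act y x = act y f + act (y ^ Suc i) n"
    using x(1) by (simp add: act_add[OF M] act_mult[OF M])
  moreover have "act y f \<in> poly_filt (Suc i)" using Suc.IH x by blast
  ultimately show ?case using set_add_I[of "act y f" "poly_filt (Suc i)" "act (y ^ Suc i) n"] x(3)
    by (simp del: power_Suc)
qed

definition poly_ext :: "'m set" where
  "poly_ext = (\<Union>i. poly_filt i)"

lemma poly_ext_superset: "N \<subseteq> poly_ext"
proof
  fix x assume "x \<in> N"
  then have "0 + act (y ^ 0) x \<in> poly_filt (Suc 0)"
    unfolding poly_filt.simps by (intro set_add_I imageI) auto
  then have "x \<in> poly_filt (Suc 0)" by (simp add: act_1[OF M] del: poly_filt.simps)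
  then show "x \<in> poly_ext" unfolding poly_ext_def by blast
qed

lemma poly_ext_sub: "A_submodule (insert y B) act poly_ext"
  unfolding A_submodule_def add_subgroup_def
proof (intro conjI ballI)
  show "0 \<in> poly_ext" using A_submodule_0[OF N] poly_ext_superset by blast
next
  fix u v assume "u \<in> poly_ext" "v \<in> poly_ext"
  then obtain i j where "u \<in> poly_filt i" "v \<in> poly_filt j" unfolding poly_ext_def by auto
  then have "u \<in> poly_filt (max i j)" "v \<in> poly_filt (max i j)"
    using poly_filt_mono[of i "max i j"] poly_filt_mono[of j "max i j"] by auto
  then show "u + v \<in> poly_ext"
    using subgroup_add[OF submodule_subgroup[OF poly_filt_sub]] unfolding poly_ext_def by blast
next
  fix u assume "u \<in> poly_ext"
  then show "- u \<in> poly_ext"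
    using subgroup_uminus[OF submodule_subgroup[OF poly_filt_sub]] unfolding poly_ext_def by blast
next
  fix a u assume a: "a \<in> insert y B" and "u \<in> poly_ext"
  then obtain i where i: "u \<in> poly_filt i" unfolding poly_ext_def by auto
  show "act a u \<in> poly_ext"
  proof (cases "a = y")
    case True
    then show ?thesis using poly_filt_act[OF i] unfolding poly_ext_def by blast
  next
    case False
    then have "a \<in> B" using a by simp
    then show ?thesis using A_submodule_act[OF poly_filt_sub _ i] unfolding poly_ext_def by blast
  qed
qed

text \<open>The leading coefficient modules of Hilbert's basis theorem.\<close>
definition lead :: "'m set \<Rightarrow> nat \<Rightarrow> 'm set" where
  "lead U i = {x \<in> N. act (y ^ i) x \<in> set_add U (poly_filt i)}"

lemma lead_sub: "A_submodule B act U \<Longrightarrow> A_submodule B act (lead U i)"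
  unfolding lead_def
  by (rule A_linear.A_submodule_vimage[OF linear_scale N A_submodule_set_add[OF M _ poly_filt_sub]])

lemma lead_mono: "U \<subseteq> V \<Longrightarrow> lead U i \<subseteq> lead V i"
  unfolding lead_def using set_add_mono[of U V "poly_filt i" "poly_filt i"] by auto

lemma lead_Suc:
  assumes "A_submodule (insert y B) act U" shows "lead U i \<subseteq> lead U (Suc i)"
proof
  fix x assume "x \<in> lead U i"
  then obtain u f where x: "x \<in> N" "act (y ^ i) x = u + f" "u \<in> U" "f \<in> poly_filt i"
    unfolding lead_def by (auto elim: set_add_E)
  have "act (y ^ Suc i) x = act y u + act y f"
    using x(2) by (simp add: act_add[OF M, symmetric] act_mult[OF M])
  moreover have "act y u \<in> U" using A_submodule_act[OF assms _ x(3)] by simp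
  moreover have "act y f \<in> poly_filt (Suc i)" by (rule poly_filt_act[OF x(4)])
  ultimately have "act (y ^ Suc i) x \<in> set_add U (poly_filt (Suc i))"
    using set_add_I[of "act y u" U "act y f"] by (simp del: poly_filt.simps power_Suc)
  then show "x \<in> lead U (Suc i)" unfolding lead_def using x(1) by blast
qed

text \<open>Induction on the degree: an element of V of degree at most i has its leading coefficient
  in \<open>lead U i\<close>, so subtracting an element of U lowers the degree and stays in
  V.\<close>

lemma lead_determines:
  assumes U: "A_submodule (insert y B) act U" and V: "A_submodule (insert y B) act V"
    and le: "U \<subseteq> V" "V \<subseteq> poly_ext" and lead: "\<And>i. lead V i \<subseteq> lead U i"
  shows "V = U"
proof -
  have "V \<inter> poly_filt i \<subseteq> U" for i
  proof (induction i)
    case 0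
    then show ?case using A_submodule_0[OF U] by auto
  next
    case (Suc i)
    show ?case
    proof
      fix v assume v: "v \<in> V \<inter> poly_filt (Suc i)"
      then obtain f x where x: "v = f + act (y ^ i) x" "f \<in> poly_filt i" "x \<in> N"
        by (auto elim: set_add_E)
      have "- f \<in> poly_filt i" using subgroup_uminus[OF submodule_subgroup[OF poly_filt_sub] x(2)] .
      then have "act (y ^ i) x \<in> set_add V (poly_filt i)"
        using set_add_I[of v V "- f" "poly_filt i"] v x(1) by simp
      then have "x \<in> lead U i" using lead[of i] x(3) unfolding lead_def by blast
      then obtain u g where u: "act (y ^ i) x = u + g" "u \<in> U" "g \<in> poly_filt i"
        unfolding lead_def by (auto elim: set_add_E)
      have eq: "v - u = f + g" using x(1) u(1) by simp
      have "v - u \<in> V"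
        using subgroup_minus[OF submodule_subgroup[OF V], of v u] v u(2) le(1) by auto
      moreover have "v - u \<in> poly_filt i"
        unfolding eq using subgroup_add[OF submodule_subgroup[OF poly_filt_sub] x(2) u(3)] .
      ultimately have "v - u \<in> U" using Suc by auto
      then have "(v - u) + u \<in> U" using subgroup_add[OF submodule_subgroup[OF U]] u(2) by blast
      then show "v \<in> U" by simp
    qed
  qed
  then have "V \<subseteq> U" using le(2) unfolding poly_ext_def by blast
  then show ?thesis using le(1) by blast
qed

text \<open>The family \<open>g k i\<close> grows in both indices. Its diagonal is constant from k0
  on, which settles all degrees \<open>i > k0\<close>; the finitely many degrees
  \<open>i <= k0\<close> stabilise one by one.\<close>

lemma acc_poly_ext:
  assumes acc: "acc_on (\<lambda>U. A_submodule B act U \<and> U \<subseteq> N)"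
  shows "acc_on (\<lambda>U. A_submodule (insert y B) act U \<and> U \<subseteq> poly_ext)"
  unfolding acc_on_def
proof (intro allI impI)
  fix f :: "nat \<Rightarrow> 'm set"
  assume f: "\<forall>n. (A_submodule (insert y B) act (f n) \<and> f n \<subseteq> poly_ext) \<and> f n \<subseteq> f (Suc n)"
  have fs: "A_submodule (insert y B) act (f n)" "f n \<subseteq> poly_ext" for n using f by blast+
  have fB: "A_submodule B act (f n)" for n by (rule A_submodule_mono[OF fs(1)]) auto
  have fm: "f n \<subseteq> f m" if "n \<le> m" for n m using lift_Suc_mono_le[of f] f that by blast
  define g where "g k i = lead (f k) i" for k i
  have gN: "A_submodule B act (g k i) \<and> g k i \<subseteq> N" for k i
    unfolding g_def using lead_sub[OF fB] by (auto simp: lead_def)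
  have gm1: "g k i \<subseteq> g l i" if "k \<le> l" for k l i unfolding g_def by (rule lead_mono[OF fm[OF that]])
  have gm2: "g k i \<subseteq> g k j" if "i \<le> j" for k i j
    unfolding g_def by (rule lift_Suc_mono_le[of "lead (f k)", OF lead_Suc[OF fs(1)] that])
  have gm: "g k i \<subseteq> g l j" if "k \<le> l" "i \<le> j" for k l i j
    using gm1[OF that(1)] gm2[OF that(2)] by (rule order_trans)
  have "\<exists>n. \<forall>m\<ge>n. g m m = g n n"
    by (rule acc_onD[OF acc, of "\<lambda>k. g k k"]) (rule gN, rule gm, simp_all)
  then obtain k0 where k0: "\<forall>m\<ge>k0. g m m = g k0 k0" ..
  have "\<forall>i. \<exists>n. \<forall>m\<ge>n. g m i = g n i"
    by (intro allI acc_onD[OF acc, of "\<lambda>k. g k _"]) (rule gN, rule gm, simp_all)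
  then obtain K where K: "\<And>i. \<forall>m\<ge>K i. g m i = g (K i) i" by metis
  define n0 where "n0 = max k0 (Max (K ` {..k0}))"
  have "g m i \<subseteq> g n0 i" if "m \<ge> n0" for m i
  proof (cases "i \<le> k0")
    case True
    then have "K i \<le> Max (K ` {..k0})" by simp
    also have "\<dots> \<le> n0" unfolding n0_def by (rule max.cobounded2)
    finally have "K i \<le> n0" "K i \<le> m" using that by simp_all
    then have "g n0 i = g (K i) i" "g m i = g (K i) i" using K[of i] by blast+
    then show ?thesis by simp
  next
    case False
    \<comment> \<open>A value beyond the corner (k0, k0) is squeezed: it lies inside a diagonal
      value, which equals the corner value, which lies inside \<open>g n0 i\<close>.\<close>
    have "g m i \<subseteq> g (max m i) (max m i)" by (rule gm) auto
    moreover have "k0 \<le> max m i" using False by simp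
    then have "g (max m i) (max m i) = g k0 k0" using k0 by blast
    moreover have "g k0 k0 \<subseteq> g n0 i" using False by (intro gm) (auto simp: n0_def)
    ultimately show ?thesis by simp
  qed
  then have "f m = f n0" if "m \<ge> n0" for m
    using that by (intro lead_determines fs fm) (auto simp: g_def)
  then show "\<exists>n. \<forall>m\<ge>n. f m = f n" by blast
qed

end

text \<open>One generator is adjoined at a time. The scalars are just a set: for a subgroup,
  stability under \<open>B \<union> Y\<close> amounts to stability under the subring that it
  generates.\<close>

lemma hilbert_basis:
  assumes "module_act act" "finite Y" "A_submodule B act N" "acc_on (\<lambda>U. A_submodule B act U \<and> U \<subseteq> N)"
  shows "\<exists>N'. N \<subseteq> N' \<and> A_submodule (B \<union> Y) act N' \<and> acc_on (\<lambda>U. A_submodule (B \<union> Y) act U \<and> U \<subseteq> N')"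
  using assms(2)
proof induction
  case empty
  then show ?case using assms(3,4) by (intro exI[of _ N]) simp
next
  case (insert y Y)
  then obtain N' where N': "N \<subseteq> N'" "A_submodule (B \<union> Y) act N'" "acc_on (\<lambda>U. A_submodule (B \<union> Y) act U \<and> U \<subseteq> N')"
    by (elim exE conjE)
  show ?case
    using poly_ext_sub[OF assms(1) N'(2), of y] poly_ext_superset[OF assms(1) N'(2), of y]
      acc_poly_ext[OF assms(1) N'(2,3), of y] N'(1)
    by (intro exI[of _ "poly_ext act y N'"]) (auto simp: Un_insert_right)
qed

text \<open>The generators of M lie in an A-module of finite length; its extension by the algebra
  generators is stable under the whole ring and hence equals M.\<close>

lemma (in artin_local) noetherian:
  fixes act :: "'a \<Rightarrow> 'm::ab_group_add \<Rightarrow> 'm"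
  assumes M: "module_act act" and Y: "finite Y" "gen_alg A Y = UNIV"
    and G: "finite G" "\<And>x. \<exists>c. x = (\<Sum>g\<in>G. act (c g) g)"
  shows "acc_on (A_submodule UNIV act)"
proof -
  obtain N where N: "A_submodule A act N" "G \<subseteq> N" "length_sq A act N {0} \<noteq> \<infinity>"
    using finite_length_span[OF M G(1)] by (elim exE conjE)
  obtain N' where N': "N \<subseteq> N'" "A_submodule (A \<union> Y) act N'"
    "acc_on (\<lambda>U. A_submodule (A \<union> Y) act U \<and> U \<subseteq> N')"
    using hilbert_basis[OF M Y(1) N(1) finite_length_acc[OF M N(1,3)]] by (elim exE conjE)
  have "\<forall>x\<in>N'. act s x \<in> N'" if "s \<in> gen_alg A Y" for s
    using that
  proof induction
    case (base a)
    then show ?case using A_submodule_act[OF N'(2)] by simp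
  next
    case (gen g)
    then show ?case using A_submodule_act[OF N'(2)] by simp
  next
    case (add s t)
    then show ?case
      using subgroup_add[OF submodule_subgroup[OF N'(2)]] by (simp add: act_add_left[OF M])
  next
    case (mult s t)
    then show ?case by (simp add: act_mult[OF M])
  next
    case (neg s)
    then show ?case
      using subgroup_uminus[OF submodule_subgroup[OF N'(2)]] by (simp add: act_minus_left[OF M])
  qed
  then have closed: "act s x \<in> N'" if "x \<in> N'" for s x using Y(2) that by simp
  have "N' = UNIV"
  proof (intro subset_antisym subsetI)
    fix x
    from G(2)[of x] obtain c where "x = (\<Sum>g\<in>G. act (c g) g)" ..
    then show "x \<in> N'"
      using subgroup_sum[OF submodule_subgroup[OF N'(2)], of G "\<lambda>g. act (c g) g"] closed N'(1) N(2) by blast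
  qed simp
  then have *: "acc_on (A_submodule (A \<union> Y) act)" using N'(3) by simp
  show ?thesis unfolding acc_on_def
  proof (intro allI impI)
    fix f :: "nat \<Rightarrow> _ set" assume f: "\<forall>n. A_submodule UNIV act (f n) \<and> f n \<subseteq> f (Suc n)"
    show "\<exists>n. \<forall>m\<ge>n. f m = f n"
      by (rule acc_onD[OF *]) (use f A_submodule_mono[of UNIV act _ "A \<union> Y"] in simp_all)
  qed
qed

section \<open>Multigraded modules\<close>

locale grading =
  fixes G :: "('d \<Rightarrow> nat) \<Rightarrow> 'v::ab_group_add set"
  assumes subgroup: "add_subgroup (G n)"
    and decomp: "direct_sum_decomp G"
begin

definition comp :: "'v \<Rightarrow> ('d \<Rightarrow> nat) \<Rightarrow> 'v" where
  "comp x = (THE f. finite {n. f n \<noteq> 0} \<and> (\<forall>n. f n \<in> G n) \<and> x = (\<Sum>n\<in>{n. f n \<noteq> 0}. f n))"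

definition degs :: "'v \<Rightarrow> ('d \<Rightarrow> nat) set" where
  "degs x = {n. comp x n \<noteq> 0}"

lemma finite_degs: "finite (degs x)" and comp_mem: "comp x n \<in> G n"
  and comp_decomp: "(\<Sum>n\<in>degs x. comp x n) = x"
  and comp_unique0: "finite {n. f n \<noteq> 0} \<Longrightarrow> (\<And>n. f n \<in> G n) \<Longrightarrow> x = (\<Sum>n\<in>{n. f n \<noteq> 0}. f n) \<Longrightarrow> comp x = f"
proof -
  let ?P = "\<lambda>f. finite {n. f n \<noteq> 0} \<and> (\<forall>n. f n \<in> G n) \<and> x = (\<Sum>n\<in>{n. f n \<noteq> 0}. f n)"
  have ex: "\<exists>!f. ?P f" using decomp unfolding direct_sum_decomp_def by (rule spec)
  have P: "?P (comp x)" unfolding comp_def by (rule theI'[OF ex])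
  show "finite (degs x)" "comp x n \<in> G n" "(\<Sum>n\<in>degs x. comp x n) = x"
    unfolding degs_def using conjunct1[OF P] spec[OF conjunct1[OF conjunct2[OF P]]] conjunct2[OF conjunct2[OF P], symmetric]
    by fast+
  assume "finite {n. f n \<noteq> 0}" "\<And>n. f n \<in> G n" "x = (\<Sum>n\<in>{n. f n \<noteq> 0}. f n)"
  then have "?P f" by simp
  then show "comp x = f" unfolding comp_def by (rule the1_equality[OF ex])
qed

lemma zero_mem: "0 \<in> G n"
  by (rule subgroup_0[OF subgroup])

lemma comp_notin_degs: "n \<notin> degs x \<Longrightarrow> comp x n = 0"
  by (simp add: degs_def)

lemma comp_unique:
  assumes F: "finite F" "\<And>n. n \<in> F \<Longrightarrow> f n \<in> G n" "x = sum f F"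
  shows "comp x n = (if n \<in> F then f n else 0)"
proof -
  let ?g = "\<lambda>n. if n \<in> F then f n else 0"
  have sub: "{n. ?g n \<noteq> 0} \<subseteq> F" by auto
  have "x = sum ?g F" using F(3) by simp
  also have "\<dots> = sum ?g {n. ?g n \<noteq> 0}" by (rule sum.mono_neutral_right[OF F(1) sub]) auto
  finally have "comp x = ?g"
    using F(2) zero_mem by (intro comp_unique0 finite_subset[OF sub F(1)]) auto
  then show ?thesis by simp
qed

lemma sum_comp:
  assumes "finite F" "degs x \<subseteq> F" shows "(\<Sum>n\<in>F. comp x n) = x"
proof -
  have "(\<Sum>n\<in>degs x. comp x n) = (\<Sum>n\<in>F. comp x n)"
    by (rule sum.mono_neutral_left[OF assms]) (simp add: degs_def)
  then show ?thesis by (simp only: comp_decomp)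
qed

lemma comp_add: "comp (x + y) n = comp x n + comp y n"
proof -
  let ?F = "degs x \<union> degs y"
  have F: "finite ?F" using finite_degs by simp
  have "x + y = (\<Sum>n\<in>?F. comp x n + comp y n)"
    unfolding sum.distrib using sum_comp[OF F, of x] sum_comp[OF F, of y] by simp
  from comp_unique[OF F _ this] have "comp (x + y) n = (if n \<in> ?F then comp x n + comp y n else 0)"
    using comp_mem subgroup_add[OF subgroup] by blast
  then show ?thesis using comp_notin_degs by auto
qed

lemma comp_homog: "x \<in> G m \<Longrightarrow> comp x n = (if n = m then x else 0)"
  using comp_unique[of "{m}" "\<lambda>_. x" x n] by auto

lemma comp_0: "comp 0 n = 0"
  using comp_homog[OF zero_mem, of n n] by simp

lemma comp_minus: "comp (- x) n = - comp x n"
  using comp_add[of x "- x" n] comp_0[of n] by (simp add: eq_neg_iff_add_eq_0 add.commute)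

lemma comp_sum: "comp (sum f I) n = (\<Sum>i\<in>I. comp (f i) n)"
  by (induction I rule: infinite_finite_induct) (auto simp: comp_0 comp_add)

lemma comp_eq_self: "comp x n = x \<longleftrightarrow> x \<in> G n"
  using comp_mem[of x n] comp_homog[of x n n] by auto

lemma mem_from_comps:
  assumes "add_subgroup U" "\<And>n. comp x n \<in> U" shows "x \<in> U"
  using subgroup_sum[OF assms(1), of "degs x" "comp x"] assms(2) comp_decomp[of x] by simp

end

section \<open>Degrees in N^d\<close>

lemma add_deg_commute: "add_deg a b = add_deg b a"
  by (auto simp: add_deg_def)

lemma add_deg_cancel: "add_deg a b = add_deg a c \<longleftrightarrow> b = c"
  by (auto simp: add_deg_def fun_eq_iff)

lemma zero_deg_add: "add_deg zero_deg n = n" "add_deg n zero_deg = n"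
  by (auto simp: add_deg_def zero_deg_def)

lemma le_add_deg: "b \<le> add_deg a b" "a \<le> add_deg a b"
  by (auto simp: add_deg_def le_fun_def)

lemma add_deg_diff: "b \<le> n \<Longrightarrow> add_deg (\<lambda>i. n i - b i) b = n"
  by (auto simp: add_deg_def le_fun_def fun_eq_iff)

text \<open>The pair of lexicographically largest elements works, for any order of the coordinates.
  The coordinates are maximised one after the other, by induction over the finite set T of those
  already treated.\<close>

lemma unique_sum_of_degrees:
  fixes F G :: "('d::finite \<Rightarrow> nat) set"
  assumes "finite F" "finite G" "F \<noteq> {}" "G \<noteq> {}"
  shows "\<exists>a\<in>F. \<exists>b\<in>G. \<forall>a'\<in>F. \<forall>b'\<in>G. add_deg a' b' = add_deg a b \<longrightarrow> a' = a \<and> b' = b"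
proof -
  \<comment> \<open>Invariant for the coordinates in T: F' and G' are constant in them, and the sum
    of a pair from F' and G' has no representation by a pair outside.\<close>
  have "\<exists>F' G'. F' \<subseteq> F \<and> G' \<subseteq> G \<and> F' \<noteq> {} \<and> G' \<noteq> {} \<and>
    (\<forall>a\<in>F'. \<forall>b\<in>G'. \<forall>a'\<in>F. \<forall>b'\<in>G. add_deg a' b' = add_deg a b \<longrightarrow> a' \<in> F' \<and> b' \<in> G') \<and>
    (\<forall>i\<in>T. (\<forall>a\<in>F'. \<forall>a'\<in>F'. a i = a' i) \<and> (\<forall>b\<in>G'. \<forall>b'\<in>G'. b i = b' i))" for T :: "'d set"
    using finite[of T]
  proof (induction T)
    case empty
    show ?case by (rule exI[of _ F], rule exI[of _ G]) (use assms in auto)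
  next
    case (insert i T)
    from insert.IH obtain F' G' where FG: "F' \<subseteq> F" "G' \<subseteq> G" "F' \<noteq> {}" "G' \<noteq> {}"
      and step: "\<forall>a\<in>F'. \<forall>b\<in>G'. \<forall>a'\<in>F. \<forall>b'\<in>G. add_deg a' b' = add_deg a b \<longrightarrow> a' \<in> F' \<and> b' \<in> G'"
      and const: "\<forall>i\<in>T. (\<forall>a\<in>F'. \<forall>a'\<in>F'. a i = a' i) \<and> (\<forall>b\<in>G'. \<forall>b'\<in>G'. b i = b' i)"
      by (elim exE conjE)
    let ?m = "Max ((\<lambda>a. a i) ` F')" and ?n = "Max ((\<lambda>b. b i) ` G')"
    let ?F = "{a \<in> F'. a i = ?m}" and ?G = "{b \<in> G'. b i = ?n}"
    have fin: "finite F'" "finite G'" using FG(1,2) assms finite_subset by blast+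
    have le: "a \<in> F' \<Longrightarrow> a i \<le> ?m" "b \<in> G' \<Longrightarrow> b i \<le> ?n" for a b using fin by auto
    have "?m \<in> (\<lambda>a. a i) ` F'" "?n \<in> (\<lambda>b. b i) ` G'" using fin FG(3,4) by (auto intro!: Max_in)
    then have ne: "?F \<noteq> {}" "?G \<noteq> {}" by auto
    have "a' \<in> ?F \<and> b' \<in> ?G"
      if "a \<in> ?F" "b \<in> ?G" "a' \<in> F" "b' \<in> G" "add_deg a' b' = add_deg a b" for a b a' b'
    proof -
      have *: "a' \<in> F'" "b' \<in> G'" using step that by blast+
      have "a' i + b' i = a i + b i" using that(5) by (simp add: add_deg_def fun_eq_iff)
      then show ?thesis using that(1,2) le(1)[OF *(1)] le(2)[OF *(2)] * by auto
    qed
    then have "\<forall>a\<in>?F. \<forall>b\<in>?G. \<forall>a'\<in>F. \<forall>b'\<in>G. add_deg a' b' = add_deg a b \<longrightarrow> a' \<in> ?F \<and> b' \<in> ?G"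
      by blast
    moreover have "\<forall>j\<in>insert i T. (\<forall>a\<in>?F. \<forall>a'\<in>?F. a j = a' j) \<and> (\<forall>b\<in>?G. \<forall>b'\<in>?G. b j = b' j)"
      using const by auto
    moreover have "?F \<subseteq> F" "?G \<subseteq> G" using FG(1,2) by auto
    ultimately show ?case using ne by (intro exI[of _ ?F] exI[of _ ?G] conjI)
  qed
  from this[of UNIV] obtain F' G' where FG: "F' \<subseteq> F" "G' \<subseteq> G" "F' \<noteq> {}" "G' \<noteq> {}"
      and step: "\<forall>a\<in>F'. \<forall>b\<in>G'. \<forall>a'\<in>F. \<forall>b'\<in>G. add_deg a' b' = add_deg a b \<longrightarrow> a' \<in> F' \<and> b' \<in> G'"
      and const: "\<forall>i\<in>UNIV. (\<forall>a\<in>F'. \<forall>a'\<in>F'. a i = a' i) \<and> (\<forall>b\<in>G'. \<forall>b'\<in>G'. b i = b' i)"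
    by (elim exE conjE)
  obtain a b where ab: "a \<in> F'" "b \<in> G'" using FG(3,4) by auto
  have "a' = a \<and> b' = b" if "a' \<in> F" "b' \<in> G" "add_deg a' b' = add_deg a b" for a' b'
  proof -
    have "a' \<in> F'" "b' \<in> G'" using step ab that by blast+
    then have "a' i = a i" "b' i = b i" for i using const ab by blast+
    then show ?thesis by (simp add: fun_eq_iff)
  qed
  moreover have "a \<in> F" "b \<in> G" using ab FG(1,2) by auto
  ultimately show ?thesis by blast
qed

locale graded_mod =
  fixes Sg :: "('d::finite \<Rightarrow> nat) \<Rightarrow> 'a::comm_ring_1 set"
    and act :: "'a \<Rightarrow> 'm::ab_group_add \<Rightarrow> 'm"
    and Mg :: "('d \<Rightarrow> nat) \<Rightarrow> 'm set"
  assumes ring: "graded_ring Sg" and gmodule: "graded_module Sg act Mg"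
begin

sublocale R: grading Sg
  using ring by unfold_locales (auto simp: graded_ring_def)

sublocale M: grading Mg
  using gmodule by unfold_locales (auto simp: graded_module_def)

lemma module: "module_act act"
  using gmodule by (simp add: graded_module_def)

lemma act_degree: "s \<in> Sg a \<Longrightarrow> x \<in> Mg b \<Longrightarrow> act s x \<in> Mg (add_deg a b)"
  using gmodule unfolding graded_module_def by blast

lemma mult_degree: "s \<in> Sg a \<Longrightarrow> t \<in> Sg b \<Longrightarrow> s * t \<in> Sg (add_deg a b)"
  using ring unfolding graded_ring_def by blast

lemma one_degree: "1 \<in> Sg zero_deg"
  using ring unfolding graded_ring_def by blast

lemma comp_act:
  "M.comp (act s x) n = (\<Sum>(a, b)\<in>R.degs s \<times> M.degs x.
     if add_deg a b = n then act (R.comp s a) (M.comp x b) else 0)"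
proof -
  have "act s x = act (\<Sum>a\<in>R.degs s. R.comp s a) (\<Sum>b\<in>M.degs x. M.comp x b)"
    by (simp only: R.comp_decomp M.comp_decomp)
  also have "\<dots> = (\<Sum>(a, b)\<in>R.degs s \<times> M.degs x. act (R.comp s a) (M.comp x b))"
    by (subst sum.cartesian_product[symmetric])
      (simp only: act_sum[OF module] act_sum_left[OF module] sum.swap[of _ "M.degs x"])
  finally have "M.comp (act s x) n = (\<Sum>(a, b)\<in>R.degs s \<times> M.degs x. M.comp (act (R.comp s a) (M.comp x b)) n)"
    by (simp add: M.comp_sum case_prod_unfold)
  also have "\<dots> = (\<Sum>(a, b)\<in>R.degs s \<times> M.degs x. if add_deg a b = n then act (R.comp s a) (M.comp x b) else 0)"
    by (intro sum.cong refl)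
      (auto simp: M.comp_homog[OF act_degree[OF R.comp_mem M.comp_mem]])
  finally show ?thesis .
qed

lemma comp_act_homogeneous:
  assumes "s \<in> Sg a" shows "M.comp (act s x) (add_deg a n) = act s (M.comp x n)"
proof -
  have "M.comp (act s x) (add_deg a n) = (\<Sum>b\<in>M.degs x. M.comp (act s (M.comp x b)) (add_deg a n))"
    by (subst M.comp_decomp[of x, symmetric]) (simp add: act_sum[OF module] M.comp_sum)
  also have "\<dots> = (\<Sum>b\<in>M.degs x. if b = n then act s (M.comp x b) else 0)"
    by (intro sum.cong refl) (auto simp: M.comp_homog[OF act_degree[OF assms M.comp_mem]] add_deg_cancel)
  also have "\<dots> = act s (M.comp x n)"
    using M.finite_degs by (auto simp: M.comp_notin_degs act_0[OF module])
  finally show ?thesis .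
qed

lemma comp_act_on_homogeneous:
  assumes "x \<in> Mg b" shows "M.comp (act s x) (add_deg a b) = act (R.comp s a) x"
proof -
  have "M.comp (act s x) (add_deg a b) = (\<Sum>c\<in>R.degs s. M.comp (act (R.comp s c) x) (add_deg a b))"
    by (subst R.comp_decomp[of s, symmetric]) (simp add: act_sum_left[OF module] M.comp_sum)
  also have "\<dots> = (\<Sum>c\<in>R.degs s. if c = a then act (R.comp s c) x else 0)"
    by (intro sum.cong refl)
      (auto simp: M.comp_homog[OF act_degree[OF R.comp_mem assms]] add_deg_cancel add_deg_commute[of _ b])
  also have "\<dots> = act (R.comp s a) x"
    using R.finite_degs by (auto simp: R.comp_notin_degs act_0_left[OF module])
  finally show ?thesis .
qed

lemma comp_act_below:
  assumes "x \<in> Mg b" "\<not> b \<le> n" shows "M.comp (act s x) n = 0"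
proof -
  have "M.comp (act s x) n = (\<Sum>c\<in>R.degs s. M.comp (act (R.comp s c) x) n)"
    by (subst R.comp_decomp[of s, symmetric]) (simp add: act_sum_left[OF module] M.comp_sum)
  also have "\<dots> = 0"
    by (intro sum.neutral ballI)
      (use assms(2) le_add_deg(1)[of b] in \<open>auto simp: M.comp_homog[OF act_degree[OF R.comp_mem assms(1)]]\<close>)
  finally show ?thesis .
qed

section \<open>Homogeneous submodules\<close>

definition hsub :: "'m set \<Rightarrow> bool" where
  "hsub N \<longleftrightarrow> A_submodule UNIV act N \<and> (\<forall>x\<in>N. \<forall>n. M.comp x n \<in> N)"

lemma hsub_submodule: "hsub N \<Longrightarrow> A_submodule UNIV act N"
  and hsub_comp: "hsub N \<Longrightarrow> x \<in> N \<Longrightarrow> M.comp x n \<in> N"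
  and hsub_subgroup: "hsub N \<Longrightarrow> add_subgroup N"
  and hsub_act: "hsub N \<Longrightarrow> x \<in> N \<Longrightarrow> act s x \<in> N"
  and hsub_0: "hsub N \<Longrightarrow> 0 \<in> N"
  unfolding hsub_def A_submodule_def add_subgroup_def by blast+

lemma hsub_UNIV: "hsub UNIV"
  by (simp add: hsub_def A_submodule_def add_subgroup_def)

lemma hsub_singleton_0: "hsub {0}"
  by (simp add: hsub_def A_submodule_def add_subgroup_def act_0[OF module] M.comp_0)

lemma hsub_set_add:
  assumes "hsub N" "hsub L" shows "hsub (set_add N L)"
  unfolding hsub_def
proof (intro conjI ballI allI)
  show "A_submodule UNIV act (set_add N L)"
    using assms by (simp add: A_submodule_set_add[OF module] hsub_def)
  fix x n assume "x \<in> set_add N L"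
  then obtain u l where "x = u + l" "u \<in> N" "l \<in> L" by (rule set_add_E)
  then show "M.comp x n \<in> set_add N L"
    by (simp add: M.comp_add set_add_I hsub_comp assms)
qed

lemma hsub_cyclic:
  assumes "x \<in> Mg b" shows "hsub (range (\<lambda>s. act s x))"
  unfolding hsub_def
proof (intro conjI ballI allI)
  have "A_linear UNIV (*) act (\<lambda>s. act s x)"
    using module by (simp add: A_linear_def times_module act_add_left act_mult)
  then show "A_submodule UNIV act (range (\<lambda>s. act s x))"
    by (rule A_linear.A_submodule_image) (simp add: A_submodule_def add_subgroup_def)
  fix y n assume "y \<in> range (\<lambda>s. act s x)"
  then obtain s where s: "y = act s x" by auto
  show "M.comp y n \<in> range (\<lambda>s. act s x)"
  proof (cases "b \<le> n")
    case True
    then have "M.comp y n = act (R.comp s (\<lambda>i. n i - b i)) x"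
      using comp_act_on_homogeneous[OF assms, of s "\<lambda>i. n i - b i"] s by (simp add: add_deg_diff)
    then show ?thesis by simp
  next
    case False
    then have "M.comp y n = act 0 x" using comp_act_below[OF assms] s by (simp add: act_0_left[OF module])
    then show ?thesis by (rule range_eqI)
  qed
qed

lemma linear_act: "A_linear B act act (act s)"
  using module by (simp add: A_linear_def act_add act_mult[symmetric] mult.commute)

lemma hsub_image:
  assumes "s \<in> Sg a" "hsub N" shows "hsub (act s ` N)"
  unfolding hsub_def
proof (intro conjI ballI allI)
  show "A_submodule UNIV act (act s ` N)"
    by (rule A_linear.A_submodule_image[OF linear_act hsub_submodule[OF assms(2)]])
  fix y n assume "y \<in> act s ` N"
  then obtain x where x: "y = act s x" "x \<in> N" by auto
  show "M.comp y n \<in> act s ` N"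
  proof (cases "a \<le> n")
    case True
    then have "M.comp y n = act s (M.comp x (\<lambda>i. n i - a i))"
      using comp_act_homogeneous[OF assms(1), of x "\<lambda>i. n i - a i"] x
      by (simp add: add_deg_diff add_deg_commute[of a])
    then show ?thesis using hsub_comp[OF assms(2) x(2)] by simp
  next
    case False
    have "M.comp y n = (\<Sum>b\<in>M.degs x. M.comp (act s (M.comp x b)) n)"
      unfolding x(1) by (subst M.comp_decomp[of x, symmetric]) (simp add: act_sum[OF module] M.comp_sum)
    also have "\<dots> = 0"
      by (intro sum.neutral ballI)
        (use False le_add_deg(2)[of a] in \<open>auto simp: M.comp_homog[OF act_degree[OF assms(1) M.comp_mem]]\<close>)
    finally show ?thesis using hsub_0[OF assms(2)] act_0[OF module] by (metis imageI)
  qed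
qed

lemma hsub_vimage:
  assumes "s \<in> Sg a" "hsub N" "hsub L" shows "hsub {x \<in> N. act s x \<in> L}"
  unfolding hsub_def
proof (intro conjI ballI allI)
  show "A_submodule UNIV act {x \<in> N. act s x \<in> L}"
    by (rule A_linear.A_submodule_vimage[OF linear_act hsub_submodule[OF assms(2)] hsub_submodule[OF assms(3)]])
  fix x n assume x: "x \<in> {x \<in> N. act s x \<in> L}"
  then have "act s (M.comp x n) \<in> L"
    using hsub_comp[OF assms(3), of "act s x" "add_deg a n"] by (simp add: comp_act_homogeneous[OF assms(1)])
  then show "M.comp x n \<in> {x \<in> N. act s x \<in> L}" using x hsub_comp[OF assms(2)] by simp
qed

end

text \<open>The ring as a module over itself, so that \<open>comp_act\<close> becomes the formula
  for the components of a product.\<close>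

lemma graded_mod_ring:
  assumes "graded_ring Sg" shows "graded_mod Sg (*) Sg"
  using assms by unfold_locales (auto simp: graded_ring_def graded_module_def times_module)

context graded_mod
begin

lemma homogeneous_ideal_iff:
  "homogeneous_ideal Sg P \<longleftrightarrow> (\<forall>x\<in>P. \<forall>n. R.comp x n \<in> P)"
proof
  assume h: "homogeneous_ideal Sg P"
  show "\<forall>x\<in>P. \<forall>n. R.comp x n \<in> P"
  proof (intro ballI allI)
    fix x n assume "x \<in> P"
    then obtain f where f: "finite {n. f n \<noteq> 0}" "\<forall>n. f n \<in> Sg n \<inter> P" "x = (\<Sum>n\<in>{n. f n \<noteq> 0}. f n)"
      using h unfolding homogeneous_ideal_def by meson
    then have "R.comp x = f" by (intro R.comp_unique0) auto
    then show "R.comp x n \<in> P" using f(2) by simp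
  qed
next
  assume h: "\<forall>x\<in>P. \<forall>n. R.comp x n \<in> P"
  show "homogeneous_ideal Sg P" unfolding homogeneous_ideal_def
  proof (intro ballI)
    fix x assume "x \<in> P"
    then show "\<exists>f. finite {n. f n \<noteq> 0} \<and> (\<forall>n. f n \<in> Sg n \<inter> P) \<and> x = (\<Sum>n\<in>{n. f n \<noteq> 0}. f n)"
      using h R.finite_degs[of x] R.comp_mem[of x] R.comp_decomp[of x, symmetric]
      unfolding R.degs_def by (intro exI[of _ "R.comp x"]) blast
  qed
qed

text \<open>If s and t lie outside P, \<open>unique_sum_of_degrees\<close> gives components of s and
  t outside P whose degrees have a sum attained by no other such pair. The component of s * t in
  that degree is their product plus terms in P, so homogeneous factors suffice to test
  primality.\<close>

lemma prime_idealI: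
  assumes P: "add_subgroup P" "\<And>a x. x \<in> P \<Longrightarrow> a * x \<in> P" "1 \<notin> P" "\<And>x n. x \<in> P \<Longrightarrow> R.comp x n \<in> P"
    and prime: "\<And>a b m n. a \<in> Sg m \<Longrightarrow> b \<in> Sg n \<Longrightarrow> a * b \<in> P \<Longrightarrow> a \<in> P \<or> b \<in> P"
  shows "prime_ideal P"
  unfolding prime_ideal_def
proof (intro conjI allI impI)
  show "add_subgroup P" by fact
  show "P \<noteq> UNIV" using P(3) by auto
  show "x \<in> P \<Longrightarrow> a * x \<in> P" for a x by (rule P(2))
  fix s t assume st: "s * t \<in> P"
  show "s \<in> P \<or> t \<in> P"
  proof (rule ccontr)
    assume "\<not> ?thesis"
    then have ne: "s \<notin> P" "t \<notin> P" by auto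
    let ?F = "{a. R.comp s a \<notin> P}" and ?G = "{b. R.comp t b \<notin> P}"
    have sub: "?F \<subseteq> R.degs s" "?G \<subseteq> R.degs t"
      using subgroup_0[OF P(1)] R.comp_notin_degs by (metis mem_Collect_eq subsetI)+
    have fin: "finite ?F" "finite ?G"
      using finite_subset[OF sub(1) R.finite_degs] finite_subset[OF sub(2) R.finite_degs] by auto
    have nonempty: "?F \<noteq> {}" "?G \<noteq> {}"
      using R.mem_from_comps[OF P(1), of s] R.mem_from_comps[OF P(1), of t] ne by blast+
    obtain a b where ab: "a \<in> ?F" "b \<in> ?G"
      and uniq: "\<forall>a'\<in>?F. \<forall>b'\<in>?G. add_deg a' b' = add_deg a b \<longrightarrow> a' = a \<and> b' = b"
      using unique_sum_of_degrees[OF fin nonempty] by blast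
    let ?t = "\<lambda>(a', b'). if add_deg a' b' = add_deg a b then R.comp s a' * R.comp t b' else 0"
    let ?D = "R.degs s \<times> R.degs t"
    have D: "finite ?D" "(a, b) \<in> ?D" using R.finite_degs ab sub by auto
    have "R.comp (s * t) (add_deg a b) = sum ?t ?D" by (rule graded_mod.comp_act[OF graded_mod_ring[OF ring]])
    also have "\<dots> = R.comp s a * R.comp t b + sum ?t (?D - {(a, b)})"
      using sum.remove[OF D, of ?t] by simp
    finally have eq: "R.comp s a * R.comp t b = R.comp (s * t) (add_deg a b) - sum ?t (?D - {(a, b)})"
      by (simp add: algebra_simps)
    \<comment> \<open>In every other pair with this total degree, one of the two components already
      lies in P.\<close>
    have "?t p \<in> P" if "p \<in> ?D - {(a, b)}" for p
    proof (cases p)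
      case (Pair a' b')
      then have "R.comp s a' * R.comp t b' \<in> P" if "add_deg a' b' = add_deg a b"
        using uniq \<open>p \<in> ?D - {(a, b)}\<close> that P(2)[of "R.comp t b'" "R.comp s a'"]
          P(2)[of "R.comp s a'" "R.comp t b'"] by (cases "R.comp s a' \<in> P") (auto simp: mult.commute)
      then show ?thesis using Pair subgroup_0[OF P(1)] by auto
    qed
    then have "sum ?t (?D - {(a, b)}) \<in> P" by (rule subgroup_sum[OF P(1)])
    then have "R.comp s a * R.comp t b \<in> P"
      unfolding eq using P(4)[OF st] by (intro subgroup_minus[OF P(1)])
    then show False using prime[OF R.comp_mem R.comp_mem] ab by blast
  qed
qed

end

section \<open>Numerical polynomials and iterated differences\<close>

definition monom_fun :: "('d::finite \<Rightarrow> nat) \<Rightarrow> ('d \<Rightarrow> nat) \<Rightarrow> real" where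
  "monom_fun k n = (\<Prod>i\<in>UNIV. real (n i) ^ k i)"

definition tdeg :: "('d::finite \<Rightarrow> nat) \<Rightarrow> nat" where
  "tdeg k = (\<Sum>i\<in>UNIV. k i)"

text \<open>Total degree strictly below t, so that \<open>poly_fun 0\<close> contains only zero and
  t matches the number of primes allowed by \<open>chain_le\<close>.\<close>

definition poly_fun :: "nat \<Rightarrow> (('d::finite \<Rightarrow> nat) \<Rightarrow> real) set" where
  "poly_fun t = {f. \<exists>c. f = (\<lambda>n. \<Sum>k | tdeg k < t. c k * monom_fun k n)}"

text \<open>Stated for any abelian group: Hilbert functions are differenced over the integers,
  polynomials over the reals.\<close>

definition fdiff :: "'d \<Rightarrow> (('d \<Rightarrow> nat) \<Rightarrow> 'r::ab_group_add) \<Rightarrow> ('d \<Rightarrow> nat) \<Rightarrow> 'r" where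
  "fdiff j h n = h (n(j := Suc (n j))) - h n"

primrec fdiffs :: "'d list \<Rightarrow> (('d \<Rightarrow> nat) \<Rightarrow> 'r::ab_group_add) \<Rightarrow> ('d \<Rightarrow> nat) \<Rightarrow> 'r" where
  "fdiffs [] h = h"
| "fdiffs (j # ds) h = fdiffs ds (fdiff j h)"

lemma tdeg_upd: "tdeg (k(j := i)) + k j = tdeg k + i"
proof -
  have "tdeg (k(j := i)) = i + (\<Sum>l\<in>UNIV - {j}. k l)"
    unfolding tdeg_def by (subst sum.remove[of UNIV j]) auto
  moreover have "tdeg k = k j + (\<Sum>l\<in>UNIV - {j}. k l)"
    unfolding tdeg_def by (subst sum.remove[of UNIV j]) auto
  ultimately show ?thesis by simp
qed

lemma le_tdeg: "k i \<le> tdeg k"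
  unfolding tdeg_def by (rule member_le_sum) auto

lemma finite_tdeg: "finite {k :: 'd::finite \<Rightarrow> nat. tdeg k < t}"
proof (rule finite_subset)
  show "{k :: 'd \<Rightarrow> nat. tdeg k < t} \<subseteq> PiE UNIV (\<lambda>_. {..<t})"
    using le_tdeg by (auto simp: PiE_def intro: le_less_trans)
qed (rule finite_PiE, auto)

lemma monom_fun_split: "monom_fun k n = real (n j) ^ k j * monom_fun (k(j := 0)) n"
proof -
  have "monom_fun (k(j := 0)) n = (\<Prod>i\<in>UNIV - {j}. real (n i) ^ k i)"
    unfolding monom_fun_def by (subst prod.remove[of UNIV j]) (auto intro!: prod.cong)
  moreover have "monom_fun k n = real (n j) ^ k j * (\<Prod>i\<in>UNIV - {j}. real (n i) ^ k i)"
    unfolding monom_fun_def by (subst prod.remove[of UNIV j]) auto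
  ultimately show ?thesis by simp
qed

lemma monom_fun_upd: "monom_fun k (n(j := v)) = real v ^ k j * monom_fun (k(j := 0)) n"
proof -
  have "monom_fun (k(j := 0)) (n(j := v)) = monom_fun (k(j := 0)) n"
    unfolding monom_fun_def by (rule prod.cong) auto
  then show ?thesis using monom_fun_split[of k "n(j := v)" j] by simp
qed

lemma fdiff_monom:
  "fdiff j (monom_fun k) n = (\<Sum>i<k j. real (k j choose i) * monom_fun (k(j := i)) n)"
proof -
  have "(real (n j) + 1) ^ k j = (\<Sum>i\<le>k j. real (k j choose i) * real (n j) ^ i)"
    using binomial_ring[of "real (n j)" 1 "k j"] by simp
  also have "\<dots> = (\<Sum>i<k j. real (k j choose i) * real (n j) ^ i) + real (n j) ^ k j"
    by (simp add: lessThan_Suc_atMost[symmetric])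
  finally have eq: "(real (n j) + 1) ^ k j - real (n j) ^ k j = (\<Sum>i<k j. real (k j choose i) * real (n j) ^ i)"
    by simp
  have "fdiff j (monom_fun k) n = ((real (n j) + 1) ^ k j - real (n j) ^ k j) * monom_fun (k(j := 0)) n"
    unfolding fdiff_def monom_fun_upd
    by (subst monom_fun_split[of k n j]) (simp add: left_diff_distrib add.commute)
  also have "\<dots> = (\<Sum>i<k j. real (k j choose i) * (real (n j) ^ i * monom_fun (k(j := 0)) n))"
    unfolding eq by (simp add: sum_distrib_right mult.assoc)
  also have "\<dots> = (\<Sum>i<k j. real (k j choose i) * monom_fun (k(j := i)) n)"
  proof (intro sum.cong refl arg_cong2[where f = "(*)"])
    fix i
    show "real (n j) ^ i * monom_fun (k(j := 0)) n = monom_fun (k(j := i)) n"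
      using monom_fun_split[of "k(j := i)" n j] by simp
  qed
  finally show ?thesis .
qed

lemma poly_funI: "(\<And>n. f n = (\<Sum>k | tdeg k < t. c k * monom_fun k n)) \<Longrightarrow> f \<in> poly_fun t"
  unfolding poly_fun_def by blast

lemma poly_funE:
  assumes "f \<in> poly_fun t" obtains c where "f = (\<lambda>n. \<Sum>k | tdeg k < t. c k * monom_fun k n)"
  using assms unfolding poly_fun_def by blast

lemma poly_fun_add: "f \<in> poly_fun t \<Longrightarrow> g \<in> poly_fun t \<Longrightarrow> (\<lambda>n. f n + g n) \<in> poly_fun t"
  by (elim poly_funE, rule_tac c = "\<lambda>k. c k + ca k" in poly_funI) (simp add: sum.distrib distrib_right)

lemma poly_fun_scale: "f \<in> poly_fun t \<Longrightarrow> (\<lambda>n. a * f n) \<in> poly_fun t"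
  by (elim poly_funE, rule_tac c = "\<lambda>k. a * c k" in poly_funI) (simp add: sum_distrib_left mult.assoc)

lemma poly_fun_diff: "f \<in> poly_fun t \<Longrightarrow> g \<in> poly_fun t \<Longrightarrow> (\<lambda>n. f n - g n) \<in> poly_fun t"
  using poly_fun_add[OF _ poly_fun_scale[of g t "-1"]] by simp

lemma poly_fun_0: "(\<lambda>n. 0) \<in> poly_fun t"
  by (rule poly_funI[where c = "\<lambda>_. 0"]) simp

lemma poly_fun_sum: "(\<And>i. i \<in> I \<Longrightarrow> f i \<in> poly_fun t) \<Longrightarrow> (\<lambda>n. \<Sum>i\<in>I. f i n) \<in> poly_fun t"
  by (induction I rule: infinite_finite_induct) (auto simp: poly_fun_0 poly_fun_add)

lemma poly_fun_monom:
  assumes "tdeg k < t" shows "monom_fun k \<in> poly_fun t"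
proof (rule poly_funI[where c = "\<lambda>l. if l = k then 1 else 0"])
  fix n
  have "(\<Sum>l | tdeg l < t. (if l = k then 1 else 0) * monom_fun l n)
      = (\<Sum>l | tdeg l < t. if l = k then monom_fun l n else 0)" by (rule sum.cong) auto
  also have "\<dots> = monom_fun k n" using assms by (simp add: finite_tdeg)
  finally show "monom_fun k n = (\<Sum>l | tdeg l < t. (if l = k then 1 else 0) * monom_fun l n)" by simp
qed

lemma poly_fun_mono:
  assumes "f \<in> poly_fun s" "s \<le> t" shows "f \<in> poly_fun t"
proof -
  obtain c where f: "f = (\<lambda>n. \<Sum>k | tdeg k < s. c k * monom_fun k n)" using assms(1) by (rule poly_funE)
  show ?thesis unfolding f by (intro poly_fun_sum poly_fun_scale poly_fun_monom) (use assms(2) in auto)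
qed

lemma poly_fun_upd:
  fixes f :: "('d::finite \<Rightarrow> nat) \<Rightarrow> real" and j :: 'd
  assumes "f \<in> poly_fun t" shows "(\<lambda>n. f (n(j := v))) \<in> poly_fun t"
proof -
  obtain c where f: "f = (\<lambda>n. \<Sum>k | tdeg k < t. c k * monom_fun k n)" using assms(1) by (rule poly_funE)
  show ?thesis unfolding f monom_fun_upd
  proof (intro poly_fun_sum poly_fun_scale poly_fun_monom)
    fix k :: "'d \<Rightarrow> nat" assume "k \<in> {k. tdeg k < t}"
    then show "tdeg (k(j := 0)) < t" using tdeg_upd[of k j 0] by simp
  qed
qed

lemma fdiff_diff: "fdiff j (\<lambda>n. f n - g n) n = fdiff j f n - fdiff j g n"
  by (auto simp: fdiff_def)

lemma fdiff_scale: "fdiff j (\<lambda>n. a * f n) n = (a::real) * fdiff j f n"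
  by (simp add: fdiff_def right_diff_distrib)

lemma fdiff_sum: "fdiff j (\<lambda>n. \<Sum>i\<in>I. f i n) n = (\<Sum>i\<in>I. fdiff j (f i) n)"
  by (simp add: fdiff_def sum_subtractf)

text \<open>Differencing the monomial with exponent \<open>k j + 1\<close> in direction j yields
  \<open>k j + 1\<close> times the given one plus monomials of lower j-exponent, which have
  antidifferences by induction on \<open>k j\<close>. The index \<open>tdeg k + 2\<close> stands for
  degree at most \<open>tdeg k + 1\<close>.\<close>

lemma monom_fun_antidifference:
  fixes k :: "'d::finite \<Rightarrow> nat" and j :: 'd
  shows "\<exists>g\<in>poly_fun (tdeg k + 2). \<forall>n. fdiff j g n = monom_fun k n"
proof (induction "k j" arbitrary: k rule: less_induct)
  case less
  have cancel: "c \<noteq> 0 \<Longrightarrow> (1 / c) * (x + c * y - x) = y" for c x y :: real by simp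
  let ?m = "k j"
  let ?K = "k(j := Suc ?m)"
  have tK: "tdeg ?K = tdeg k + 1" using tdeg_upd[of k j "Suc ?m"] by simp
  have "\<exists>g\<in>poly_fun (tdeg k + 2). \<forall>n. fdiff j g n = monom_fun (k(j := i)) n" if "i < ?m" for i
  proof -
    have "tdeg (k(j := i)) \<le> tdeg k" using tdeg_upd[of k j i] that by simp
    then show ?thesis using less[of "k(j := i)"] that poly_fun_mono[of _ "tdeg (k(j := i)) + 2" "tdeg k + 2"]
      by auto
  qed
  then obtain g where g: "\<And>i. i < ?m \<Longrightarrow> g i \<in> poly_fun (tdeg k + 2)"
    "\<And>i n. i < ?m \<Longrightarrow> fdiff j (g i) n = monom_fun (k(j := i)) n" by metis
  let ?s = "\<lambda>n. \<Sum>i<?m. real (Suc ?m choose i) * g i n"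
  let ?g = "\<lambda>n. (1 / real (Suc ?m)) * (monom_fun ?K n - ?s n)"
  have "?g \<in> poly_fun (tdeg k + 2)"
    by (intro poly_fun_scale poly_fun_diff poly_fun_sum poly_fun_monom g(1)) (auto simp: tK)
  moreover have "fdiff j ?g n = monom_fun k n" for n
  proof -
    have "fdiff j ?g n = (1 / real (Suc ?m)) * (fdiff j (monom_fun ?K) n - (\<Sum>i<?m. real (Suc ?m choose i) * fdiff j (g i) n))"
      by (simp only: fdiff_scale fdiff_diff fdiff_sum)
    also have "(\<Sum>i<?m. real (Suc ?m choose i) * fdiff j (g i) n) = (\<Sum>i<?m. real (Suc ?m choose i) * monom_fun (k(j := i)) n)"
      by (rule sum.cong) (auto simp: g(2))
    also have "fdiff j (monom_fun ?K) n = (\<Sum>i<Suc ?m. real (Suc ?m choose i) * monom_fun (k(j := i)) n)"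
      by (simp only: fdiff_monom fun_upd_same fun_upd_upd)
    also have "\<dots> = (\<Sum>i<?m. real (Suc ?m choose i) * monom_fun (k(j := i)) n) + real (Suc ?m) * monom_fun k n"
      by (simp del: of_nat_Suc)
    finally show ?thesis
      by (rule trans) (rule cancel, simp del: of_nat_Suc)
  qed
  ultimately show ?case by blast
qed

lemma poly_fun_antidifference:
  assumes "q \<in> poly_fun t" shows "\<exists>g\<in>poly_fun (Suc t). \<forall>n. fdiff j g n = q n"
proof -
  obtain c where q: "q = (\<lambda>n. \<Sum>k | tdeg k < t. c k * monom_fun k n)" using assms by (rule poly_funE)
  obtain g where g: "\<And>k. g k \<in> poly_fun (tdeg k + 2)" "\<And>k n. fdiff j (g k) n = monom_fun k n"
    using monom_fun_antidifference[of _ j] by metis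
  let ?G = "\<lambda>n. \<Sum>k | tdeg k < t. c k * g k n"
  have "?G \<in> poly_fun (Suc t)"
    by (intro poly_fun_sum poly_fun_scale poly_fun_mono[OF g(1)]) auto
  moreover have "fdiff j ?G n = q n" for n unfolding q by (simp add: fdiff_sum fdiff_scale g(2))
  ultimately show ?thesis by blast
qed

lemma poly_fun_const: "(\<lambda>n. c) \<in> poly_fun (Suc t)"
proof -
  have "tdeg (\<lambda>_. 0) < Suc t" by (simp add: tdeg_def)
  from poly_fun_scale[OF poly_fun_monom[OF this], of c]
  show ?thesis by (simp add: monom_fun_def)
qed

text \<open>Starting at the corner v, the coordinates are released one at a time; along each new
  one, h is its value on the face already treated plus the sum of the prescribed difference.\<close>

lemma discrete_integration:
  fixes h :: "('d::finite \<Rightarrow> nat) \<Rightarrow> real"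
  assumes q: "\<And>j. q j \<in> poly_fun t" and h: "\<And>j n. v \<le> n \<Longrightarrow> fdiff j h n = q j n"
  shows "\<exists>p\<in>poly_fun (Suc t). \<forall>n\<ge>v. h n = p n"
proof -
  have "\<exists>p\<in>poly_fun (Suc t). \<forall>n\<ge>v. (\<forall>i. i \<notin> T \<longrightarrow> n i = v i) \<longrightarrow> h n = p n" for T :: "'d set"
    using finite[of T]
  proof (induction T)
    case empty
    show ?case by (intro bexI[OF _ poly_fun_const[of "h v"]]) (auto intro!: arg_cong[where f = h])
  next
    case (insert j T)
    from insert.IH obtain p where p: "p \<in> poly_fun (Suc t)"
      and hp: "\<forall>n\<ge>v. (\<forall>i. i \<notin> T \<longrightarrow> n i = v i) \<longrightarrow> h n = p n" ..
    obtain G where G: "G \<in> poly_fun (Suc t)" "\<And>n. fdiff j G n = q j n"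
      using poly_fun_antidifference[OF q, of j j] by blast
    \<comment> \<open>The value on the face where coordinate j is frozen at \<open>v j\<close>, plus
      the sum of \<open>q j\<close> from \<open>v j\<close> to \<open>n j - 1\<close>, which
      telescopes to a difference of values of G.\<close>
    let ?p = "\<lambda>n. p (n(j := v j)) + (G n - G (n(j := v j)))"
    have mem: "?p \<in> poly_fun (Suc t)" by (intro poly_fun_add poly_fun_diff poly_fun_upd p G(1))
    have eq: "h n = ?p n" if n: "v \<le> n" "\<forall>i. i \<notin> insert j T \<longrightarrow> n i = v i" for n
    proof -
      have "h (n(j := m)) - G (n(j := m)) = h (n(j := v j)) - G (n(j := v j))" if "v j \<le> m" for m
        using that
      proof (induction m rule: dec_induct)
        case (step m)
        have "v \<le> n(j := m)" using n(1) step(1) by (auto simp: le_fun_def)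
        from h[OF this, of j] G(2)[of "n(j := m)"] have "fdiff j h (n(j := m)) = fdiff j G (n(j := m))" by simp
        then have "h (n(j := Suc m)) - h (n(j := m)) = G (n(j := Suc m)) - G (n(j := m))"
          by (simp only: fdiff_def fun_upd_same fun_upd_upd)
        then show ?case using step.IH by linarith
      qed simp
      from this[of "n j"] n(1) have "h n - G n = h (n(j := v j)) - G (n(j := v j))"
        by (simp add: le_fun_def)
      moreover have "h (n(j := v j)) = p (n(j := v j))" using hp n by (auto simp: le_fun_def)
      ultimately show ?thesis by simp
    qed
    show ?case by (rule bexI[OF _ mem], intro allI impI, rule eq)
  qed
  from this[of UNIV] show ?thesis by simp
qed

section \<open>Evaluating iterated differences\<close>

lemma fdiffs_cong:
  assumes "\<And>n. v \<le> n \<Longrightarrow> f n = g n" "v \<le> n" shows "fdiffs ds f n = fdiffs ds g n"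
  using assms
proof (induction ds arbitrary: f g)
  case (Cons j ds)
  have "fdiff j f n = fdiff j g n" if "v \<le> n" for n
  proof -
    have "v \<le> n(j := Suc (n j))" using that by (auto simp: le_fun_def intro: le_SucI)
    then show ?thesis using Cons.prems(1) that by (simp add: fdiff_def)
  qed
  then show ?case using Cons.IH[of "fdiff j f" "fdiff j g"] Cons.prems(2) by simp
qed simp

lemma fdiffs_sum:
  "fdiffs ds (\<lambda>n. \<Sum>i\<in>I. (c i :: real) * f i n) n = (\<Sum>i\<in>I. c i * fdiffs ds (f i) n)"
proof (induction ds arbitrary: f)
  case (Cons j ds)
  have "fdiff j (\<lambda>n. \<Sum>i\<in>I. c i * f i n) = (\<lambda>n. \<Sum>i\<in>I. c i * fdiff j (f i) n)"
    by (auto simp: fun_eq_iff fdiff_sum fdiff_scale)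
  then show ?case using Cons[of "\<lambda>i. fdiff j (f i)"] by simp
qed simp

definition mcount :: "'d list \<Rightarrow> 'd \<Rightarrow> nat" where
  "mcount ds i = length (filter (\<lambda>j. j = i) ds)"

lemma mcount_Cons: "mcount (j # ds) = (mcount ds)(j := Suc (mcount ds j))"
  by (auto simp: mcount_def fun_eq_iff)

lemma tdeg_mcount: "tdeg (mcount ds) = length ds"
proof (induction ds)
  case Nil
  then show ?case by (simp add: tdeg_def mcount_def)
next
  case (Cons j ds)
  have "tdeg ((mcount ds)(j := Suc (mcount ds j))) + mcount ds j = tdeg (mcount ds) + Suc (mcount ds j)"
    by (rule tdeg_upd)
  then show ?case unfolding mcount_Cons Cons list.size by linarith
qed

lemma tdeg_eq_0: "tdeg k = 0 \<longleftrightarrow> k = (\<lambda>_. 0)"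
  by (auto simp: tdeg_def fun_eq_iff)

text \<open>Each difference lowers the total degree of a monomial, so after \<open>length ds\<close>
  steps at most a constant survives. It does when every variable is hit as often as its exponent
  says, and the exponents that come down multiply to the factorials.\<close>

lemma fdiffs_monom:
  "tdeg k \<le> length ds \<Longrightarrow>
    fdiffs ds (monom_fun k) n = (if k = mcount ds then \<Prod>i\<in>UNIV. fact (k i) else 0)"
proof (induction ds arbitrary: k)
  case Nil
  then show ?case by (auto simp: tdeg_eq_0 mcount_def monom_fun_def)
next
  case (Cons j ds)
  let ?c = "mcount ds"
  have eq: "fdiff j (monom_fun k) = (\<lambda>n. \<Sum>i<k j. real (k j choose i) * monom_fun (k(j := i)) n)"
    by (simp add: fun_eq_iff fdiff_monom)
  have td: "tdeg (k(j := i)) \<le> length ds" if "i < k j" for i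
    using tdeg_upd[of k j i] Cons.prems that by simp
  have "fdiffs (j # ds) (monom_fun k) n = (\<Sum>i<k j. real (k j choose i) * fdiffs ds (monom_fun (k(j := i))) n)"
    by (simp add: eq fdiffs_sum)
  also have "\<dots> = (\<Sum>i<k j. real (k j choose i) *
      (if k(j := i) = ?c then \<Prod>l\<in>UNIV. fact ((k(j := i)) l) else 0))"
    by (intro sum.cong refl) (simp only: Cons.IH[OF td] lessThan_iff)
  also have "\<dots> = (if k = mcount (j # ds) then \<Prod>i\<in>UNIV. fact (k i) else 0)"
  proof (cases "k = mcount (j # ds)")
    case True
    then have kj: "k j = Suc (?c j)" "k = ?c(j := Suc (?c j))" by (simp_all add: mcount_Cons)
    \<comment> \<open>Only the term whose j-exponent drops by exactly one still has enough degree
      for the remaining differences.\<close>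
    have iff: "k(j := i) = ?c \<longleftrightarrow> i = ?c j" for i
      unfolding kj(2) by (auto simp: fun_eq_iff)
    have "(\<Sum>i<k j. real (k j choose i) * (if k(j := i) = ?c then \<Prod>l\<in>UNIV. fact ((k(j := i)) l) else 0))
      = (\<Sum>i<k j. if i = ?c j then real (k j choose i) * (\<Prod>l\<in>UNIV. fact ((k(j := i)) l)) else 0)"
      using iff by (intro sum.cong) auto
    also have "\<dots> = real (k j choose ?c j) * (\<Prod>l\<in>UNIV. fact (?c l))"
      using kj(1) iff[of "?c j"] by simp
    also have "\<dots> = real (k j) * (\<Prod>l\<in>UNIV. fact (?c l))" using kj(1) by simp
    also have "\<dots> = (\<Prod>i\<in>UNIV. fact (k i))"
    proof -
      have "(\<Prod>l\<in>UNIV. fact (?c l)) = fact (?c j) * (\<Prod>l\<in>UNIV - {j}. fact (?c l) :: real)"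
        by (rule prod.remove) auto
      moreover have "(\<Prod>l\<in>UNIV. fact (k l)) = fact (k j) * (\<Prod>l\<in>UNIV - {j}. fact (k l) :: real)"
        by (rule prod.remove) auto
      moreover have "(\<Prod>l\<in>UNIV - {j}. fact (k l) :: real) = (\<Prod>l\<in>UNIV - {j}. fact (?c l))"
        unfolding kj(2) by (rule prod.cong) auto
      ultimately show ?thesis using kj(1) by simp
    qed
    finally show ?thesis using True by simp
  next
    case False
    have "k(j := i) \<noteq> ?c" if "i < k j" for i
    proof
      assume c: "k(j := i) = ?c"
      then have "tdeg (k(j := i)) = length ds" by (simp add: tdeg_mcount)
      then have "k j = Suc i" using tdeg_upd[of k j i] Cons.prems that by simp
      then have "k = mcount (j # ds)" using c unfolding mcount_Cons by (metis fun_upd_same fun_upd_triv fun_upd_upd)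
      then show False using False by simp
    qed
    then show ?thesis using False by (simp add: sum.neutral)
  qed
  finally show ?case .
qed

lemma fdiffs_poly:
  "fdiffs ds (\<lambda>n. \<Sum>k | tdeg k < Suc (length ds). c k * monom_fun k n) n
    = c (mcount ds) * (\<Prod>i\<in>UNIV. fact (mcount ds i))"
proof -
  have "fdiffs ds (\<lambda>n. \<Sum>k | tdeg k < Suc (length ds). c k * monom_fun k n) n
    = (\<Sum>k | tdeg k < Suc (length ds). c k * (if k = mcount ds then \<Prod>i\<in>UNIV. fact (k i) else 0))"
    unfolding fdiffs_sum by (intro sum.cong refl) (simp add: fdiffs_monom)
  also have "\<dots> = (\<Sum>k | tdeg k < Suc (length ds). if k = mcount ds then c k * (\<Prod>i\<in>UNIV. fact (k i)) else 0)"
    by (intro sum.cong) auto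
  also have "\<dots> = c (mcount ds) * (\<Prod>i\<in>UNIV. fact (mcount ds i))"
    by (simp add: finite_tdeg tdeg_mcount)
  finally show ?thesis .
qed

section \<open>Uniqueness of the coefficients\<close>

lemma mcount_surj: "\<exists>ds. mcount ds = k" for k :: "'d::finite \<Rightarrow> nat"
proof (induction "tdeg k" arbitrary: k)
  case 0
  then show ?case by (intro exI[of _ "[]"]) (auto simp: tdeg_eq_0 mcount_def)
next
  case (Suc m)
  then have "k \<noteq> (\<lambda>_. 0)" by (auto simp: tdeg_eq_0[symmetric])
  then obtain j where j: "k j > 0" by (auto simp: fun_eq_iff)
  have "tdeg (k(j := k j - 1)) = m" using tdeg_upd[of k j "k j - 1"] Suc(2) j by simp
  then obtain ds where "mcount ds = k(j := k j - 1)" using Suc(1) by blast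
  then have "mcount (j # ds) = k" using j by (simp add: mcount_Cons)
  then show ?case by blast
qed

text \<open>For k of maximal total degree in the support, differencing along a list with counts k
  isolates \<open>c k\<close> times factorials; but the differences of a function that vanishes from
  v on are zero at v.\<close>

lemma poly_coeffs_zero:
  fixes c :: "('d::finite \<Rightarrow> nat) \<Rightarrow> real"
  assumes fin: "finite {k. c k \<noteq> 0}" and z: "\<And>n. v \<le> n \<Longrightarrow> (\<Sum>k | c k \<noteq> 0. c k * monom_fun k n) = 0"
  shows "c = (\<lambda>_. 0)"
proof (rule ccontr)
  assume "c \<noteq> (\<lambda>_. 0)"
  then have ne: "{k. c k \<noteq> 0} \<noteq> {}" by auto
  let ?m = "Max (tdeg ` {k. c k \<noteq> 0})"
  have "?m \<in> tdeg ` {k. c k \<noteq> 0}" using fin ne by (intro Max_in) auto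
  then obtain k where k: "c k \<noteq> 0" "tdeg k = ?m" by force
  obtain ds where ds: "mcount ds = k" using mcount_surj by blast
  then have len: "length ds = tdeg k" using tdeg_mcount[of ds] by simp
  have sub: "{l. c l \<noteq> 0} \<subseteq> {l. tdeg l < Suc (length ds)}"
    using fin unfolding len k(2) by (auto simp: less_Suc_eq_le)
  have "(\<lambda>n. \<Sum>l | c l \<noteq> 0. c l * monom_fun l n) = (\<lambda>n. \<Sum>l | tdeg l < Suc (length ds). c l * monom_fun l n)"
    by (intro ext sum.mono_neutral_left finite_tdeg sub) auto
  then have "fdiffs ds (\<lambda>n. \<Sum>l | c l \<noteq> 0. c l * monom_fun l n) v = c k * (\<Prod>i\<in>UNIV. fact (k i))"
    using fdiffs_poly[of ds c v] ds by simp
  moreover have "fdiffs ds (\<lambda>n. \<Sum>l | c l \<noteq> 0. c l * monom_fun l n) v = fdiffs ds (\<lambda>n. \<Sum>l\<in>{}. 0 * monom_fun l n) v"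
    by (rule fdiffs_cong[of v]) (simp_all add: z)
  then have "fdiffs ds (\<lambda>n. \<Sum>l | c l \<noteq> 0. c l * monom_fun l n) v = 0"
    using fdiffs_sum[of ds "\<lambda>_. 0" monom_fun "{}" v] by simp
  ultimately show False using k(1) by simp
qed

lemma poly_coeffs_unique:
  fixes c :: "('d::finite \<Rightarrow> nat) \<Rightarrow> real"
  assumes fin: "finite {k. c k \<noteq> 0}" "finite {k. c' k \<noteq> 0}"
    and eq: "\<And>n. v \<le> n \<Longrightarrow> (\<Sum>k | c k \<noteq> 0. c k * monom_fun k n) = (\<Sum>k | c' k \<noteq> 0. c' k * monom_fun k n)"
  shows "c = c'"
proof -
  let ?D = "{k. c k \<noteq> 0} \<union> {k. c' k \<noteq> 0}"
  let ?d = "\<lambda>k. c k - c' k"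
  have sub: "{k. ?d k \<noteq> 0} \<subseteq> ?D" by auto
  have finD: "finite ?D" using fin by simp
  have "(\<Sum>k | ?d k \<noteq> 0. ?d k * monom_fun k n) = 0" if "v \<le> n" for n
  proof -
    have "(\<Sum>k | ?d k \<noteq> 0. ?d k * monom_fun k n) = (\<Sum>k\<in>?D. ?d k * monom_fun k n)"
      by (rule sum.mono_neutral_left[OF finD sub]) auto
    also have "\<dots> = (\<Sum>k\<in>?D. c k * monom_fun k n) - (\<Sum>k\<in>?D. c' k * monom_fun k n)"
      by (simp add: left_diff_distrib sum_subtractf)
    also have "(\<Sum>k\<in>?D. c k * monom_fun k n) = (\<Sum>k | c k \<noteq> 0. c k * monom_fun k n)"
      by (rule sum.mono_neutral_right[OF finD]) auto
    also have "(\<Sum>k\<in>?D. c' k * monom_fun k n) = (\<Sum>k | c' k \<noteq> 0. c' k * monom_fun k n)"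
      by (rule sum.mono_neutral_right[OF finD]) auto
    finally show ?thesis using eq[OF that] by simp
  qed
  from poly_coeffs_zero[OF finite_subset[OF sub finD] this] have "?d = (\<lambda>_. 0)" by simp
  then show ?thesis by (simp add: fun_eq_iff)
qed

section \<open>Hilbert polynomials\<close>

lemma poly_fun_shift:
  assumes "f \<in> poly_fun t" shows "(\<lambda>n. f (n(j := Suc (n j)))) \<in> poly_fun t"
proof -
  obtain c where f: "f = (\<lambda>n. \<Sum>k | tdeg k < t. c k * monom_fun k n)" using assms by (rule poly_funE)
  have shift: "monom_fun k (n(j := Suc (n j))) = monom_fun k n + (\<Sum>i<k j. real (k j choose i) * monom_fun (k(j := i)) n)"
    for k n using fdiff_monom[of j k n] by (simp only: fdiff_def)
  show ?thesis unfolding f shift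
  proof (intro poly_fun_sum poly_fun_scale poly_fun_add poly_fun_monom)
    fix k :: "'a \<Rightarrow> nat" and i assume "k \<in> {k. tdeg k < t}" "i \<in> {..<k j}"
    then show "tdeg (k(j := i)) < t" using tdeg_upd[of k j i] by simp
  qed simp
qed

lemma le_upd_Suc: "v \<le> n \<Longrightarrow> v \<le> n(j := Suc (n j))"
  by (auto simp: le_fun_def intro: le_SucI)

lemma add_deg_unit_vec: "add_deg (unit_vec j) n = n(j := Suc (n j))"
  by (auto simp: add_deg_def unit_vec_def fun_eq_iff)

locale multigraded_module = graded_mod Sg act Mg
  for Sg :: "('d::finite \<Rightarrow> nat) \<Rightarrow> 'a::comm_ring_1 set"
    and act :: "'a \<Rightarrow> 'm::ab_group_add \<Rightarrow> 'm"
    and Mg :: "('d \<Rightarrow> nat) \<Rightarrow> 'm set" +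
  assumes artinian: "artinian_local_inf_residue (Sg zero_deg)"
    and standard: "gen_alg (Sg zero_deg) (\<Union>i. Sg (unit_vec i)) = UNIV"
    and fg_ring: "fg_algebra Sg"
    and fg_mod: "fg_module act"
begin

sublocale A: artin_local "Sg zero_deg"
proof
  show "a * b \<in> Sg zero_deg" if "a \<in> Sg zero_deg" "b \<in> Sg zero_deg" for a b
    using mult_degree[OF that] by (simp add: zero_deg_add)
qed (rule R.subgroup one_degree artinian)+

lemma acc_module: "acc_on (A_submodule UNIV act)"
proof -
  from fg_ring obtain Y where Y: "finite Y" "gen_alg (Sg zero_deg) Y = UNIV"
    unfolding fg_algebra_def by (elim exE conjE)
  from fg_mod obtain G where G: "finite G" "\<forall>x. \<exists>c. x = (\<Sum>g\<in>G. act (c g) g)"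
    unfolding fg_module_def by (elim exE conjE)
  show ?thesis by (rule A.noetherian[OF module Y G(1)]) (rule spec[OF G(2)])
qed

lemma acc_ring: "acc_on (A_submodule UNIV ((*) :: 'a \<Rightarrow> 'a \<Rightarrow> 'a))"
proof -
  from fg_ring obtain Y where Y: "finite Y" "gen_alg (Sg zero_deg) Y = UNIV"
    unfolding fg_algebra_def by (elim exE conjE)
  have gen: "\<exists>c. x = (\<Sum>g\<in>{1}. c g * g)" for x :: 'a by (rule exI[of _ "\<lambda>_. x"]) simp
  show ?thesis by (rule A.noetherian[OF times_module Y _ gen]) simp
qed

lemma hsub_degree: "hsub N \<Longrightarrow> A_submodule (Sg zero_deg) act (N \<inter> Mg n)"
  unfolding A_submodule_def
proof (intro conjI ballI)
  assume N: "hsub N"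
  show "add_subgroup (N \<inter> Mg n)"
    using hsub_subgroup[OF N] M.subgroup[of n] unfolding add_subgroup_def by simp
  fix a x assume "a \<in> Sg zero_deg" "x \<in> N \<inter> Mg n"
  then show "act a x \<in> N \<inter> Mg n"
    using hsub_act[OF N, of x a] act_degree[of a zero_deg x n] by (simp add: zero_deg_add)
qed

lemma finite_length_degree: "length_sq (Sg zero_deg) act (Mg n) {0} \<noteq> \<infinity>"
proof -
  \<comment> \<open>\<open>E W\<close> is an $S$-submodule with degree \<open>n\<close> part \<open>W\<close>, so chains of $A$-submodules inside
    one degree inherit the ascending chain condition.\<close>
  define E where "E W = {x. \<forall>s. M.comp (act s x) n \<in> W}" for W
  have Mn: "A_submodule (Sg zero_deg) act (Mg n)" using hsub_degree[OF hsub_UNIV, of n] by simp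
  have sub: "A_submodule UNIV act (E W)" if W: "A_submodule (Sg zero_deg) act W" for W
    using submodule_subgroup[OF W] unfolding A_submodule_def add_subgroup_def E_def
    by (auto simp: act_add[OF module] act_minus[OF module] act_0[OF module]
        M.comp_add M.comp_minus M.comp_0 act_mult[OF module, symmetric])
  have rec: "E W \<inter> Mg n = W" if W: "A_submodule (Sg zero_deg) act W \<and> W \<subseteq> Mg n" for W
  proof (intro subset_antisym subsetI IntI)
    fix x assume x: "x \<in> E W \<inter> Mg n"
    then have "M.comp (act 1 x) n \<in> W" unfolding E_def by blast
    then show "x \<in> W" using x M.comp_eq_self[of x n] by (simp add: act_1[OF module])
  next
    fix x assume x: "x \<in> W"
    then show xn: "x \<in> Mg n" using W by blast
    have "M.comp (act s x) n = act (R.comp s zero_deg) x" for s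
      using comp_act_on_homogeneous[OF xn, of s zero_deg] by (simp add: zero_deg_add)
    moreover have "act (R.comp s zero_deg) x \<in> W" for s
      using A_submodule_act[of "Sg zero_deg" act W] W x R.comp_mem by blast
    ultimately show "x \<in> E W" unfolding E_def by simp
  qed
  have "acc_on (\<lambda>W. A_submodule (Sg zero_deg) act W \<and> W \<subseteq> Mg n)"
    unfolding acc_on_def
  proof (intro allI impI)
    fix f :: "nat \<Rightarrow> _" assume f: "\<forall>k. (A_submodule (Sg zero_deg) act (f k) \<and> f k \<subseteq> Mg n) \<and> f k \<subseteq> f (Suc k)"
    have fk: "A_submodule (Sg zero_deg) act (f k) \<and> f k \<subseteq> Mg n" for k using spec[OF f, of k] by (rule conjunct1)
    have "\<exists>k. \<forall>m\<ge>k. E (f m) = E (f k)"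
    proof (rule acc_onD[OF acc_module])
      show "A_submodule UNIV act (E (f k))" for k by (rule sub[OF conjunct1[OF fk]])
      show "E (f k) \<subseteq> E (f (Suc k))" for k unfolding E_def using conjunct2[OF spec[OF f, of k]] by blast
    qed
    then obtain k where "\<forall>m\<ge>k. E (f m) = E (f k)" ..
    then have "\<forall>m\<ge>k. f m = f k" using rec[OF fk] by metis
    then show "\<exists>k. \<forall>m\<ge>k. f m = f k" ..
  qed
  then show ?thesis by (rule A.acc_finite_length[OF module Mn])
qed

section \<open>Hilbert functions of homogeneous subquotients\<close>

definition hl :: "'m set \<Rightarrow> 'm set \<Rightarrow> ('d \<Rightarrow> nat) \<Rightarrow> nat" where
  "hl N L n = the_enat (hlen Sg act Mg N L n)"

text \<open>Monotonicity bounds the length by that of the whole graded piece, which is finite; this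
  makes \<open>the_enat\<close> in \<open>hl\<close> faithful.\<close>

lemma hlen_eq:
  assumes "hsub L" "hsub N" "L \<subseteq> N" shows "hlen Sg act Mg N L n = enat (hl N L n)"
proof -
  have z: "A_submodule (Sg zero_deg) act {0}" by (rule A.A_submodule_singleton_0[OF module])
  have Mn: "A_submodule (Sg zero_deg) act (Mg n)" using hsub_degree[OF hsub_UNIV, of n] by simp
  have "length_sq (Sg zero_deg) act (N \<inter> Mg n) (L \<inter> Mg n) \<le> length_sq (Sg zero_deg) act (N \<inter> Mg n) {0}"
    using hsub_0[OF assms(1)] M.zero_mem assms(3)
    by (intro A.length_sq_mono(1)[OF module z] hsub_degree assms) auto
  also have "\<dots> \<le> length_sq (Sg zero_deg) act (Mg n) {0}"
    using hsub_0[OF assms(2)] M.zero_mem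
    by (intro A.length_sq_mono(2)[OF module z] hsub_degree assms Mn) auto
  finally show ?thesis
    using finite_length_degree[of n] unfolding hl_def hlen_def
    by (cases "length_sq (Sg zero_deg) act (N \<inter> Mg n) (L \<inter> Mg n)") auto
qed

lemma hl_add:
  assumes "hsub L" "hsub K" "hsub N" "L \<subseteq> K" "K \<subseteq> N"
  shows "hl N L n = hl N K n + hl K L n"
proof -
  have "hlen Sg act Mg N L n = hlen Sg act Mg N K n + hlen Sg act Mg K L n"
    unfolding hlen_def using assms by (intro length_sq_add[OF module] hsub_degree) auto
  moreover have "L \<subseteq> N" using assms by auto
  ultimately show ?thesis using assms by (simp add: hlen_eq)
qed

lemma hl_self: "hsub L \<Longrightarrow> hl L L n = 0"
  using hlen_eq[of L L n] length_sq_self[OF hsub_degree[of L n]] by (simp add: hlen_def zero_enat_def)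

lemma hsub_set_add_image:
  assumes "s \<in> Sg a" "hsub L" "hsub N" "L \<subseteq> N"
  shows "hsub (set_add L (act s ` N))" "L \<subseteq> set_add L (act s ` N)" "set_add L (act s ` N) \<subseteq> N"
    "hsub {x \<in> N. act s x \<in> L}" "L \<subseteq> {x \<in> N. act s x \<in> L}"
proof -
  have i: "hsub (act s ` N)" by (rule hsub_image[OF assms(1,3)])
  show "hsub (set_add L (act s ` N))" by (rule hsub_set_add[OF assms(2) i])
  show "L \<subseteq> set_add L (act s ` N)" by (rule set_add_left[OF hsub_0[OF i]])
  show "set_add L (act s ` N) \<subseteq> N"
    using hsub_act[OF assms(3)] by (intro set_add_least hsub_subgroup assms) auto
  show "hsub {x \<in> N. act s x \<in> L}" by (rule hsub_vimage[OF assms(1,3,2)])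
  show "L \<subseteq> {x \<in> N. act s x \<in> L}" using hsub_act[OF assms(2)] assms(4) by auto
qed

text \<open>The exact sequence $0 \to (L : s)/L \to N/L \to N/L \to N/(L + sN) \to 0$.\<close>
lemma hl_mult:
  assumes s: "s \<in> Sg a" and L: "hsub L" and N: "hsub N" and le: "L \<subseteq> N"
  shows "hl N L (add_deg a n) + hl {x \<in> N. act s x \<in> L} L n
    = hl N (set_add L (act s ` N)) (add_deg a n) + hl N L n"
proof -
  let ?K = "set_add L (act s ` N)" and ?V = "{x \<in> N. act s x \<in> L}"
  note K = hsub_set_add_image[OF s L N le]
  \<comment> \<open>In degree a + n, the submodule L + sN consists of s times the degree n part of N
    plus the part of L. So \<open>length_sq_image\<close> applies to multiplication by s from one
    graded piece to the other.\<close>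
  have KM: "?K \<inter> Mg (add_deg a n) = set_add (act s ` (N \<inter> Mg n)) (L \<inter> Mg (add_deg a n))"
  proof (intro subset_antisym subsetI)
    fix k assume k: "k \<in> ?K \<inter> Mg (add_deg a n)"
    then obtain l x where lx: "k = l + act s x" "l \<in> L" "x \<in> N" by (auto elim: set_add_E)
    have "k = M.comp k (add_deg a n)" using k M.comp_eq_self[of k "add_deg a n"] by simp
    also have "\<dots> = act s (M.comp x n) + M.comp l (add_deg a n)"
      by (simp add: lx(1) M.comp_add comp_act_homogeneous[OF s])
    finally have "k = act s (M.comp x n) + M.comp l (add_deg a n)" .
    moreover have "act s (M.comp x n) \<in> act s ` (N \<inter> Mg n)"
      using hsub_comp[OF N lx(3)] M.comp_mem by blast
    moreover have "M.comp l (add_deg a n) \<in> L \<inter> Mg (add_deg a n)"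
      using hsub_comp[OF L lx(2)] M.comp_mem by blast
    ultimately show "k \<in> set_add (act s ` (N \<inter> Mg n)) (L \<inter> Mg (add_deg a n))"
      using set_add_I by metis
  next
    fix k assume "k \<in> set_add (act s ` (N \<inter> Mg n)) (L \<inter> Mg (add_deg a n))"
    then obtain x l where k: "k = act s x + l" "x \<in> N" "x \<in> Mg n" "l \<in> L" "l \<in> Mg (add_deg a n)"
      by (auto elim: set_add_E)
    have "k = l + act s x" using k(1) by simp
    then have "k \<in> ?K" using set_add_I[OF k(4), of "act s x" "act s ` N"] k(2) by simp
    moreover have "k \<in> Mg (add_deg a n)"
      unfolding k(1) by (rule subgroup_add[OF M.subgroup act_degree[OF s k(3)] k(5)])
    ultimately show "k \<in> ?K \<inter> Mg (add_deg a n)" by blast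
  qed
  have VM: "{x \<in> N \<inter> Mg n. act s x \<in> L \<inter> Mg (add_deg a n)} = ?V \<inter> Mg n"
    using act_degree[OF s] by blast
  have "length_sq (Sg zero_deg) act (N \<inter> Mg n) (?V \<inter> Mg n)
      = length_sq (Sg zero_deg) act (?K \<inter> Mg (add_deg a n)) (L \<inter> Mg (add_deg a n))"
    using A_linear.length_sq_image[OF linear_act hsub_degree[OF N, of n] hsub_degree[OF L, of "add_deg a n"] KM]
    unfolding VM .
  then have "hl N ?V n = hl ?K L (add_deg a n)" unfolding hl_def hlen_def by simp
  moreover have "hl N L n = hl N ?V n + hl ?V L n" by (rule hl_add[OF L K(4) N K(5)]) auto
  moreover have "hl N L (add_deg a n) = hl N ?K (add_deg a n) + hl ?K L (add_deg a n)"
    by (rule hl_add[OF L K(1) N K(2,3)])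
  ultimately show ?thesis by linarith
qed

section \<open>Homogeneous primes and elements of positive degree\<close>

lemma colon_ideal:
  assumes "hsub L" shows "A_submodule UNIV (*) {s. act s x \<in> L}"
proof -
  have "A_linear UNIV (*) act (\<lambda>s. act s x)"
    using module by (simp add: A_linear_def times_module act_add_left act_mult)
  from A_linear.A_submodule_vimage[OF this _ hsub_submodule[OF assms], of UNIV]
  show ?thesis by (simp add: A_submodule_def add_subgroup_def)
qed

text \<open>An associated prime: take a maximal annihilator of a nonzero homogeneous element x of
  N/L. If a homogeneous t does not kill x, then \<open>act t x\<close> has the same annihilator, so
  an s that kills \<open>act t x\<close> already kills x.\<close>

lemma exists_homogeneous_prime:
  assumes L: "hsub L" and N: "hsub N" and le: "L \<subseteq> N" "L \<noteq> N"
  obtains b x where "x \<in> Mg b" "x \<in> N" "x \<notin> L" "prime_ideal {s. act s x \<in> L}"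
    "homogeneous_ideal Sg {s. act s x \<in> L}"
proof -
  let ?ann = "\<lambda>x. {s. act s x \<in> L}"
  let ?F = "{?ann x | x b. x \<in> Mg b \<and> x \<in> N \<and> x \<notin> L}"
  obtain y where y: "y \<in> N" "y \<notin> L" using le by blast
  then obtain b0 where b0: "M.comp y b0 \<notin> L" using M.mem_from_comps[OF hsub_subgroup[OF L]] by blast
  have mem: "?ann (M.comp y b0) \<in> ?F"
    using b0 M.comp_mem[of y b0] hsub_comp[OF N y(1)] by blast
  have "\<exists>U\<in>?F. \<forall>V\<in>?F. U \<subseteq> V \<longrightarrow> V = U"
    by (rule acc_on_maximal[OF acc_ring mem]) (use colon_ideal[OF L] in blast)
  then obtain U where U: "U \<in> ?F" and max: "\<forall>V\<in>?F. U \<subseteq> V \<longrightarrow> V = U" ..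
  from U obtain x b where x: "U = ?ann x" "x \<in> Mg b" "x \<in> N" "x \<notin> L" by blast
  have sub: "A_submodule UNIV (*) U" unfolding x(1) by (rule colon_ideal[OF L])
  have comps: "R.comp s n \<in> U" if "s \<in> U" for s n
  proof -
    have "M.comp (act s x) (add_deg n b) \<in> L" using hsub_comp[OF L] that x(1) by blast
    then show ?thesis using x(1) by (simp add: comp_act_on_homogeneous[OF x(2)])
  qed
  have "prime_ideal U"
  proof (rule prime_idealI)
    show "add_subgroup U" by (rule submodule_subgroup[OF sub])
    show "s \<in> U \<Longrightarrow> a * s \<in> U" for a s using A_submodule_act[OF sub, of a s] by simp
    show "1 \<notin> U" using x(1,4) by (simp add: act_1[OF module])
    show "s \<in> U \<Longrightarrow> R.comp s n \<in> U" for s n by (rule comps)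
    fix s t m n assume st: "s \<in> Sg m" "t \<in> Sg n" "s * t \<in> U"
    show "s \<in> U \<or> t \<in> U"
    proof (rule disjCI)
      assume "t \<notin> U"
      then have "act t x \<notin> L" using x(1) by blast
      then have "?ann (act t x) \<in> ?F" using act_degree[OF st(2) x(2)] hsub_act[OF N x(3)] by blast
      moreover have "U \<subseteq> ?ann (act t x)"
      proof
        fix r assume "r \<in> U"
        then have "act t (act r x) \<in> L" using x(1) hsub_act[OF L] by blast
        moreover have "act t (act r x) = act r (act t x)"
          by (simp add: act_mult[OF module, symmetric] mult.commute)
        ultimately show "r \<in> ?ann (act t x)" by simp
      qed
      ultimately have "?ann (act t x) = U" using max by blast
      moreover have "s \<in> ?ann (act t x)" using st(3) x(1) by (simp add: act_mult[OF module])
      ultimately show "s \<in> U" by simp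
    qed
  qed
  moreover have "homogeneous_ideal Sg U" unfolding homogeneous_ideal_iff using comps by blast
  ultimately show thesis using that x by blast
qed

text \<open>By standardness, an element of positive i-th degree is a sum of products that each
  contain a factor of degree e_i.\<close>

lemma positive_degree_mem:
  assumes P: "prime_ideal P" and gen: "Sg (unit_vec i) \<subseteq> P" and s: "s \<in> Sg n" "n i \<ge> 1"
  shows "s \<in> P"
proof -
  have sub: "add_subgroup P" and mult: "\<And>a x. x \<in> P \<Longrightarrow> a * x \<in> P"
    using P unfolding prime_ideal_def by blast+
  \<comment> \<open>Generation passes through inhomogeneous elements, so the claim is made for all
    components at once.\<close>
  have "\<forall>n. n i \<ge> 1 \<longrightarrow> R.comp s n \<in> P" if "s \<in> gen_alg (Sg zero_deg) (\<Union>i. Sg (unit_vec i))" for s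
    using that
  proof induction
    case (base a)
    then show ?case by (auto simp: R.comp_homog zero_deg_def subgroup_0[OF sub])
  next
    case (gen g)
    then obtain j where g: "g \<in> Sg (unit_vec j)" by blast
    show ?case
    proof (intro allI impI)
      fix n :: "'d \<Rightarrow> nat" assume n: "1 \<le> n i"
      show "R.comp g n \<in> P"
      proof (cases "n = unit_vec j")
        case True
        then have "j = i" using n by (auto simp: unit_vec_def split: if_splits)
        then show ?thesis using True g assms(2) by (auto simp: R.comp_homog[OF g])
      next
        case False
        then show ?thesis by (simp add: R.comp_homog[OF g] subgroup_0[OF sub])
      qed
    qed
  next
    case (add x y)
    then show ?case by (auto simp: R.comp_add intro: subgroup_add[OF sub])
  next
    case (mult x y)
    show ?case
    proof (intro allI impI)
      fix n :: "'d \<Rightarrow> nat" assume n: "1 \<le> n i"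
      have "R.comp x a * R.comp y b \<in> P" if "add_deg a b = n" for a b
      proof -
        have "a i + b i = n i" using that by (auto simp: add_deg_def)
        then have "1 \<le> a i \<or> 1 \<le> b i" using n by linarith
        then show ?thesis using mult.IH assms(1)
          by (metis \<open>\<And>x a. x \<in> P \<Longrightarrow> a * x \<in> P\<close> mult.commute)
      qed
      then show "R.comp (x * y) n \<in> P"
        unfolding graded_mod.comp_act[OF graded_mod_ring[OF ring]]
        by (intro subgroup_sum[OF sub]) (auto simp: subgroup_0[OF sub])
    qed
  next
    case (neg x)
    then show ?case by (auto simp: R.comp_minus intro: subgroup_uminus[OF sub])
  qed
  from this[of s] have "R.comp s n \<in> P" using standard s(2) by simp
  then show ?thesis using s(1) R.comp_eq_self[of s n] by simp
qed

lemma S_pp_memI: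
  assumes "s \<in> Sg n" "\<forall>i. 1 \<le> n i" shows "s \<in> S_pp Sg"
proof -
  let ?f = "\<lambda>k. R.comp s k"
  have "?f k = (if k = n then s else 0)" for k using R.comp_homog[OF assms(1)] .
  then have "\<forall>k. ?f k \<noteq> 0 \<longrightarrow> (\<forall>i. 1 \<le> k i)" using assms(2) by simp
  then show ?thesis unfolding S_pp_def
    using R.finite_degs[of s] R.comp_mem[of s] R.comp_decomp[of s, symmetric] unfolding R.degs_def by blast
qed

lemma S_pp_subset:
  assumes "add_subgroup P" "\<And>s n. s \<in> Sg n \<Longrightarrow> \<forall>i. 1 \<le> n i \<Longrightarrow> s \<in> P" shows "S_pp Sg \<subseteq> P"
proof
  fix s assume "s \<in> S_pp Sg"
  then obtain f where f: "\<forall>n. f n \<in> Sg n" "\<forall>n. f n \<noteq> 0 \<longrightarrow> (\<forall>i. 1 \<le> n i)" "s = (\<Sum>n\<in>{n. f n \<noteq> 0}. f n)"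
    unfolding S_pp_def by blast
  show "s \<in> P" unfolding f(3) by (rule subgroup_sum[OF assms(1)]) (use assms(2) f(1,2) in blast)
qed

lemma exists_unit_degree_notin:
  assumes P: "prime_ideal P" "\<not> S_pp Sg \<subseteq> P"
  obtains y where "y \<in> Sg (unit_vec i)" "y \<notin> P"
proof -
  have "\<not> Sg (unit_vec i) \<subseteq> P"
  proof
    assume "Sg (unit_vec i) \<subseteq> P"
    then have "S_pp Sg \<subseteq> P"
      using positive_degree_mem[OF P(1)] P(1) by (intro S_pp_subset) (auto simp: prime_ideal_def)
    then show False using P(2) by simp
  qed
  then show thesis using that by blast
qed

text \<open>Counts primes, not inclusions: the bound t stands for dimension at most t - 1, and t = 0
  for the empty set.\<close>

definition chain_le :: "nat \<Rightarrow> 'a set set \<Rightarrow> bool" where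
  "chain_le t X \<longleftrightarrow> (\<forall>C. set C \<subseteq> X \<longrightarrow> sorted_wrt (\<subset>) C \<longrightarrow> length C \<le> t)"

lemma chain_le_mono: "chain_le t X \<Longrightarrow> Y \<subseteq> X \<Longrightarrow> chain_le t Y"
  unfolding chain_le_def by blast

abbreviation Supp :: "'m set \<Rightarrow> 'm set \<Rightarrow> 'a set set" where
  "Supp N L \<equiv> Supp_pp Sg act N L"

lemma Supp_mono: "N \<subseteq> N' \<Longrightarrow> L' \<subseteq> L \<Longrightarrow> Supp N L \<subseteq> Supp N' L'"
  unfolding Supp_pp_def by blast

text \<open>Here U/L is a shifted copy of S/P with P a homogeneous prime. The assumption IH is the
  full statement for smaller bounds; the induction in \<open>hilbert_polynomial\<close> supplies
  it.\<close>

lemma hilbert_polynomial_step: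
  assumes L: "hsub L" and N: "hsub N" and le: "L \<subseteq> N" and x: "x \<in> Mg b" "x \<in> N" "x \<notin> L"
    and P: "prime_ideal {s. act s x \<in> L}" "homogeneous_ideal Sg {s. act s x \<in> L}"
    and ch: "chain_le t (Supp N L)"
    and IH: "\<And>t' N L. t' < t \<Longrightarrow> hsub L \<Longrightarrow> hsub N \<Longrightarrow> L \<subseteq> N \<Longrightarrow> chain_le t' (Supp N L) \<Longrightarrow>
      \<exists>p\<in>poly_fun t'. \<exists>v. \<forall>n\<ge>v. real (hl N L n) = p n"
  shows "\<exists>p\<in>poly_fun t. \<exists>v. \<forall>n\<ge>v. real (hl (set_add (range (\<lambda>s. act s x)) L) L n) = p n"
proof -
  let ?P = "{s. act s x \<in> L}" and ?C = "range (\<lambda>s. act s x)"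
  let ?U = "set_add ?C L"
  have C: "hsub ?C" by (rule hsub_cyclic[OF x(1)])
  have U: "hsub ?U" by (rule hsub_set_add[OF C L])
  have LU: "L \<subseteq> ?U" by (rule set_add_right[OF hsub_0[OF C]])
  have UN: "?U \<subseteq> N" using hsub_act[OF N x(2)] le by (intro set_add_least hsub_subgroup[OF N]) auto
  show ?thesis
  proof (cases "S_pp Sg \<subseteq> ?P")
    case True
    \<comment> \<open>From degree b + (1,...,1) on, an element of U is, up to L, a multiple of x by
      an element of S_{++}, and such multiples lie in L.\<close>
    have "hl ?U L n = 0" if n: "add_deg b (\<lambda>_. 1) \<le> n" for n
    proof -
      have bn: "b \<le> n" "\<forall>i. 1 \<le> n i - b i"
      proof -
        have *: "Suc (b i) \<le> n i" for i using n by (simp add: add_deg_def le_fun_def)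
        show "b \<le> n" using * by (auto simp: le_fun_def intro: Suc_leD)
        show "\<forall>i. 1 \<le> n i - b i"
        proof
          fix i show "1 \<le> n i - b i" using *[of i] by linarith
        qed
      qed
      have "?U \<inter> Mg n \<subseteq> L"
      proof
        fix u assume u: "u \<in> ?U \<inter> Mg n"
        then obtain s l where sl: "u = act s x + l" "l \<in> L" by (auto elim: set_add_E)
        let ?a = "\<lambda>i. n i - b i"
        have n': "add_deg ?a b = n" by (rule add_deg_diff[OF bn(1)])
        have "u = M.comp u n" using u M.comp_eq_self[of u n] by simp
        also have "\<dots> = act (R.comp s ?a) x + M.comp l n"
          using comp_act_on_homogeneous[OF x(1), of s ?a] by (simp add: sl(1) M.comp_add n')
        finally have eq: "u = act (R.comp s ?a) x + M.comp l n" .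
        have "R.comp s ?a \<in> S_pp Sg" by (rule S_pp_memI[OF R.comp_mem]) (use bn(2) in simp)
        then have "act (R.comp s ?a) x \<in> L" using True by blast
        then show "u \<in> L" unfolding eq
          by (rule subgroup_add[OF hsub_subgroup[OF L] _ hsub_comp[OF L sl(2)]])
      qed
      then have "?U \<inter> Mg n = L \<inter> Mg n" using LU by blast
      then have "hl ?U L n = hl L L n" unfolding hl_def hlen_def by simp
      then show ?thesis by (simp add: hl_self[OF L])
    qed
    then show ?thesis by (intro bexI[OF _ poly_fun_0] exI[of _ "add_deg b (\<lambda>_. 1)"] allI impI) simp
  next
    case False
    have PS: "?P \<in> Supp N L"
      unfolding Supp_pp_def Proj_def using P False x(2) by blast
    \<comment> \<open>P itself belongs to the support, so t is positive, and P can be spent as the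
      smallest member of a chain.\<close>
    then have "length [?P] \<le> t" using ch unfolding chain_le_def by (metis empty_set empty_subsetI insert_subset list.simps(15) sorted_wrt1)
    then obtain t' where t: "t = Suc t'" by (cases t) auto
    have "\<exists>q v. q \<in> poly_fun t' \<and> (\<forall>n\<ge>v. fdiff i (\<lambda>n. real (hl ?U L n)) n = q n)" for i
    proof -
      obtain y where y: "y \<in> Sg (unit_vec i)" "y \<notin> ?P" using exists_unit_degree_notin[OF P(1) False] by blast
      let ?K = "set_add L (act y ` ?U)"
      note K = hsub_set_add_image[OF y(1) L U LU]
      \<comment> \<open>Multiplication by y is injective on U/L because P is prime and y is outside
        P; the kernel term of \<open>hl_mult\<close> disappears.\<close>
      have colon: "{u \<in> ?U. act y u \<in> L} = L"
      proof (intro subset_antisym subsetI)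
        fix u assume "u \<in> {u \<in> ?U. act y u \<in> L}"
        then have u: "u \<in> ?U" "act y u \<in> L" by auto
        from u(1) obtain s l where sl: "u = act s x + l" "l \<in> L" by (auto elim: set_add_E)
        have "act y (act s x) = act y u - act y l" unfolding sl(1) by (simp add: act_add[OF module])
        then have "act (y * s) x \<in> L"
          using subgroup_minus[OF hsub_subgroup[OF L] u(2) hsub_act[OF L sl(2), of y]]
          by (simp add: act_mult[OF module])
        then have "s \<in> ?P" using P(1) y(2) unfolding prime_ideal_def by blast
        then show "u \<in> L" unfolding sl(1) using subgroup_add[OF hsub_subgroup[OF L] _ sl(2)] by blast
      qed (use LU hsub_act[OF L] in blast)
      have eq: "hl ?U L (n(i := Suc (n i))) = hl ?U ?K (n(i := Suc (n i))) + hl ?U L n" for n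
        using hl_mult[OF y(1) L U LU, of n] unfolding colon add_deg_unit_vec hl_self[OF L] by simp
      \<comment> \<open>A prime Q supporting U/(L + yU) contains the annihilator P of U/L and also
        y, so it is strictly larger than P.\<close>
      have sup: "Q \<in> Supp N L \<and> ?P \<subset> Q" if Q: "Q \<in> Supp ?U ?K" for Q
      proof -
        obtain u where u: "u \<in> ?U" "\<And>s. s \<notin> Q \<Longrightarrow> act s u \<notin> ?K" using Q unfolding Supp_pp_def by blast
        have "?P \<subseteq> Q"
        proof
          fix s assume s: "s \<in> ?P"
          from u(1) obtain r l where rl: "u = act r x + l" "l \<in> L" by (auto elim: set_add_E)
          have "act s u = act r (act s x) + act s l" unfolding rl(1)
            by (simp add: act_add[OF module] act_mult[OF module, symmetric] mult.commute)
          moreover have "act r (act s x) \<in> L" using s hsub_act[OF L] by blast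
          ultimately have "act s u \<in> L"
            using subgroup_add[OF hsub_subgroup[OF L] _ hsub_act[OF L rl(2)]] by simp
          then show "s \<in> Q" using u(2) K(2) by blast
        qed
        moreover have "act y u \<in> ?K" using set_add_right[OF hsub_0[OF L], of "act y ` ?U"] u(1) by blast
        then have "y \<in> Q" using u(2) by blast
        moreover have "Q \<in> Supp N L" using Supp_mono[OF UN K(2)] Q by blast
        ultimately show ?thesis using y(2) by blast
      qed
      have "chain_le t' (Supp ?U ?K)" unfolding chain_le_def
      proof (intro allI impI)
        fix C assume C: "set C \<subseteq> Supp ?U ?K" "sorted_wrt (\<subset>) C"
        have "set (?P # C) \<subseteq> Supp N L" "sorted_wrt (\<subset>) (?P # C)" using PS sup C by auto
        then have "length (?P # C) \<le> t" using ch unfolding chain_le_def by blast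
        then show "length C \<le> t'" using t by simp
      qed
      then obtain p v where p: "p \<in> poly_fun t'" "\<forall>n\<ge>v. real (hl ?U ?K n) = p n"
        using IH[OF _ K(1) U K(3)] t by blast
      \<comment> \<open>In \<open>eq\<close> the quotient is evaluated at the raised degree, hence
        the shift in the polynomial.\<close>
      show ?thesis
      proof (intro exI[of _ "\<lambda>n. p (n(i := Suc (n i)))"] exI[of _ v] conjI allI impI)
        show "(\<lambda>n. p (n(i := Suc (n i)))) \<in> poly_fun t'" by (rule poly_fun_shift[OF p(1)])
        fix n assume "v \<le> n"
        then have "v \<le> n(i := Suc (n i))" by (rule le_upd_Suc)
        then have "real (hl ?U ?K (n(i := Suc (n i)))) = p (n(i := Suc (n i)))"
          by (rule p(2)[rule_format])
        then show "fdiff i (\<lambda>n. real (hl ?U L n)) n = p (n(i := Suc (n i)))"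
          unfolding fdiff_def using eq[of n] by simp
      qed
    qed
    then obtain q v where qv: "\<And>i. q i \<in> poly_fun t'"
      "\<And>i. \<forall>n\<ge>v i. fdiff i (\<lambda>n. real (hl ?U L n)) n = q i n" by metis
    define w where "w = (\<lambda>k. \<Sum>i\<in>UNIV. v i k)"
    have "v i \<le> w" for i unfolding w_def le_fun_def by (auto intro: member_le_sum)
    then have "fdiff i (\<lambda>n. real (hl ?U L n)) n = q i n" if "w \<le> n" for i n
      using qv(2)[of i] order_trans[OF _ that, of "v i"] by blast
    from discrete_integration[of q, OF qv(1) this] show ?thesis unfolding t by blast
  qed
qed

text \<open>Strong induction on t; inside it, for fixed N, a maximal K for which the claim fails.
  Adding a homogeneous x with prime annihilator modulo K gives U with N/U good by maximality and U/K
  covered by \<open>hilbert_polynomial_step\<close>.\<close>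

lemma hilbert_polynomial:
  "hsub L \<Longrightarrow> hsub N \<Longrightarrow> L \<subseteq> N \<Longrightarrow> chain_le t (Supp N L) \<Longrightarrow>
    \<exists>p\<in>poly_fun t. \<exists>v. \<forall>n\<ge>v. real (hl N L n) = p n"
proof (induction t arbitrary: N L rule: less_induct)
  case (less t)
  let ?good = "\<lambda>L. \<exists>p\<in>poly_fun t. \<exists>v. \<forall>n\<ge>v. real (hl N L n) = p n"
  let ?F = "{L. hsub L \<and> L \<subseteq> N \<and> chain_le t (Supp N L) \<and> \<not> ?good L}"
  show ?case
  proof (rule ccontr)
    assume "\<not> ?good L"
    then have "L \<in> ?F" using less.prems by blast
    then have "\<exists>U\<in>?F. \<forall>V\<in>?F. U \<subseteq> V \<longrightarrow> V = U"
      by (rule acc_on_maximal[OF acc_module]) (simp add: hsub_submodule)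
    then obtain K where K: "K \<in> ?F" and max: "\<forall>V\<in>?F. K \<subseteq> V \<longrightarrow> V = K" ..
    have Kh: "hsub K" and KN: "K \<subseteq> N" and Kch: "chain_le t (Supp N K)" and bad: "\<not> ?good K"
      using K by blast+
    have N: "hsub N" by fact
    have "K \<noteq> N"
    proof
      assume "K = N"
      then have "real (hl N K n) = 0" for n using hl_self[OF N] by simp
      then have "?good K" by (intro bexI[OF _ poly_fun_0]) simp
      then show False using bad by contradiction
    qed
    from exists_homogeneous_prime[OF Kh N KN this]
    obtain b x where x: "x \<in> Mg b" "x \<in> N" "x \<notin> K" "prime_ideal {s. act s x \<in> K}"
      "homogeneous_ideal Sg {s. act s x \<in> K}" by blast
    let ?C = "range (\<lambda>s. act s x)"
    let ?U = "set_add ?C K"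
    have C: "hsub ?C" by (rule hsub_cyclic[OF x(1)])
    have U: "hsub ?U" by (rule hsub_set_add[OF C Kh])
    have KU: "K \<subseteq> ?U" by (rule set_add_right[OF hsub_0[OF C]])
    have UN: "?U \<subseteq> N" using hsub_act[OF N x(2)] KN by (intro set_add_least hsub_subgroup[OF N]) auto
    have "x \<in> ?C" using act_1[OF module, of x] by (metis rangeI)
    then have "x \<in> ?U" using set_add_left[OF hsub_0[OF Kh], of ?C] by blast
    then have "?U \<noteq> K" using x(3) by blast
    then have "?U \<notin> ?F" using max KU by blast
    moreover have "chain_le t (Supp N ?U)" by (rule chain_le_mono[OF Kch Supp_mono[OF order_refl KU]])
    ultimately have "?good ?U" using U UN by blast
    then obtain p v where p: "p \<in> poly_fun t" "\<forall>n\<ge>v. real (hl N ?U n) = p n" by blast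
    obtain p' v' where p': "p' \<in> poly_fun t" "\<forall>n\<ge>v'. real (hl ?U K n) = p' n"
      using hilbert_polynomial_step[OF Kh N KN x Kch less.IH] by blast
    have "\<forall>n\<ge>sup v v'. real (hl N K n) = p n + p' n"
      using p(2) p'(2) hl_add[OF Kh U N KU UN] by simp
    then have "?good K" by (intro bexI[OF _ poly_fun_add[OF p(1) p'(1)]] exI)
    then show False using bad by contradiction
  qed
qed

end

section \<open>The mixed multiplicity symbol\<close>

lemma fdiffs_diff: "fdiffs ds (\<lambda>n. f n - g n) n = fdiffs ds f n - fdiffs ds g n"
proof (induction ds arbitrary: f g)
  case (Cons j ds)
  have "fdiff j (\<lambda>n. f n - g n) = (\<lambda>n. fdiff j f n - fdiff j g n)"
    by (rule ext) (simp add: fdiff_def)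
  then show ?case using Cons[of "fdiff j f" "fdiff j g"] by simp
qed simp

lemma fdiffs_shift: "fdiffs ds (\<lambda>n. h (n(j := Suc (n j)))) n = fdiffs ds h (n(j := Suc (n j)))"
proof (induction ds arbitrary: h)
  case (Cons i ds)
  have "fdiff i (\<lambda>n. h (n(j := Suc (n j)))) = (\<lambda>n. fdiff i h (n(j := Suc (n j))))"
    by (rule ext, cases "i = j") (simp_all add: fdiff_def fun_upd_twist)
  then show ?case using Cons[of "fdiff i h"] by (simp only: fdiffs.simps)
qed simp

lemma poly_fun_1:
  assumes "p \<in> poly_fun 1" obtains c where "p = (\<lambda>n. c)"
proof -
  obtain c where c: "p = (\<lambda>n. \<Sum>k | tdeg k < 1. c k * monom_fun k n)" using assms by (rule poly_funE)
  have "{k :: 'a \<Rightarrow> nat. tdeg k < 1} = {\<lambda>_. 0}" by (auto simp: tdeg_eq_0)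
  then have "p = (\<lambda>n. c (\<lambda>_. 0))" unfolding c by (simp add: monom_fun_def)
  then show thesis by (rule that)
qed

lemma prime_ideal_prod_notin:
  assumes "prime_ideal P" "\<And>i. i \<in> I \<Longrightarrow> f i \<notin> P" shows "prod f I \<notin> P"
proof -
  have one: "1 \<notin> P"
  proof
    assume "1 \<in> P"
    moreover have "\<forall>a x. x \<in> P \<longrightarrow> a * x \<in> P" "P \<noteq> UNIV" using assms(1) unfolding prime_ideal_def by blast+
    ultimately have "a \<in> P" for a by (metis mult.right_neutral)
    then show False using \<open>P \<noteq> UNIV\<close> by blast
  qed
  have mult: "a \<notin> P \<Longrightarrow> b \<notin> P \<Longrightarrow> a * b \<notin> P" for a b
    using assms(1) unfolding prime_ideal_def by blast
  show ?thesis using assms(2)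
    by (induction I rule: infinite_finite_induct) (simp_all add: one mult)
qed

text \<open>Nakayama's lemma at the prime \<^term>\<open>P\<close>, by eliminating the generators one after the other.\<close>
lemma prime_nakayama:
  assumes M: "module_act act" and P: "prime_ideal P" and "finite G" "s \<notin> P"
    and "\<And>g. g \<in> G \<Longrightarrow> \<exists>c. (\<forall>h. c h \<in> P) \<and> act s g = (\<Sum>h\<in>G. act (c h) h)"
  shows "\<exists>t. t \<notin> P \<and> (\<forall>g\<in>G. act t g = 0)"
  using assms(3-5)
proof (induction G arbitrary: s)
  case empty
  then show ?case by blast
next
  case (insert g0 G)
  have sub: "add_subgroup P" and mult: "\<And>a x. x \<in> P \<Longrightarrow> a * x \<in> P" and
    prime: "\<And>a b. a \<notin> P \<Longrightarrow> b \<notin> P \<Longrightarrow> a * b \<notin> P"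
    using P unfolding prime_ideal_def by blast+
  obtain c where c: "\<forall>h. c h \<in> P" "act s g0 = (\<Sum>h\<in>insert g0 G. act (c h) h)"
    using insert.prems(2)[of g0] by blast
  \<comment> \<open>Moving the g0 term to the left expresses \<open>act ?r g0\<close> through G
    alone, and \<open>?r\<close> stays outside P because \<open>c g0\<close> is in P.\<close>
  let ?r = "s - c g0"
  have r: "?r \<notin> P"
  proof
    assume "?r \<in> P"
    then have "?r + c g0 \<in> P" using c(1) by (intro subgroup_add[OF sub]) auto
    then show False using insert.prems(1) by simp
  qed
  have rg0: "act ?r g0 = (\<Sum>h\<in>G. act (c h) h)"
    using c(2) insert.hyps by (simp add: act_diff_left[OF M])
  have "\<exists>d. (\<forall>h. d h \<in> P) \<and> act (?r * s) g = (\<Sum>h\<in>G. act (d h) h)" if g: "g \<in> G" for g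
  proof -
    obtain b where b: "\<forall>h. b h \<in> P" "act s g = (\<Sum>h\<in>insert g0 G. act (b h) h)"
      using insert.prems(2)[of g] g by blast
    have "act (?r * s) g = act ?r (act (b g0) g0 + (\<Sum>h\<in>G. act (b h) h))"
      using b(2) insert.hyps by (simp add: act_mult[OF M])
    also have "\<dots> = act (b g0) (act ?r g0) + (\<Sum>h\<in>G. act (?r * b h) h)"
      by (simp add: act_add[OF M] act_sum[OF M] act_mult[OF M, symmetric] mult.commute)
    also have "\<dots> = (\<Sum>h\<in>G. act (b g0 * c h + ?r * b h) h)"
      by (simp add: rg0 act_sum[OF M] act_mult[OF M, symmetric] act_add_left[OF M] sum.distrib)
    finally have eq: "act (?r * s) g = (\<Sum>h\<in>G. act (b g0 * c h + ?r * b h) h)" .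
    have "b g0 * c h + ?r * b h \<in> P" for h
      using b(1) c(1) mult by (intro subgroup_add[OF sub]) auto
    then show ?thesis using eq by (intro exI[of _ "\<lambda>h. b g0 * c h + ?r * b h"]) simp
  qed
  from insert.IH[OF prime[OF r insert.prems(1)] this] obtain t where t: "t \<notin> P" "\<forall>g\<in>G. act t g = 0" by blast
  have "act (t * ?r) g = 0" if "g \<in> insert g0 G" for g
  proof (cases "g = g0")
    case True
    have "act (t * ?r) g0 = (\<Sum>h\<in>G. act t (act (c h) h))"
      by (simp only: act_mult[OF M] rg0 act_sum[OF M])
    also have "\<dots> = (\<Sum>h\<in>G. act (c h) (act t h))"
      by (simp add: act_mult[OF M, symmetric] mult.commute)
    also have "\<dots> = 0" using t(2) by (simp add: act_0[OF M])
    finally show ?thesis using True by simp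
  next
    case False
    then have "act t g = 0" using that t(2) by blast
    then have "act ?r (act t g) = 0" by (simp add: act_0[OF M])
    then show ?thesis by (simp add: act_mult[OF M, symmetric] mult.commute)
  qed
  then show ?case using prime[OF t(1) r] by blast
qed

context multigraded_module
begin

text \<open>If the quotient vanished at P, then M_P would equal P M_P, and Nakayama's lemma would
  make M_P zero. This turns the defining condition of a mixed multiplicity system into one on the
  support of M itself.\<close>

lemma Supp_quotient:
  assumes P: "P \<in> Supp UNIV {0}" "set xs \<subseteq> P"
  shows "P \<in> Supp UNIV (seq_mult act xs UNIV)"
proof (rule ccontr)
  assume no: "P \<notin> Supp UNIV (seq_mult act xs UNIV)"
  let ?X = "seq_mult act xs UNIV"
  have Proj: "P \<in> Proj Sg" using P(1) unfolding Supp_pp_def by blast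
  then have prime: "prime_ideal P" unfolding Proj_def by blast
  have sub: "add_subgroup P" and mult: "\<And>a x. x \<in> P \<Longrightarrow> a * x \<in> P" using prime unfolding prime_ideal_def by blast+
  obtain u where u: "\<And>s. s \<notin> P \<Longrightarrow> act s u \<noteq> 0" using P(1) unfolding Supp_pp_def by blast
  from fg_mod obtain G where G: "finite G" "\<forall>x. \<exists>c. x = (\<Sum>g\<in>G. act (c g) g)"
    unfolding fg_module_def by (elim exE conjE)
  obtain coef where coef: "\<And>x. x = (\<Sum>g\<in>G. act (coef x g) g)" using G(2) by metis
  have "\<forall>m. \<exists>s. s \<notin> P \<and> act s m \<in> ?X" using no Proj unfolding Supp_pp_def by blast
  then obtain s where s: "\<And>m. s m \<notin> P" "\<And>m. act (s m) m \<in> ?X" by metis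
  \<comment> \<open>One multiplier outside P that sends every generator of M into xM.\<close>
  let ?s = "\<Prod>g\<in>G. s g"
  have sP: "?s \<notin> P" by (rule prime_ideal_prod_notin[OF prime s(1)])
  have closed: "act r x \<in> ?X" if x: "x \<in> ?X" for r x
  proof -
    from x obtain m where "x = (\<Sum>j<length xs. act (xs ! j) (m j))" unfolding seq_mult_def by blast
    then have "act r x = (\<Sum>j<length xs. act (xs ! j) (act r (m j)))"
      by (simp add: act_sum[OF module] act_mult[OF module, symmetric] mult.commute)
    then show ?thesis unfolding seq_mult_def by (intro CollectI exI[of _ "\<lambda>j. act r (m j)"]) simp
  qed
  have "\<exists>c. (\<forall>h. c h \<in> P) \<and> act ?s g = (\<Sum>h\<in>G. act (c h) h)" if g: "g \<in> G" for g
  proof -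
    have "?s = (\<Prod>h\<in>G - {g}. s h) * s g" using prod.remove[OF G(1) g, of s] by (simp add: mult.commute)
    then have "act ?s g = act (\<Prod>h\<in>G - {g}. s h) (act (s g) g)" by (simp add: act_mult[OF module])
    then have "act ?s g \<in> ?X" using closed[OF s(2)] by simp
    then obtain m where m: "act ?s g = (\<Sum>j<length xs. act (xs ! j) (m j))" unfolding seq_mult_def by blast
    let ?c = "\<lambda>h. \<Sum>j<length xs. xs ! j * coef (m j) h"
    have "act ?s g = (\<Sum>j<length xs. \<Sum>h\<in>G. act (xs ! j * coef (m j) h) h)"
      unfolding m
    proof (rule sum.cong[OF refl])
      fix j
      have "act (xs ! j) (m j) = act (xs ! j) (\<Sum>h\<in>G. act (coef (m j) h) h)" using coef[of "m j"] by simp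
      then show "act (xs ! j) (m j) = (\<Sum>h\<in>G. act (xs ! j * coef (m j) h) h)"
        by (simp add: act_sum[OF module] act_mult[OF module])
    qed
    also have "\<dots> = (\<Sum>h\<in>G. act (?c h) h)"
      by (subst sum.swap) (simp add: act_sum_left[OF module])
    finally have eq: "act ?s g = (\<Sum>h\<in>G. act (?c h) h)" .
    have "xs ! j * a \<in> P" if "j < length xs" for j a
      using mult[of "xs ! j" a] P(2) nth_mem[OF that] by (auto simp: mult.commute)
    then have "?c h \<in> P" for h by (intro subgroup_sum[OF sub]) simp
    then show ?thesis using eq by (intro exI[of _ ?c]) simp
  qed
  from prime_nakayama[OF module prime G(1) sP this] obtain t where t: "t \<notin> P" "\<forall>g\<in>G. act t g = 0" by blast
  have "act t u = (\<Sum>g\<in>G. act t (act (coef u g) g))"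
    using arg_cong[OF coef[of u], of "act t"] by (simp add: act_sum[OF module])
  also have "\<dots> = (\<Sum>g\<in>G. act (coef u g) (act t g))"
    by (simp add: act_mult[OF module, symmetric] mult.commute)
  also have "\<dots> = 0" using t(2) by (simp add: act_0[OF module])
  finally show False using u[OF t(1)] by simp
qed

section \<open>Dimension of the support as a bound on chains\<close>

lemma dim_supp_chain:
  assumes "C \<noteq> []" "set C \<subseteq> Supp N L" "sorted_wrt (\<subset>) C"
  shows "ereal (real (length C - 1)) \<le> dim_supp Sg act N L"
proof -
  have "Supp N L \<noteq> {}" using assms(1,2) by (cases C) auto
  then show ?thesis unfolding dim_supp_def using assms by (auto intro!: Sup_upper)
qed

lemma dim_supp_le_imp_chain_le:
  assumes "dim_supp Sg act N L \<le> ereal (real t)" shows "chain_le (Suc t) (Supp N L)"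
  unfolding chain_le_def
proof (intro allI impI)
  fix C assume C: "set C \<subseteq> Supp N L" "sorted_wrt (\<subset>) C"
  show "length C \<le> Suc t"
  proof (cases "C = []")
    case False
    have "ereal (real (length C - 1)) \<le> ereal (real t)"
      using dim_supp_chain[OF False C] assms by (rule order_trans)
    then show ?thesis by simp
  qed simp
qed

text \<open>The strict inequality saves one prime compared with
  \<open>dim_supp_le_imp_chain_le\<close>, and thereby one degree of the Hilbert polynomial.\<close>

lemma dim_supp_less_imp_chain_le:
  assumes "dim_supp Sg act N L < ereal (real t)" shows "chain_le t (Supp N L)"
  unfolding chain_le_def
proof (intro allI impI)
  fix C assume C: "set C \<subseteq> Supp N L" "sorted_wrt (\<subset>) C"
  show "length C \<le> t"
  proof (cases "C = []")
    case False
    have "ereal (real (length C - 1)) < ereal (real t)"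
      using dim_supp_chain[OF False C] assms by (rule le_less_trans)
    then show ?thesis by simp
  qed simp
qed

text \<open>A prime supporting N/(L + xN) or (L : x)/L contains x automatically. So when x leaves
  the list, the primes that contain the shorter list lie among those of the previous stage, and the
  chain bound passes on to both terms of the recursion.\<close>

lemma mm_symbol_eq_fdiffs:
  "list_all2 (\<lambda>x j. x \<in> Sg (unit_vec j)) xs ds \<Longrightarrow> hsub L \<Longrightarrow> hsub N \<Longrightarrow> L \<subseteq> N \<Longrightarrow>
    chain_le 1 {P \<in> Supp N L. set xs \<subseteq> P} \<Longrightarrow>
    \<exists>v. \<forall>n\<ge>v. fdiffs ds (\<lambda>n. int (hl N L n)) n = mm_symbol Sg act Mg xs N L"
proof (induction xs ds arbitrary: N L rule: list_all2_induct)
  case Nil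
  \<comment> \<open>With no elements left, chains consist of at most one prime, so the Hilbert
    polynomial is constant.\<close>
  then have "chain_le 1 (Supp N L)" by simp
  from hilbert_polynomial[OF Nil(1-3) this] obtain p v where
    p: "p \<in> poly_fun 1" "\<forall>n\<ge>v. real (hl N L n) = p n" by blast
  obtain c where c: "p = (\<lambda>n. c)" using p(1) by (rule poly_fun_1)
  let ?c = "hl N L v"
  have const: "\<forall>n\<ge>v. hl N L n = ?c"
  proof (intro allI impI)
    fix n assume "v \<le> n"
    then have "real (hl N L n) = real ?c" using p(2) c by simp
    then show "hl N L n = ?c" by simp
  qed
  have "(THE c. \<exists>v. \<forall>n\<ge>v. hlen Sg act Mg N L n = enat c) = ?c"
  proof (rule the_equality)
    have "\<forall>n\<ge>v. hlen Sg act Mg N L n = enat ?c"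
      using const hlen_eq[OF Nil(1-3)] by metis
    then show "\<exists>w. \<forall>n\<ge>w. hlen Sg act Mg N L n = enat ?c" by (rule exI[of _ v])
    fix c assume "\<exists>w. \<forall>n\<ge>w. hlen Sg act Mg N L n = enat c"
    then obtain w where w: "\<forall>n\<ge>w. hlen Sg act Mg N L n = enat c" ..
    have "enat (hl N L (sup v w)) = enat c" using w hlen_eq[OF Nil(1-3), of "sup v w"] by simp
    moreover have "hl N L (sup v w) = ?c" using const[rule_format, of "sup v w"] by simp
    ultimately show "c = ?c" by simp
  qed
  then have sym: "mm_symbol Sg act Mg [] N L = int ?c" by simp
  show ?case
  proof (intro exI[of _ v] allI impI)
    fix n assume "v \<le> n"
    then have "hl N L n = ?c" using const by blast
    then show "fdiffs [] (\<lambda>n. int (hl N L n)) n = mm_symbol Sg act Mg [] N L"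
      unfolding sym fdiffs.simps by (rule arg_cong)
  qed
next
  case (Cons x xs j ds)
  note x = Cons.hyps(1) and hyp = Cons.prems
  let ?K = "set_add L (act x ` N)" and ?V = "{u \<in> N. act x u \<in> L}"
  note K = hsub_set_add_image[OF x hyp(1-3)]
  have "{P \<in> Supp N ?K. set xs \<subseteq> P} \<subseteq> {P \<in> Supp N L. set (x # xs) \<subseteq> P}"
  proof (rule subsetI, elim CollectE conjE, intro CollectI conjI)
    fix P assume P: "P \<in> Supp N ?K" "set xs \<subseteq> P"
    show "P \<in> Supp N L" using P(1) Supp_mono[OF order_refl K(2), of N] by blast
    obtain u where u: "u \<in> N" "\<And>s. s \<notin> P \<Longrightarrow> act s u \<notin> ?K" using P(1) unfolding Supp_pp_def by blast
    have "act x u \<in> ?K" using set_add_right[OF hsub_0[OF hyp(1)], of "act x ` N"] u(1) by blast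
    then show "set (x # xs) \<subseteq> P" using u(2) P(2) by auto
  qed
  then have 1: "chain_le 1 {P \<in> Supp N ?K. set xs \<subseteq> P}" by (rule chain_le_mono[OF hyp(4)])
  have "{P \<in> Supp ?V L. set xs \<subseteq> P} \<subseteq> {P \<in> Supp N L. set (x # xs) \<subseteq> P}"
  proof (rule subsetI, elim CollectE conjE, intro CollectI conjI)
    fix P assume P: "P \<in> Supp ?V L" "set xs \<subseteq> P"
    show "P \<in> Supp N L" using P(1) Supp_mono[of ?V N L L] by blast
    obtain u where u: "u \<in> ?V" "\<And>s. s \<notin> P \<Longrightarrow> act s u \<notin> L" using P(1) unfolding Supp_pp_def by blast
    then show "set (x # xs) \<subseteq> P" using P(2) by auto
  qed
  then have 2: "chain_le 1 {P \<in> Supp ?V L. set xs \<subseteq> P}" by (rule chain_le_mono[OF hyp(4)])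
  obtain v1 where v1: "\<forall>n\<ge>v1. fdiffs ds (\<lambda>n. int (hl N ?K n)) n = mm_symbol Sg act Mg xs N ?K"
    using Cons.IH[OF K(1) hyp(2) K(3) 1] ..
  obtain v2 where v2: "\<forall>n\<ge>v2. fdiffs ds (\<lambda>n. int (hl ?V L n)) n = mm_symbol Sg act Mg xs ?V L"
    using Cons.IH[OF hyp(1) K(4,5) 2] ..
  have Keq: "{l + act x m | l m. l \<in> L \<and> m \<in> N} = ?K" unfolding set_add_def by auto
  \<comment> \<open>The quotient enters at degree n + e_j and the colon module at degree n. The
    shift is harmless because the remaining differences of the quotient are eventually
    constant.\<close>
  have "fdiff j (\<lambda>n. int (hl N L n)) = (\<lambda>n. int (hl N ?K (n(j := Suc (n j)))) - int (hl ?V L n))"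
  proof
    fix n
    have "hl N L (n(j := Suc (n j))) + hl ?V L n = hl N ?K (n(j := Suc (n j))) + hl N L n"
      using hl_mult[OF x hyp(1-3), of n] unfolding add_deg_unit_vec .
    then show "fdiff j (\<lambda>n. int (hl N L n)) n = int (hl N ?K (n(j := Suc (n j)))) - int (hl ?V L n)"
      unfolding fdiff_def by linarith
  qed
  then have "fdiffs (j # ds) (\<lambda>n. int (hl N L n)) n =
      fdiffs ds (\<lambda>n. int (hl N ?K n)) (n(j := Suc (n j))) - fdiffs ds (\<lambda>n. int (hl ?V L n)) n" for n
    by (simp add: fdiffs_diff fdiffs_shift[of ds "\<lambda>n. int (hl N ?K n)"])
  moreover have "fdiffs ds (\<lambda>n. int (hl N ?K n)) (n(j := Suc (n j))) = mm_symbol Sg act Mg xs N ?K"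
    if "sup v1 v2 \<le> n" for n
    using that by (intro v1[rule_format] le_upd_Suc) simp
  moreover have "fdiffs ds (\<lambda>n. int (hl ?V L n)) n = mm_symbol Sg act Mg xs ?V L" if "sup v1 v2 \<le> n" for n
    using that by (intro v2[rule_format]) simp
  ultimately have "\<forall>n\<ge>sup v1 v2. fdiffs (j # ds) (\<lambda>n. int (hl N L n)) n = mm_symbol Sg act Mg (x # xs) N L"
    by (simp add: Keq)
  then show ?case by (rule exI[of _ "sup v1 v2"])
qed

end

section \<open>The Koszul complex\<close>

text \<open>A direct sum over finite T as functions vanishing off T, the encoding that
  \<open>kos_piece\<close> uses.\<close>

definition prod_family :: "('i \<Rightarrow> 'v::ab_group_add set) \<Rightarrow> 'i set \<Rightarrow> ('i \<Rightarrow> 'v) set" where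
  "prod_family G T = {f. \<forall>I. if I \<in> T then f I \<in> G I else f I = 0}"

lemma module_act_pointwise: "module_act act \<Longrightarrow> module_act (\<lambda>a f I. act a (f I))"
  unfolding module_act_def by (simp add: fun_eq_iff)

lemma A_submodule_prod_family:
  assumes M: "module_act act" and G: "\<And>I. I \<in> T \<Longrightarrow> A_submodule A act (G I)"
  shows "A_submodule A (\<lambda>a f I. act a (f I)) (prod_family G T)"
  unfolding A_submodule_def add_subgroup_def
proof (intro conjI ballI)
  show "0 \<in> prod_family G T"
    using A_submodule_0[OF G] by (simp add: prod_family_def)
  fix f assume f: "f \<in> prod_family G T"
  show "- f \<in> prod_family G T"
    using f subgroup_uminus[OF submodule_subgroup[OF G]] by (simp add: prod_family_def)
  show "(\<lambda>I. act a (f I)) \<in> prod_family G T" if "a \<in> A" for a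
    using f A_submodule_act[OF G that] by (simp add: prod_family_def act_0[OF M])
  fix g assume g: "g \<in> prod_family G T"
  show "f + g \<in> prod_family G T"
    using f g subgroup_add[OF submodule_subgroup[OF G]] by (simp add: prod_family_def)
qed

text \<open>Evaluation at an index J maps onto \<open>G J\<close>, and its kernel is the family over
  the remaining indices.\<close>

lemma length_sq_prod_family:
  assumes M: "module_act act" and "finite T" and G: "\<And>I. I \<in> T \<Longrightarrow> A_submodule A act (G I)"
  shows "length_sq A (\<lambda>a f I. act a (f I)) (prod_family G T) {0} = (\<Sum>I\<in>T. length_sq A act (G I) {0})"
  using assms(2,3)
proof (induction T)
  case empty
  have eq: "prod_family G {} = {0}" by (auto simp: prod_family_def fun_eq_iff)
  have "A_submodule A (\<lambda>a f I. act a (f I)) (prod_family G {})"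
    by (rule A_submodule_prod_family[OF M]) simp
  from length_sq_self[OF this] show ?case unfolding eq sum.empty .
next
  case (insert J T)
  let ?a = "\<lambda>a f I. act a (f I)"
  let ?N = "prod_family G (insert J T)" and ?K = "prod_family G T"
  note Mp = module_act_pointwise[OF M]
  have sN: "A_submodule A ?a ?N" by (rule A_submodule_prod_family[OF M insert.prems])
  have sK: "A_submodule A ?a ?K" by (rule A_submodule_prod_family[OF M]) (use insert.prems in simp)
  have s0: "A_submodule A ?a {0}" "A_submodule A act {0}"
    using M by (simp_all add: A_submodule_def add_subgroup_def act_0 fun_eq_iff)
  have GJ: "A_submodule A act (G J)" using insert.prems by simp
  have lin: "A_linear A ?a act (\<lambda>f. f J)"
    using M Mp by (simp add: A_linear_def)
  have "(\<lambda>f. f J) ` ?N = G J"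
  proof (intro subset_antisym subsetI)
    fix x assume x: "x \<in> G J"
    have "(\<lambda>I. if I = J then x else 0) \<in> ?N"
      using x A_submodule_0[OF insert.prems] by (simp add: prod_family_def)
    then show "x \<in> (\<lambda>f. f J) ` ?N" by (rule rev_image_eqI) simp
  qed (auto simp: prod_family_def)
  then have im: "G J = set_add ((\<lambda>f. f J) ` ?N) {0}"
    by (simp add: set_add_def)
  have ker: "{f \<in> ?N. f J \<in> {0}} = ?K"
  proof (rule subset_antisym; rule subsetI)
    fix f assume f: "f \<in> {f \<in> ?N. f J \<in> {0}}"
    show "f \<in> ?K" unfolding prod_family_def
    proof (rule CollectI, rule allI)
      fix I
      have "if I \<in> insert J T then f I \<in> G I else f I = 0" "f J = 0"
        using f unfolding prod_family_def by blast+
      then show "if I \<in> T then f I \<in> G I else f I = 0" using insert.hyps(2) by (cases "I = J") auto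
    qed
  next
    fix f assume f: "f \<in> ?K"
    have fI: "if I \<in> T then f I \<in> G I else f I = 0" for I
      using f unfolding prod_family_def by blast
    have fJ: "f J = 0" using fI[of J] insert.hyps(2) by simp
    have "if I \<in> insert J T then f I \<in> G I else f I = 0" for I
      using fI[of I] fJ A_submodule_0[OF GJ] by (cases "I = J") auto
    then show "f \<in> {f \<in> ?N. f J \<in> {0}}" using fJ unfolding prod_family_def by blast
  qed
  have "length_sq A ?a ?N ?K = length_sq A act (G J) {0}"
    using A_linear.length_sq_image[OF lin sN s0(2) im] unfolding ker .
  moreover have "length_sq A ?a ?N {0} = length_sq A ?a ?N ?K + length_sq A ?a ?K {0}"
  proof (rule length_sq_add[OF Mp s0(1) sK sN])
    show "{0} \<subseteq> ?K" using A_submodule_0[OF sK] by simp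
    show "?K \<subseteq> ?N" unfolding ker[symmetric] by blast
  qed
  moreover have "length_sq A ?a ?K {0} = (\<Sum>I\<in>T. length_sq A act (G I) {0})"
    by (rule insert.IH) (use insert.prems in simp)
  ultimately show ?case unfolding sum.insert[OF insert.hyps] by (simp only:)
qed

lemma fdiffs_append: "fdiffs (ds @ [j]) h = fdiff j (fdiffs ds h)"
  by (induction ds arbitrary: h) auto

lemma kdeg_append:
  assumes "J \<subseteq> {..<length ds}"
  shows "kdeg (ds @ [j]) J = kdeg ds J"
    "kdeg (ds @ [j]) (insert (length ds) J) = (kdeg ds J)(j := Suc (kdeg ds J j))"
proof -
  have fin: "finite J" using assms finite_subset by blast
  have nth: "(ds @ [j]) ! t = ds ! t" if "t \<in> J" for t
    using that assms by (auto simp: nth_append)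
  show "kdeg (ds @ [j]) J = kdeg ds J"
    unfolding kdeg_def by (intro ext arg_cong[where f = card] Collect_cong) (auto simp: nth)
  have n: "length ds \<notin> J" using assms by auto
  show "kdeg (ds @ [j]) (insert (length ds) J) = (kdeg ds J)(j := Suc (kdeg ds J j))"
  proof
    fix i
    have "{t \<in> insert (length ds) J. (ds @ [j]) ! t = i}
        = (if i = j then insert (length ds) {t \<in> J. ds ! t = i} else {t \<in> J. ds ! t = i})"
      using nth by auto
    then show "kdeg (ds @ [j]) (insert (length ds) J) i = ((kdeg ds J)(j := Suc (kdeg ds J j))) i"
      unfolding kdeg_def using fin n by simp
  qed
qed

text \<open>Expansion of a product of operators E_j - 1, with E_j the shift: I collects the factors
  that contribute -1, its complement the shifts. The complement measures the degree of e_I from the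
  top of the Koszul complex.\<close>

lemma fdiffs_eq_sum:
  "fdiffs ds h w = (\<Sum>I\<in>Pow {..<length ds}. (- 1) ^ card I * (h (add_deg (kdeg ds ({..<length ds} - I)) w) :: int))"
proof (induction ds arbitrary: w rule: rev_induct)
  case Nil
  then show ?case by (simp add: add_deg_def kdeg_def)
next
  case (snoc j ds)
  let ?n = "length ds"
  let ?w = "w(j := Suc (w j))"
  let ?t = "\<lambda>I. (- 1) ^ card I * h (add_deg (kdeg (ds @ [j]) ({..<Suc ?n} - I)) w)"
  have Pow: "Pow {..<Suc ?n} = Pow {..<?n} \<union> insert ?n ` Pow {..<?n}"
    by (simp add: lessThan_Suc Pow_insert)
  have "sum ?t (Pow {..<Suc ?n}) = sum ?t (Pow {..<?n}) + sum ?t (insert ?n ` Pow {..<?n})"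
    unfolding Pow by (rule sum.union_disjoint) auto
  also have "sum ?t (insert ?n ` Pow {..<?n}) = (\<Sum>I\<in>Pow {..<?n}. ?t (insert ?n I))"
  proof (rule sum.reindex_cong[OF _ refl refl])
    show "inj_on (insert ?n) (Pow {..<?n})"
    proof (rule inj_onI)
      fix x y assume "x \<in> Pow {..<?n}" "y \<in> Pow {..<?n}" and eq: "insert ?n x = insert ?n y"
      then have "?n \<notin> x" "?n \<notin> y" by auto
      then show "x = y" using eq insert_ident[of ?n x y] by blast
    qed
  qed
  also have "\<dots> = - (\<Sum>I\<in>Pow {..<?n}. (- 1) ^ card I * h (add_deg (kdeg ds ({..<?n} - I)) w))"
    unfolding sum_negf[symmetric]
  proof (rule sum.cong[OF refl])
    fix I assume "I \<in> Pow {..<?n}"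
    then have I: "I \<subseteq> {..<?n}" "finite I" "?n \<notin> I" using finite_subset by auto
    have "{..<Suc ?n} - insert ?n I = {..<?n} - I" by auto
    then show "?t (insert ?n I) = - ((- 1) ^ card I * h (add_deg (kdeg ds ({..<?n} - I)) w))"
      using I(2,3) kdeg_append(1)[of "{..<?n} - I" ds j] by simp
  qed
  also have "sum ?t (Pow {..<?n}) = (\<Sum>I\<in>Pow {..<?n}. (- 1) ^ card I * h (add_deg (kdeg ds ({..<?n} - I)) ?w))"
  proof (rule sum.cong[OF refl])
    fix I assume "I \<in> Pow {..<?n}"
    then have "{..<Suc ?n} - I = insert ?n ({..<?n} - I)" by auto
    then have k: "kdeg (ds @ [j]) ({..<Suc ?n} - I) = (kdeg ds ({..<?n} - I))(j := Suc (kdeg ds ({..<?n} - I) j))"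
      using kdeg_append(2)[of "{..<?n} - I" ds j] by simp
    show "?t I = (- 1) ^ card I * h (add_deg (kdeg ds ({..<?n} - I)) ?w)"
      unfolding k by (intro arg_cong2[where f = "(*)"] arg_cong[where f = h] refl) (auto simp: add_deg_def)
  qed
  also have "(\<Sum>I\<in>Pow {..<?n}. (- 1) ^ card I * h (add_deg (kdeg ds ({..<?n} - I)) ?w))
      + - (\<Sum>I\<in>Pow {..<?n}. (- 1) ^ card I * h (add_deg (kdeg ds ({..<?n} - I)) w))
      = fdiffs (ds @ [j]) h w"
    unfolding fdiffs_append fdiff_def snoc.IH by simp
  finally show ?case by simp
qed

text \<open>With the sign moved into the scalar, linearity and the vanishing of the square become
  computations in the ring.\<close>

lemma kos_d_altdef:
  assumes "module_act act"
  shows "kos_d act xs f J = (\<Sum>j\<in>{..<length xs} - J. act ((- 1) ^ card {t \<in> J. t < j} * xs ! j) (f (insert j J)))"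
  unfolding kos_d_def
  by (intro sum.cong refl) (simp add: act_minus_left[OF assms] uminus_power_if)

text \<open>The double sum runs over ordered pairs of distinct indices outside J, and the terms for
  (j, l) and (l, j) cancel. If J has elements out of range, f is zero on every larger set.\<close>

lemma kos_d_kos_d:
  assumes M: "module_act act" and f: "\<And>I. \<not> I \<subseteq> {..<length xs} \<Longrightarrow> f I = 0"
  shows "kos_d act xs (kos_d act xs f) J = 0"
proof (cases "J \<subseteq> {..<length xs}")
  case False
  have "f (insert l (insert j J)) = 0" for l j using False by (intro f) auto
  then show ?thesis by (simp add: kos_d_altdef[OF M] act_0[OF M])
next
  case True
  then have fin: "finite J" using finite_subset by blast
  let ?D = "{..<length xs} - J"
  let ?e = "\<lambda>J j. (- 1) ^ card {t \<in> J. t < j} :: 'a"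
  let ?T = "\<lambda>j l. act (?e J j * xs ! j * (?e (insert j J) l * xs ! l)) (f (insert l (insert j J)))"
  let ?P = "\<lambda>R. {p \<in> ?D \<times> ?D. R (fst p) (snd p)}"
  have "kos_d act xs (kos_d act xs f) J = (\<Sum>j\<in>?D. \<Sum>l\<in>{..<length xs} - insert j J. ?T j l)"
    by (simp add: kos_d_altdef[OF M] act_sum[OF M] act_mult[OF M])
  also have "\<dots> = (\<Sum>(j, l)\<in>Sigma ?D (\<lambda>j. {..<length xs} - insert j J). ?T j l)"
    by (rule sum.Sigma) auto
  also have "Sigma ?D (\<lambda>j. {..<length xs} - insert j J) = ?P (<) \<union> ?P (>)"
    by auto
  also have "(\<Sum>(j, l)\<in>?P (<) \<union> ?P (>). ?T j l) = (\<Sum>(j, l)\<in>?P (<). ?T j l) + (\<Sum>(j, l)\<in>?P (>). ?T j l)"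
    by (rule sum.union_disjoint) auto
  also have "(\<Sum>(j, l)\<in>?P (>). ?T j l) = (\<Sum>(j, l)\<in>?P (<). ?T l j)"
    by (rule sum.reindex_bij_witness[where i = prod.swap and j = prod.swap]) auto
  also have "(\<Sum>(j, l)\<in>?P (<). ?T j l) + (\<Sum>(j, l)\<in>?P (<). ?T l j) = (\<Sum>p\<in>?P (<). 0)"
    unfolding sum.distrib[symmetric]
  proof (rule sum.cong[OF refl])
    fix p assume p: "p \<in> ?P (<)"
    obtain j l where jl: "p = (j, l)" by (cases p)
    have "j < l" "j \<notin> J" "l \<notin> J" using p jl by auto
    have "{t \<in> insert j J. t < l} = insert j {t \<in> J. t < l}" "{t \<in> insert l J. t < j} = {t \<in> J. t < j}"
      using \<open>j < l\<close> by auto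
    \<comment> \<open>Inserting the smaller index flips the sign attached to the larger one, but not
      conversely.\<close>
    then have e: "?e (insert j J) l = - ?e J l" "?e (insert l J) j = ?e J j"
      using fin \<open>j \<notin> J\<close> by simp_all
    have ins: "insert j (insert l J) = insert l (insert j J)" by auto
    have "?T j l + ?T l j = act (?e J j * xs ! j * (- ?e J l * xs ! l) + ?e J l * xs ! l * (?e J j * xs ! j)) (f (insert l (insert j J)))"
      unfolding e ins by (simp only: act_add_left[OF M])
    also have "?e J j * xs ! j * (- ?e J l * xs ! l) + ?e J l * xs ! l * (?e J j * xs ! j) = 0"
      by (simp add: algebra_simps)
    finally show "(case p of (j, l) \<Rightarrow> ?T j l) + (case p of (j, l) \<Rightarrow> ?T l j) = 0"
      using jl by (simp add: act_0_left[OF M])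
  qed
  finally show ?thesis by simp
qed

lemma kdeg_mono: "finite J \<Longrightarrow> I \<subseteq> J \<Longrightarrow> kdeg ds I \<le> kdeg ds J"
  unfolding kdeg_def le_fun_def by (auto intro!: card_mono)

lemma kdeg_insert:
  assumes "finite J" "j \<notin> J" shows "kdeg ds (insert j J) = add_deg (unit_vec (ds ! j)) (kdeg ds J)"
proof
  fix i
  have "{t \<in> insert j J. ds ! t = i} = (if ds ! j = i then insert j {t \<in> J. ds ! t = i} else {t \<in> J. ds ! t = i})"
    by auto
  then show "kdeg ds (insert j J) i = add_deg (unit_vec (ds ! j)) (kdeg ds J) i"
    unfolding kdeg_def add_deg_def unit_vec_def using assms by auto
qed

lemma kdeg_full: "kdeg ds {..<length ds} = mcount ds"
  unfolding kdeg_def mcount_def by (rule ext) (simp add: length_filter_conv_card)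

lemma kdeg_complement:
  assumes "I \<subseteq> {..<length ds}"
  shows "add_deg (kdeg ds I) (kdeg ds ({..<length ds} - I)) = mcount ds"
proof
  fix i
  let ?n = "{..<length ds}"
  have "{t \<in> ?n. ds ! t = i} = {t \<in> I. ds ! t = i} \<union> {t \<in> ?n - I. ds ! t = i}" using assms by auto
  moreover have "finite I" using assms finite_subset by blast
  ultimately have "kdeg ds ?n i = kdeg ds I i + kdeg ds (?n - I) i"
    unfolding kdeg_def by (simp add: card_Un_disjoint[symmetric] disjoint_iff)
  then show "add_deg (kdeg ds I) (kdeg ds (?n - I)) i = mcount ds i"
    by (simp add: add_deg_def kdeg_full)
qed

text \<open>The letters k, z, b, h stand for the lengths of terms, cycles, boundaries and homology.
  Boundary lengths cancel in consecutive degrees, and only the last one remains.\<close>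

lemma alternating_sum:
  fixes k z b h :: "nat \<Rightarrow> int"
  assumes "\<And>i. h i = z i - b i" "\<And>i. k (Suc i) = z (Suc i) + b i" "k 0 = z 0"
  shows "(\<Sum>i\<le>n. (- 1) ^ i * h i) = (\<Sum>i\<le>n. (- 1) ^ i * k i) - (- 1) ^ n * b n"
  by (induction n) (simp_all add: assms algebra_simps)

context multigraded_module
begin

text \<open>Once v is at least the degree of the top basis element, the side condition
  \<open>kdeg ds I <= v\<close> always holds and the subtraction of degrees does not
  truncate.\<close>

lemma kos_piece_family:
  assumes "length ds = length xs" "mcount ds \<le> v"
  shows "kos_piece Mg xs ds UNIV i v
    = prod_family (\<lambda>I. Mg (\<lambda>t. v t - kdeg ds I t)) {I. I \<subseteq> {..<length xs} \<and> card I = i}"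
proof -
  have "kdeg ds I \<le> v" if "I \<subseteq> {..<length xs}" for I
    using kdeg_mono[OF finite_lessThan that, of ds] assms kdeg_full[of ds] by simp
  then show ?thesis unfolding kos_piece_def prod_family_def by (intro Collect_cong) auto
qed

text \<open>The basis element of \<open>insert j J\<close> exceeds that of J by the degree of
  \<open>xs ! j\<close>, which multiplication by \<open>xs ! j\<close> gives back.\<close>

lemma kos_d_piece:
  assumes x: "list_all2 (\<lambda>x j. x \<in> Sg (unit_vec j)) xs ds" and v: "mcount ds \<le> v"
    and f: "f \<in> kos_piece Mg xs ds UNIV (Suc i) v"
  shows "kos_d act xs f \<in> kos_piece Mg xs ds UNIV i v"
proof -
  have len: "length ds = length xs" using list_all2_lengthD[OF x] by simp
  let ?n = "{..<length xs}"
  have f': "if I \<subseteq> ?n \<and> card I = Suc i then f I \<in> Mg (\<lambda>t. v t - kdeg ds I t) else f I = 0" for I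
    using f unfolding kos_piece_family[OF len v] prod_family_def by simp
  have dJ: "if J \<subseteq> ?n \<and> card J = i then kos_d act xs f J \<in> Mg (\<lambda>t. v t - kdeg ds J t) else kos_d act xs f J = 0" for J
  proof (cases "J \<subseteq> ?n \<and> card J = i")
    case True
    then have fin: "finite J" using finite_subset by blast
    have "act ((- 1) ^ card {t \<in> J. t < j} * xs ! j) (f (insert j J)) \<in> Mg (\<lambda>t. v t - kdeg ds J t)"
      if j: "j \<in> ?n - J" for j
    proof -
      have "insert j J \<subseteq> ?n \<and> card (insert j J) = Suc i" using True j fin by auto
      then have fj: "f (insert j J) \<in> Mg (\<lambda>t. v t - kdeg ds (insert j J) t)" and
        ins: "insert j J \<subseteq> ?n" using f'[of "insert j J"] by simp_all
      have "xs ! j \<in> Sg (unit_vec (ds ! j))" using list_all2_nthD[OF x, of j] j by simp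
      from act_degree[OF this fj]
      have 1: "act (xs ! j) (f (insert j J)) \<in> Mg (add_deg (unit_vec (ds ! j)) (\<lambda>t. v t - kdeg ds (insert j J) t))" .
      have kj: "kdeg ds (insert j J) = add_deg (unit_vec (ds ! j)) (kdeg ds J)" using kdeg_insert[OF fin] j by blast
      have "kdeg ds (insert j J) \<le> v"
        using kdeg_mono[OF finite_lessThan ins, of ds] v kdeg_full[of ds] len by simp
      then have le: "unit_vec (ds ! j) t + kdeg ds J t \<le> v t" for t
        unfolding kj by (simp add: add_deg_def le_fun_def)
      have "unit_vec (ds ! j) t + (v t - (unit_vec (ds ! j) t + kdeg ds J t)) = v t - kdeg ds J t" for t
        using le[of t] by linarith
      then have 2: "add_deg (unit_vec (ds ! j)) (\<lambda>t. v t - kdeg ds (insert j J) t) = (\<lambda>t. v t - kdeg ds J t)"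
        unfolding kj by (simp add: add_deg_def)
      have 3: "act (xs ! j) (f (insert j J)) \<in> Mg (\<lambda>t. v t - kdeg ds J t)" using 1 unfolding 2 .
      have "(- 1 :: 'a) ^ card {t \<in> J. t < j} = 1 \<or> (- 1 :: 'a) ^ card {t \<in> J. t < j} = - 1"
        by (cases "even (card {t \<in> J. t < j})") auto
      then show ?thesis
        using 3 subgroup_uminus[OF M.subgroup 3] by (auto simp: act_minus_left[OF module])
    qed
    then have "kos_d act xs f J \<in> Mg (\<lambda>t. v t - kdeg ds J t)"
      unfolding kos_d_altdef[OF module] by (rule subgroup_sum[OF M.subgroup])
    then show ?thesis using True by simp
  next
    case False
    have "f (insert j J) = 0" if j: "j \<in> ?n - J" for j
    proof (cases "J \<subseteq> ?n")
      case True
      then have "card (insert j J) \<noteq> Suc i" using False j finite_subset[OF True] by auto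
      then show ?thesis using f'[of "insert j J"] by auto
    next
      case False
      then show ?thesis using f'[of "insert j J"] by auto
    qed
    then show ?thesis unfolding kos_d_altdef[OF module] if_not_P[OF False] by (simp add: act_0[OF module])
  qed
  show ?thesis unfolding kos_piece_family[OF len v] prod_family_def
    by (rule CollectI, rule allI, unfold mem_Collect_eq, rule dJ)
qed

lemma kos_d_linear: "A_linear (Sg zero_deg) (\<lambda>a f I. act a (f I)) (\<lambda>a f I. act a (f I)) (kos_d act xs)"
  unfolding A_linear_def
proof (intro conjI allI impI)
  show "module_act (\<lambda>a f I. act a (f I))" "module_act (\<lambda>a f I. act a (f I))"
    by (rule module_act_pointwise[OF module])+
  show "kos_d act xs (f + g) = kos_d act xs f + kos_d act xs g" for f g
    by (rule ext) (simp add: kos_d_altdef[OF module] act_add[OF module] sum.distrib)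
  show "kos_d act xs (\<lambda>I. act a (f I)) = (\<lambda>I. act a (kos_d act xs f I))" for a f
    by (rule ext) (simp add: kos_d_altdef[OF module] act_sum[OF module] act_mult[OF module, symmetric] mult.commute)
qed

lemma length_sq_kos_piece:
  assumes "length ds = length xs" "mcount ds \<le> v"
  shows "length_sq (Sg zero_deg) (\<lambda>a f I. act a (f I)) (kos_piece Mg xs ds UNIV i v) {0}
    = enat (\<Sum>I | I \<subseteq> {..<length xs} \<and> card I = i. hl UNIV {0} (\<lambda>t. v t - kdeg ds I t))"
proof -
  have fin: "finite {I. I \<subseteq> {..<length xs} \<and> card I = i}"
    by (rule finite_subset[of _ "Pow {..<length xs}"]) auto
  have Mn: "A_submodule (Sg zero_deg) act (Mg w)" for w using hsub_degree[OF hsub_UNIV, of w] by simp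
  have "length_sq (Sg zero_deg) act (Mg w) {0} = enat (hl UNIV {0} w)" for w
  proof -
    have "{0} \<inter> Mg w = {0}" using M.zero_mem by auto
    then show ?thesis using hlen_eq[OF hsub_singleton_0 hsub_UNIV, of w] unfolding hlen_def by simp
  qed
  moreover have "(\<Sum>I\<in>T. enat (g I)) = enat (sum g T)" for g :: "nat set \<Rightarrow> nat" and T
    by (induction T rule: infinite_finite_induct) (auto simp: zero_enat_def)
  ultimately show ?thesis
    unfolding kos_piece_family[OF assms] length_sq_prod_family[OF module fin Mn] by simp
qed

text \<open>Over all subsets I, the signed lengths of the terms form the expansion in
  \<open>fdiffs_eq_sum\<close>. Its base point is v minus the type of the sequence, the degree of
  the top basis element.\<close>

lemma koszul_euler_characteristic:
  assumes x: "list_all2 (\<lambda>x j. x \<in> Sg (unit_vec j)) xs ds" and v: "mcount ds \<le> v"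
  shows "kos_hlen Sg act Mg xs ds UNIV {0} i v \<noteq> \<infinity>"
    and "(\<Sum>i\<le>length xs. (- 1) ^ i * int (the_enat (kos_hlen Sg act Mg xs ds UNIV {0} i v)))
      = fdiffs ds (\<lambda>n. int (hl UNIV {0} n)) (\<lambda>t. v t - mcount ds t)"
proof -
  have len: "length ds = length xs" using list_all2_lengthD[OF x] by simp
  let ?A = "Sg zero_deg" and ?a = "\<lambda>a (f :: nat set \<Rightarrow> 'm) I. act a (f I)" and ?D = "kos_d act xs"
  let ?n = "{..<length xs}"
  let ?l = "length_sq ?A ?a"
  define K where "K i = kos_piece Mg xs ds UNIV i v" for i
  define Z where "Z i = {f \<in> K i. ?D f \<in> {0}}" for i
  define B where "B i = ?D ` K (Suc i)" for i
  note Mp = module_act_pointwise[OF module]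
  have s0: "A_submodule ?A ?a {0}"
    using module by (simp add: A_submodule_def add_subgroup_def act_0 fun_eq_iff)
  have Mn: "A_submodule ?A act (Mg w)" for w using hsub_degree[OF hsub_UNIV, of w] by simp
  have sK: "A_submodule ?A ?a (K i)" for i
    unfolding K_def kos_piece_family[OF len v] by (rule A_submodule_prod_family[OF module Mn])
  have sZ: "A_submodule ?A ?a (Z i)" for i
    unfolding Z_def by (rule A_linear.A_submodule_vimage[OF kos_d_linear sK s0])
  have sB: "A_submodule ?A ?a (B i)" for i
    unfolding B_def by (rule A_linear.A_submodule_image[OF kos_d_linear sK])
  have K0: "f I = 0" if "f \<in> K i" "\<not> (I \<subseteq> ?n \<and> card I = i)" for f I i
    using that unfolding K_def kos_piece_family[OF len v] prod_family_def by (auto dest: spec[of _ I])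
  have DD: "?D (?D f) = 0" if "f \<in> K i" for f i
    by (rule ext) (use kos_d_kos_d[OF module, of xs f] K0[OF that] in simp)
  have BZ: "B i \<subseteq> Z i" for i
    unfolding B_def Z_def using kos_d_piece[OF x v] DD unfolding K_def by auto
  have ZK: "Z i \<subseteq> K i" for i unfolding Z_def by blast
  have zero: "{0} \<subseteq> Z i" "{0} \<subseteq> B i" "{0} \<subseteq> K i" for i
    using A_submodule_0[OF sZ] A_submodule_0[OF sB] A_submodule_0[OF sK] by auto
  have kos: "kos_hlen Sg act Mg xs ds UNIV {0} i v = ?l (Z i) (B i)" for i
  proof -
    have 1: "{f \<in> kos_piece Mg xs ds UNIV i v. \<forall>J. ?D f J \<in> {0}} = Z i"
      unfolding Z_def K_def by (auto simp: fun_eq_iff)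
    have "kos_piece Mg xs ds {0} i v = {0}"
      unfolding kos_piece_def using M.zero_mem by (auto simp: fun_eq_iff split: if_splits)
    then have 2: "{(\<lambda>J. ?D g J + h J) | g h. g \<in> kos_piece Mg xs ds UNIV (Suc i) v \<and> h \<in> kos_piece Mg xs ds {0} i v} = B i"
      unfolding B_def K_def by (auto simp: image_def)
    show ?thesis unfolding kos_hlen_def 1 2 ..
  qed
  have B_len: "?l (K (Suc i)) (Z (Suc i)) = ?l (B i) {0}" for i
  proof -
    have "B i = set_add (?D ` K (Suc i)) {0}" unfolding B_def by (simp add: set_add_def)
    from A_linear.length_sq_image[OF kos_d_linear sK s0 this] show ?thesis unfolding Z_def .
  qed
  define k where "k i = (\<Sum>I | I \<subseteq> ?n \<and> card I = i. hl UNIV {0} (\<lambda>t. v t - kdeg ds I t))" for i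
  have k: "?l (K i) {0} = enat (k i)" for i
    unfolding K_def k_def by (rule length_sq_kos_piece[OF len v])
  have KZ: "?l (K i) {0} = ?l (K i) (Z i) + ?l (Z i) {0}" for i
    by (rule length_sq_add[OF Mp s0 sZ sK zero(1) ZK])
  have ZB: "?l (Z i) {0} = ?l (Z i) (B i) + ?l (B i) {0}" for i
    by (rule length_sq_add[OF Mp s0 sB sZ zero(2) BZ])
  have fin: "?l (Z i) {0} \<noteq> \<infinity>" "?l (Z i) (B i) \<noteq> \<infinity>" "?l (B i) {0} \<noteq> \<infinity>" for i
  proof -
    show Zfin: "?l (Z i) {0} \<noteq> \<infinity>" using KZ[of i] k[of i] by (metis enat.distinct(2) plus_eq_infty_iff_enat)
    show "?l (Z i) (B i) \<noteq> \<infinity>" "?l (B i) {0} \<noteq> \<infinity>"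
      using ZB[of i] Zfin by (metis plus_eq_infty_iff_enat)+
  qed
  show "kos_hlen Sg act Mg xs ds UNIV {0} i v \<noteq> \<infinity>" unfolding kos by (rule fin(2))
  define z b h where "z i = the_enat (?l (Z i) {0})" and "b i = the_enat (?l (B i) {0})"
    and "h i = the_enat (?l (Z i) (B i))" for i
  have the: "n = enat (the_enat n)" if "n \<noteq> \<infinity>" for n using that by (cases n) auto
  have z: "?l (Z i) {0} = enat (z i)" for i unfolding z_def by (rule the[OF fin(1)])
  have b: "?l (B i) {0} = enat (b i)" for i unfolding b_def by (rule the[OF fin(3)])
  have h: "?l (Z i) (B i) = enat (h i)" for i unfolding h_def by (rule the[OF fin(2)])
  have e1: "int (h i) = int (z i) - int (b i)" for i using ZB[of i] z b h by simp
  have e2: "int (k (Suc i)) = int (z (Suc i)) + int (b i)" for i using KZ[of "Suc i"] k z b B_len[of i] by simp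
  \<comment> \<open>A 0-chain is zero on nonempty index sets, so each one is a cycle.\<close>
  have "K 0 = Z 0"
  proof (rule subset_antisym[OF _ ZK], rule subsetI)
    fix f assume f: "f \<in> K 0"
    have "f (insert j J) = 0" for j J
    proof (cases "insert j J \<subseteq> ?n")
      case True
      then have "finite (insert j J)" by (rule finite_subset[OF _ finite_lessThan])
      then have "card (insert j J) \<noteq> 0" by (simp only: card_0_eq insert_not_empty not_False_eq_True)
      then show ?thesis using K0[OF f, of "insert j J"] by simp
    next
      case False
      show ?thesis by (rule K0[OF f]) (use False in blast)
    qed
    then have "?D f = 0" by (intro ext) (simp add: kos_d_altdef[OF module] act_0[OF module])
    then show "f \<in> Z 0" unfolding Z_def using f by simp
  qed
  then have e3: "int (k 0) = int (z 0)" using k[of 0] z[of 0] by simp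
  \<comment> \<open>No set of n indices has a subset of size n + 1, so the top degree has no
    boundaries and the leftover term of \<open>alternating_sum\<close> is zero.\<close>
  have "B (length xs) \<subseteq> {0}"
  proof
    fix g assume "g \<in> B (length xs)"
    then obtain f where f: "g = ?D f" "f \<in> K (Suc (length xs))" unfolding B_def by blast
    have "\<not> (I \<subseteq> ?n \<and> card I = Suc (length xs))" for I
      using card_mono[of ?n I] by auto
    then have "f I = 0" for I by (rule K0[OF f(2)])
    then have "g = 0" unfolding f(1) by (intro ext) (simp add: kos_d_altdef[OF module] act_0[OF module])
    then show "g \<in> {0}" by simp
  qed
  then have B0: "B (length xs) = {0}" using zero(2) by blast
  have "?l (B (length xs)) {0} = 0" unfolding B0 by (rule length_sq_self[OF s0])
  then have e4: "b (length xs) = 0" using b[of "length xs"] by (simp add: zero_enat_def)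
  have "(\<Sum>i\<le>length xs. (- 1) ^ i * int (the_enat (kos_hlen Sg act Mg xs ds UNIV {0} i v)))
    = (\<Sum>i\<le>length xs. (- 1) ^ i * int (h i))" unfolding kos h by simp
  also have "\<dots> = (\<Sum>i\<le>length xs. (- 1) ^ i * int (k i))"
    using alternating_sum[of "\<lambda>i. int (h i)" "\<lambda>i. int (z i)" "\<lambda>i. int (b i)" "\<lambda>i. int (k i)" "length xs", OF e1 e2 e3]
    by (simp add: e4)
  also have "\<dots> = (\<Sum>i\<le>length xs. \<Sum>I | I \<in> Pow ?n \<and> card I = i. (- 1) ^ card I * int (hl UNIV {0} (\<lambda>t. v t - kdeg ds I t)))"
    unfolding k_def of_nat_sum sum_distrib_left by (intro sum.cong) auto
  also have "\<dots> = (\<Sum>I\<in>Pow ?n. (- 1) ^ card I * int (hl UNIV {0} (\<lambda>t. v t - kdeg ds I t)))"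
  proof (rule sum.group)
    show "card ` Pow ?n \<subseteq> {..length xs}" using card_mono[of ?n] by auto
  qed auto
  also have "\<dots> = fdiffs ds (\<lambda>n. int (hl UNIV {0} n)) (\<lambda>t. v t - mcount ds t)"
    unfolding fdiffs_eq_sum len
  proof (rule sum.cong[OF refl])
    fix I assume I: "I \<in> Pow ?n"
    \<comment> \<open>The degrees of I and of its complement add up to the type of the sequence, so
      lowering v by the one is raising the base point by the other.\<close>
    have "(\<lambda>t. v t - kdeg ds I t) = add_deg (kdeg ds (?n - I)) (\<lambda>t. v t - mcount ds t)"
    proof
      fix t
      have "kdeg ds I t + kdeg ds (?n - I) t = mcount ds t"
        using fun_cong[OF kdeg_complement[of I ds], of t] I len by (simp add: add_deg_def)
      moreover have "mcount ds t \<le> v t" using v by (simp add: le_fun_def)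
      ultimately show "v t - kdeg ds I t = add_deg (kdeg ds (?n - I)) (\<lambda>t. v t - mcount ds t) t"
        unfolding add_deg_def by linarith
    qed
    then show "(- 1) ^ card I * int (hl UNIV {0} (\<lambda>t. v t - kdeg ds I t))
      = (- 1) ^ card I * int (hl UNIV {0} (add_deg (kdeg ds (?n - I)) (\<lambda>t. v t - mcount ds t)))" by simp
  qed
  finally show "(\<Sum>i\<le>length xs. (- 1) ^ i * int (the_enat (kos_hlen Sg act Mg xs ds UNIV {0} i v)))
      = fdiffs ds (\<lambda>n. int (hl UNIV {0} n)) (\<lambda>t. v t - mcount ds t)" .
qed

lemma chi_eq:
  assumes x: "list_all2 (\<lambda>x j. x \<in> Sg (unit_vec j)) xs ds"
    and c: "\<forall>n\<ge>v. fdiffs ds (\<lambda>n. int (hl UNIV {0} n)) n = c"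
  shows "chi Sg act Mg xs ds UNIV {0} = c"
proof -
  let ?P = "\<lambda>c n. (\<forall>i\<le>length xs. kos_hlen Sg act Mg xs ds UNIV {0} i n \<noteq> \<infinity>) \<and>
     (\<Sum>i\<le>length xs. (-1) ^ i * int (the_enat (kos_hlen Sg act Mg xs ds UNIV {0} i n))) = c"
  \<comment> \<open>The Euler characteristic at n is the iterated difference at n minus the type, so
    the threshold is raised by the type.\<close>
  let ?w = "add_deg v (mcount ds)"
  have P: "?P c n" if n: "?w \<le> n" for n
  proof -
    have vn: "v t + mcount ds t \<le> n t" for t using n by (simp add: add_deg_def le_fun_def)
    have m: "mcount ds \<le> n" unfolding le_fun_def using vn add_leD2 by blast
    have "v \<le> (\<lambda>t. n t - mcount ds t)" unfolding le_fun_def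
    proof
      fix t show "v t \<le> n t - mcount ds t" using vn[of t] by linarith
    qed
    then show ?thesis using koszul_euler_characteristic[OF x m] c by simp
  qed
  show ?thesis unfolding chi_def
  proof (rule the_equality)
    show "\<exists>v. \<forall>n. v \<le> n \<longrightarrow> ?P c n" by (rule exI[of _ ?w]) (intro allI impI P)
    fix c' assume "\<exists>v. \<forall>n. v \<le> n \<longrightarrow> ?P c' n"
    then obtain u where u: "\<forall>n. u \<le> n \<longrightarrow> ?P c' n" ..
    have "?P c (sup u ?w)" by (rule P) simp
    moreover have "?P c' (sup u ?w)" using u by simp
    ultimately show "c' = c" by linarith
  qed
qed

end

section \<open>Mixed multiplicities\<close>

lemma fdiffs_of_int: "fdiffs ds (\<lambda>n. real_of_int (h n)) n = real_of_int (fdiffs ds h n)"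
proof (induction ds arbitrary: h)
  case (Cons j ds)
  have "fdiff j (\<lambda>n. real_of_int (h n)) = (\<lambda>n. real_of_int (fdiff j h n))"
    by (rule ext) (simp add: fdiff_def)
  then show ?case using Cons[of "fdiff j h"] by simp
qed simp

text \<open>The definite description in \<open>hilb_coeff\<close> is resolved by
  \<open>poly_coeffs_unique\<close>: two candidates agree beyond both of their thresholds.\<close>

lemma (in multigraded_module) hilb_coeff_eq:
  assumes fin: "finite {k. c k \<noteq> 0}"
    and hl: "\<And>n. v \<le> n \<Longrightarrow> real (hl UNIV {0} n) = (\<Sum>k | c k \<noteq> 0. c k * monom_fun k n)"
  shows "hilb_coeff Sg act Mg = c"
  unfolding hilb_coeff_def
proof (rule the_equality)
  have hlen: "hlen Sg act Mg UNIV {0} n = enat (hl UNIV {0} n)" for n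
    using hlen_eq[OF hsub_singleton_0 hsub_UNIV] by simp
  let ?Q = "\<lambda>c n. \<exists>m. hlen Sg act Mg UNIV {0} n = enat m \<and>
      real m = (\<Sum>k | c k \<noteq> 0. c k * (\<Prod>i\<in>UNIV. real (n i) ^ k i))"
  have "?Q c n" if "v \<le> n" for n
    using hlen[of n] hl[OF that] unfolding monom_fun_def by blast
  then show "finite {k. c k \<noteq> 0} \<and> (\<exists>v. \<forall>n. v \<le> n \<longrightarrow> ?Q c n)"
    using fin by (intro conjI exI[of _ v]) simp_all
  fix c' assume c': "finite {k. c' k \<noteq> 0} \<and> (\<exists>v. \<forall>n. v \<le> n \<longrightarrow> ?Q c' n)"
  then obtain w where w: "\<forall>n. w \<le> n \<longrightarrow> ?Q c' n" by (elim conjE exE)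
  have "(\<Sum>k | c' k \<noteq> 0. c' k * monom_fun k n) = (\<Sum>k | c k \<noteq> 0. c k * monom_fun k n)" if n: "sup v w \<le> n" for n
  proof -
    have "w \<le> n" "v \<le> n" using n by simp_all
    have "?Q c' n" by (rule w[rule_format]) fact
    then obtain m where m: "hlen Sg act Mg UNIV {0} n = enat m" "real m = (\<Sum>k | c' k \<noteq> 0. c' k * monom_fun k n)"
      unfolding monom_fun_def by (elim exE conjE)
    have "m = hl UNIV {0} n" using m(1) hlen[of n] by simp
    then show ?thesis unfolding m(2)[symmetric] hl[OF \<open>v \<le> n\<close>, symmetric] by simp
  qed
  then show "c' = c" by (rule poly_coeffs_unique[OF conjunct1[OF c'] fin])
qed

theorem theorem3p12:
  fixes Sg :: "('d::finite \<Rightarrow> nat) \<Rightarrow> 'a::comm_ring_1 set"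
    and act :: "'a \<Rightarrow> 'm::ab_group_add \<Rightarrow> 'm"
    and Mg :: "('d \<Rightarrow> nat) \<Rightarrow> 'm set"
    and k :: "'d \<Rightarrow> nat"
    and xs :: "'a list"
    and ds :: "'d list"
  assumes "artinian_local_inf_residue (Sg zero_deg)"
    and "standard_graded_algebra Sg"
    and "fg_algebra Sg"
    and "graded_module Sg act Mg"
    and "fg_module act"
    and "mms Sg act xs ds k"
    and "dim_supp Sg act UNIV {0} \<le> ereal (real (\<Sum>i\<in>UNIV. k i))"
  shows "EE Sg act Mg k = real_of_int (chi Sg act Mg xs ds UNIV {0})
    \<and> chi Sg act Mg xs ds UNIV {0} = mm_symbol Sg act Mg xs UNIV {0}"
proof -
  interpret multigraded_module Sg act Mg
    using assms(1-5) unfolding standard_graded_algebra_def by unfold_locales auto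
  have x: "list_all2 (\<lambda>x j. x \<in> Sg (unit_vec j)) xs ds"
    and k: "mcount ds = k"
    and dim: "dim_supp Sg act UNIV (seq_mult act xs UNIV) \<le> ereal (real 0)"
    using assms(6) unfolding mms_def by (auto simp: list_all2_conv_all_nth mcount_def fun_eq_iff zero_ereal_def)
  have len: "length ds = tdeg k" using tdeg_mcount[of ds] k by simp
  note h0 = hsub_singleton_0 hsub_UNIV subset_UNIV[of "{0}"]
  \<comment> \<open>Dimension at most 0 means chains of at most one prime;
    \<open>Supp_quotient\<close> carries this over to the primes in the support of M that contain
    the sequence.\<close>
  have "chain_le 1 (Supp UNIV (seq_mult act xs UNIV))"
    using dim_supp_le_imp_chain_le[OF dim] by simp
  then have "chain_le 1 {P \<in> Supp UNIV {0}. set xs \<subseteq> P}"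
    by (rule chain_le_mono) (use Supp_quotient in blast)
  from mm_symbol_eq_fdiffs[OF x h0 this] obtain v where
    v: "\<forall>n\<ge>v. fdiffs ds (\<lambda>n. int (hl UNIV {0} n)) n = mm_symbol Sg act Mg xs UNIV {0}" ..
  have chi: "chi Sg act Mg xs ds UNIV {0} = mm_symbol Sg act Mg xs UNIV {0}" by (rule chi_eq[OF x v])
  \<comment> \<open>If |k| exceeds the dimension, the smaller bound excludes monomials of degree
    |k|, so the iterated difference is zero, in agreement with E(M;k) = 0. Dimension minus infinity
    falls under this case.\<close>
  define t where "t = (if ereal (real (tdeg k)) = dim_supp Sg act UNIV {0} then Suc (tdeg k) else tdeg k)"
  have "chain_le t (Supp UNIV {0})"
  proof (cases "ereal (real (tdeg k)) = dim_supp Sg act UNIV {0}")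
    case True
    then show ?thesis unfolding t_def using dim_supp_le_imp_chain_le[of UNIV "{0}" "tdeg k"] by simp
  next
    case False
    then have "dim_supp Sg act UNIV {0} < ereal (real (tdeg k))"
      using assms(7) unfolding tdeg_def by (simp add: order_less_le)
    then show ?thesis unfolding t_def using False dim_supp_less_imp_chain_le[of UNIV "{0}" "tdeg k"] by simp
  qed
  from hilbert_polynomial[OF h0 this] obtain p w where
    p: "p \<in> poly_fun t" "\<forall>n\<ge>w. real (hl UNIV {0} n) = p n" by blast
  from p(1) obtain c where c: "p = (\<lambda>n. \<Sum>l | tdeg l < t. c l * monom_fun l n)" by (rule poly_funE)
  \<comment> \<open>The values of c in degrees t and above are arbitrary, whereas
    \<open>hilb_coeff\<close> records every nonzero coefficient, so they are cut off.\<close>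
  define c' where "c' l = (if tdeg l < t then c l else 0)" for l
  have p1: "p n = (\<Sum>l | tdeg l < Suc (length ds). c' l * monom_fun l n)" for n
    unfolding c by (rule sum.mono_neutral_cong_left) (auto simp: finite_tdeg c'_def t_def len split: if_splits)
  have p2: "p n = (\<Sum>l | c' l \<noteq> 0. c' l * monom_fun l n)" for n
    unfolding c by (rule sum.mono_neutral_cong_right) (auto simp: finite_tdeg c'_def)
  have fin: "finite {l. c' l \<noteq> 0}"
    by (rule finite_subset[OF _ finite_tdeg[of t]]) (auto simp: c'_def)
  have coeff: "hilb_coeff Sg act Mg = c'"
    by (rule hilb_coeff_eq[OF fin, of w]) (use p(2) p2 in simp)
  let ?n = "sup v w"
  have "fdiffs ds (\<lambda>n. real_of_int (int (hl UNIV {0} n))) ?n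
      = fdiffs ds (\<lambda>n. \<Sum>l | tdeg l < Suc (length ds). c' l * monom_fun l n) ?n"
  proof (rule fdiffs_cong[of w])
    fix n assume "w \<le> n"
    then show "real_of_int (int (hl UNIV {0} n)) = (\<Sum>l | tdeg l < Suc (length ds). c' l * monom_fun l n)"
      using p(2) p1[of n] by simp
  qed simp
  then have "real_of_int (fdiffs ds (\<lambda>n. int (hl UNIV {0} n)) ?n) = c' k * (\<Prod>i\<in>UNIV. fact (k i))"
    unfolding fdiffs_of_int fdiffs_poly k .
  moreover have "fdiffs ds (\<lambda>n. int (hl UNIV {0} n)) ?n = mm_symbol Sg act Mg xs UNIV {0}" using v by simp
  ultimately have "real_of_int (mm_symbol Sg act Mg xs UNIV {0}) = c' k * (\<Prod>i\<in>UNIV. fact (k i))" by simp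
  moreover have "EE Sg act Mg k = c' k * (\<Prod>i\<in>UNIV. fact (k i))"
  proof (cases "ereal (real (tdeg k)) = dim_supp Sg act UNIV {0}")
    case True
    then show ?thesis unfolding EE_def mixed_mult_def coeff tdeg_def by simp
  next
    case False
    then have "c' k = 0" unfolding c'_def t_def by simp
    then show ?thesis using False unfolding EE_def tdeg_def by simp
  qed
  ultimately show ?thesis using chi by simp
qed

end
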